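(* Let $f$ be a polynomial, let $\mathcal{C}(t)$ be the evolution of an $n\times n$ CMV matrix under the Hamiltonian $\phi(\mathcal{C})=\mathrm{Im}\,\mathrm{tr}(f(\mathcal{C}))$, and let $\alpha_j(t)$ be its Verblunsky coefficients. Let $z_1,\ldots,z_n$ be the (time-independent) eigenvalues, $\mu_1,\ldots,\mu_n$ the corresponding masses of the spectral measure at time $0$, and $\lambda_k=2\,\mathrm{Re}[z_kf'(z_k)]$, labelled so that $\lambda_1\ge\lambda_2\ge\cdots\ge\lambda_n$. Fix $1\le k\le n-1$. Let $B_k=\{l:\lambda_l=\lambda_k\}$ and let $s(k)$ be the largest index less than $k$ not contained in $B_k$ (with $s(k)=0$ if there is none). Then, as $t\to\infty$, $$\alpha_{k-1}(t)\to(-1)^{k-1}\,\bar z_J\,\frac{\sum|\Delta_{J\cup I}|^2\mu_I\bar z_I}{\sum|\Delta_{J\cup I}|^2\mu_I},$$ where $J=(1<2<\cdots<s(k))$ and both sums are over all ordered multi-indices $I\subseteq B_k$ of length $k-s(k)$. In particular, $|\alpha_{k-1}|\to1$ if and only if $\lambda_k>\lambda_{k+1}$. If all $\lambda_j$ are distinct, then as $t\to\infty$ $$\alpha_{k-1}(t)=(-1)^{k-1}\bar z_1\cdots\bar z_k\left[1+\xi_{k-1}e^{-(\lambda_k-\lambda_{k+1})t}+O(e^{-\gamma t})\right],$$ where $$\xi_{k-1}=(z_k\bar z_{k+1}-1)\frac{\mu_{k+1}}{\mu_k}\prod_{l=1}^{k-1}\left|\frac{z_{k+1}-z_l}{z_k-z_l}\right|^2$$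 and $\gamma>(\lambda_k-\lambda_{k+1})>0$.
   Context: CMV matrices: given Verblunsky coefficients $\alpha_0,\ldots,\alpha_{n-2}$ in the open unit disk and $\alpha_{n-1}$ on the unit circle, put $\rho_k=\sqrt{1-|\alpha_k|^2}$, $\Xi_k=\begin{bmatrix}\bar\alpha_k&\rho_k\\ \rho_k&-\alpha_k\end{bmatrix}$ for $0\le k\le n-2$, $\Xi_{-1}=[1]$, $\Xi_{n-1}=[\bar\alpha_{n-1}]$. The CMV matrix is $\mathcal{C}=\mathcal{L}\mathcal{M}$ with $n\times n$ block-diagonal $\mathcal{L}=\mathrm{diag}(\Xi_0,\Xi_2,\ldots)$, $\mathcal{M}=\mathrm{diag}(\Xi_{-1},\Xi_1,\Xi_3,\ldots)$. Its eigenvalues $z_1,\dots,z_n$ are distinct, and the spectral measure of $(\mathcal{C},e_1)$, $e_1=[1,0,\dots,0]^T$, is $\sum_k\mu_k\delta_{z_k}$ with $\mu_k>0$, i.e. $\langle e_1|h(\mathcal{C})e_1\rangle=\sum_k h(z_k)\mu_k$. Multi-index notation: for an ordered multi-index $I=(i_1<\cdots<i_l)$, $\mu_I=\prod_k\mu_{i_k}$, $z_I=\prod_kz_{i_k}$ and $\Delta_I=\prod_{1\le j<k\le l}(z_{i_k}-z_{i_j})$ (empty products equal $1$). Flow: let $\mathfrak{g}$ be the $n\times n$ complex matrices viewed as a real manifold; $\mathfrak{g}=\mathfrak{l}\oplus\mathfrak{a}$ with $\mathfrak{a}=\{A:A=-A^\dagger\}$ and $\mathfrak{l}$ the lower triangular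 matrices with real diagonal; $\pi_{\mathfrak l},\pi_{\mathfrak a}$ the projections, $R=\pi_{\mathfrak l}-\pi_{\mathfrak a}$. With $\langle X,Y\rangle=\mathrm{Im}\,\mathrm{tr}(XY)$ and $\nabla\phi$ defined by $\frac{d}{dt}|_{t=0}\phi(B+tC)=\langle\nabla\phi|_B,C\rangle$, the Poisson bracket is $\{\phi,\psi\}|_B=\tfrac12\langle R(XB),YB\rangle-\tfrac12\langle R(BX),BY\rangle$, $X=\nabla\phi|_B$, $Y=\nabla\psi|_B$, and the flow of $\phi$ satisfies $\dot\psi=\{\phi,\psi\}$ for all $\psi$. For $\phi=\mathrm{Im}\,\mathrm{tr} f$ this is $\dot{\mathcal{C}}=-[\mathcal{C},\pi_{\mathfrak a}(\mathcal{C}f'(\mathcal{C}))]$; it preserves CMV matrices and their eigenvalues. *)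

theory Defs
  imports
    "HOL-Analysis.Analysis"
    "HOL-Computational_Algebra.Polynomial"
    "HOL-Library.Landau_Symbols"
begin

text \<open>
  The size \<open>n\<close> is \<open>CARD('n)\<close> for an arbitrary finite linearly ordered index type \<open>'n\<close>.
  Rows and columns are numbered from \<open>0\<close> in increasing order, in accordance with the
  numbering \<open>\<alpha>\<^sub>0, \<dots>, \<alpha>\<^sub>n\<^sub>-\<^sub>1\<close> of the Verblunsky coefficients; eigenvalues, masses and
  multi-indices are numbered from \<open>1\<close>.
\<close>

definition idx :: "'n::{finite,linorder} \<Rightarrow> nat" where
  "idx i = card {j. j < i}"


subsection \<open>CMV matrices\<close>

definition verblunsky :: "nat \<Rightarrow> (nat \<Rightarrow> complex) \<Rightarrow> bool" where
  "verblunsky n \<alpha> \<longleftrightarrow> (\<forall>k. k + 1 < n \<longrightarrow> norm (\<alpha> k) < 1) \<and> norm (\<alpha> (n - 1)) = 1"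

definition Xi :: "complex \<Rightarrow> nat \<Rightarrow> nat \<Rightarrow> complex" where
  "Xi a p q =
    (if p = 0 \<and> q = 0 then cnj a
     else if p = 1 \<and> q = 1 then - a
     else complex_of_real (sqrt (1 - (norm a)\<^sup>2)))"

text \<open>
  \<open>\<Xi>\<^sub>k\<close> sits in rows and columns \<open>k\<close>, \<open>k + 1\<close>. For \<open>k = n - 1\<close> only row and column \<open>n - 1\<close>
  exist, so that the truncated block is \<open>[cnj \<alpha>\<^sub>n\<^sub>-\<^sub>1]\<close>, as it should be.
\<close>

definition Xi_placed :: "(nat \<Rightarrow> complex) \<Rightarrow> nat \<Rightarrow> complex^'n::{finite,linorder}^'n::{finite,linorder}" where
  "Xi_placed \<alpha> k = (\<chi> i j.
     if idx i \<in> {k, k + 1} \<and> idx j \<in> {k, k + 1} then Xi (\<alpha> k) (idx i - k) (idx j - k) else 0)"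

definition cmv_L :: "(nat \<Rightarrow> complex) \<Rightarrow> complex^'n::{finite,linorder}^'n::{finite,linorder}" where
  "cmv_L \<alpha> = (\<Sum>k | k < CARD('n) \<and> even k. Xi_placed \<alpha> k)"

text \<open>The first summand is the block \<open>\<Xi>\<^sub>-\<^sub>1 = [1]\<close>.\<close>

definition cmv_M :: "(nat \<Rightarrow> complex) \<Rightarrow> complex^'n::{finite,linorder}^'n::{finite,linorder}" where
  "cmv_M \<alpha> = (\<chi> i j. if idx i = 0 \<and> idx j = 0 then 1 else 0)
     + (\<Sum>k | k < CARD('n) \<and> odd k. Xi_placed \<alpha> k)"

definition cmv :: "(nat \<Rightarrow> complex) \<Rightarrow> complex^'n::{finite,linorder}^'n::{finite,linorder}" where
  "cmv \<alpha> = cmv_L \<alpha> ** cmv_M \<alpha>"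


subsection \<open>Spectral data\<close>

definition poly_mat :: "complex poly \<Rightarrow> complex^'n^'n \<Rightarrow> complex^'n^'n" where
  "poly_mat f A = (\<Sum>i\<le>degree f. mat (coeff f i) ** (((**) A ^^ i) (mat 1)))"

definition eigenvalues :: "complex^'n^'n \<Rightarrow> complex set" where
  "eigenvalues A = {w. \<exists>v. v \<noteq> 0 \<and> A *v v = w *s v}"

definition e1 :: "complex^'n::{finite,linorder}" where
  "e1 = (\<chi> i. if idx i = 0 then 1 else 0)"

definition hinner :: "complex^'n \<Rightarrow> complex^'n \<Rightarrow> complex" where
  "hinner u v = (\<Sum>i\<in>UNIV. cnj (u $ i) * v $ i)"

text \<open>
  \<open>z\<^sub>1, \<dots>, z\<^sub>n\<close> are the distinct eigenvalues of \<open>A\<close>, and the spectral measure of \<open>(A, e\<^sub>1)\<close> is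
  the sum of the point masses \<open>\<mu>\<^sub>k\<close> at \<open>z\<^sub>k\<close>. Since the support is finite, it suffices to test
  against polynomials \<open>h\<close>.
\<close>

definition spectral_data ::
    "complex^'n::{finite,linorder}^'n::{finite,linorder} \<Rightarrow> (nat \<Rightarrow> complex) \<Rightarrow> (nat \<Rightarrow> real) \<Rightarrow> bool" where
  "spectral_data A z \<mu> \<longleftrightarrow>
     bij_betw z {1..CARD('n)} (eigenvalues A) \<and>
     (\<forall>h. hinner e1 (poly_mat h A *v e1) =
            (\<Sum>k=1..CARD('n). poly h (z k) * complex_of_real (\<mu> k)))"


subsection \<open>The Poisson bracket and its Hamiltonian flows\<close>

definition skew_hermitian :: "(complex^'n^'n) set" where
  "skew_hermitian = {A. \<forall>i j. A $ i $ j = - cnj (A $ j $ i)}"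

definition lower_real_diag :: "(complex^'n::{finite,linorder}^'n::{finite,linorder}) set" where
  "lower_real_diag = {A. (\<forall>i j. i < j \<longrightarrow> A $ i $ j = 0) \<and> (\<forall>i. A $ i $ i \<in> \<real>)}"

definition pi_a :: "complex^'n::{finite,linorder}^'n::{finite,linorder} \<Rightarrow> complex^'n::{finite,linorder}^'n::{finite,linorder}" where
  "pi_a X = (THE A. A \<in> skew_hermitian \<and> X - A \<in> lower_real_diag)"

definition pi_l :: "complex^'n::{finite,linorder}^'n::{finite,linorder} \<Rightarrow> complex^'n::{finite,linorder}^'n::{finite,linorder}" where
  "pi_l X = (THE L. L \<in> lower_real_diag \<and> X - L \<in> skew_hermitian)"

definition R_op :: "complex^'n::{finite,linorder}^'n::{finite,linorder} \<Rightarrow> complex^'n::{finite,linorder}^'n::{finite,linorder}" where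
  "R_op X = pi_l X - pi_a X"

definition pairing :: "complex^'n^'n \<Rightarrow> complex^'n^'n \<Rightarrow> real" where
  "pairing X Y = Im (trace (X ** Y))"

definition grad :: "(complex^'n^'n \<Rightarrow> real) \<Rightarrow> complex^'n^'n \<Rightarrow> complex^'n^'n" where
  "grad \<phi> B = (THE G. \<forall>D.
     ((\<lambda>t. \<phi> (B + t *\<^sub>R D)) has_real_derivative pairing G D) (at 0))"

definition poisson ::
    "(complex^'n::{finite,linorder}^'n::{finite,linorder} \<Rightarrow> real) \<Rightarrow> (complex^'n::{finite,linorder}^'n::{finite,linorder} \<Rightarrow> real)
      \<Rightarrow> complex^'n::{finite,linorder}^'n::{finite,linorder} \<Rightarrow> real"
  where
  "poisson \<phi> \<psi> B =
     (let X = grad \<phi> B; Y = grad \<psi> B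
      in pairing (R_op (X ** B)) (Y ** B) / 2 - pairing (R_op (B ** X)) (B ** Y) / 2)"

text \<open>
  Only the first derivative of the observable \<open>\<psi>\<close> enters, so letting \<open>\<psi>\<close> range over all
  differentiable functions gives the same flow as smooth ones. At \<open>t = 0\<close> the time derivative
  is one-sided.
\<close>

definition hamiltonian_flow ::
    "(complex^'n::{finite,linorder}^'n::{finite,linorder} \<Rightarrow> real) \<Rightarrow> (real \<Rightarrow> complex^'n::{finite,linorder}^'n::{finite,linorder}) \<Rightarrow> bool" where
  "hamiltonian_flow \<phi> C \<longleftrightarrow>
     (\<forall>\<psi> t. (\<forall>B. \<psi> differentiable (at B)) \<longrightarrow> 0 \<le> t \<longrightarrow>
        ((\<lambda>s. \<psi> (C s)) has_real_derivative poisson \<phi> \<psi> (C t)) (at t within {0..}))"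


subsection \<open>Multi-indices\<close>

text \<open>
  An ordered multi-index \<open>i\<^sub>1 < \<dots> < i\<^sub>l\<close> is represented by the finite set \<open>{i\<^sub>1, \<dots>, i\<^sub>l}\<close>; then
  \<open>\<mu>\<^sub>I\<close> and \<open>z\<^sub>I\<close> are products over this set.
\<close>

definition Delta :: "(nat \<Rightarrow> complex) \<Rightarrow> nat set \<Rightarrow> complex" where
  "Delta z I = (\<Prod>(i, j) \<in> {(i, j). i \<in> I \<and> j \<in> I \<and> i < j}. z j - z i)"

definition Bset :: "nat \<Rightarrow> (nat \<Rightarrow> real) \<Rightarrow> nat \<Rightarrow> nat set" where
  "Bset n lam k = {l \<in> {1..n}. lam l = lam k}"

definition s_index :: "nat \<Rightarrow> (nat \<Rightarrow> real) \<Rightarrow> nat \<Rightarrow> nat" where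
  "s_index n lam k = Max (insert 0 {l \<in> {1..<k}. l \<notin> Bset n lam k})"

definition Isets :: "nat \<Rightarrow> (nat \<Rightarrow> real) \<Rightarrow> nat \<Rightarrow> nat set set" where
  "Isets n lam k = {I. I \<subseteq> Bset n lam k \<and> card I = k - s_index n lam k}"

end

theory Submission
  imports Defs
begin

text \<open>
  Write \<open>A = \<pi>\<^sub>a (C f'(C))\<close>. The flow is \<open>C' = [A, C]\<close> with \<open>A\<close> skew-Hermitian, so
  \<open>h(C)' = [A, h(C)]\<close> for every polynomial \<open>h\<close> and the Frobenius norm of \<open>h(C)\<close> is constant;
  with suitable \<open>h\<close> this shows that every \<open>z\<^sub>j\<close> stays an eigenvalue. The matrices are unitary
  with simple spectrum, hence \<open>h(C) = V diag(h(z\<^sub>j)) V\<^sup>*\<close>, and the corner entry of the Lax equation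
  for the Lagrange polynomials gives \<open>\<mu>\<^sub>j' = (\<lambda>\<^sub>j - c(t)) \<mu>\<^sub>j\<close>: up to a common factor the masses at time
  \<open>t\<close> are \<open>e\<^bsup>\<lambda>\<^sub>j t\<^esup> \<mu>\<^sub>j\<close>.

  The eigenvector components are, up to constants and powers of \<open>z\<close>, the orthogonal polynomials of the
  spectral measure, whose values at \<open>0\<close> are \<open>- cnj \<alpha>\<^sub>k\<^sub>-\<^sub>1\<close>. By Heine's formula, \<open>\<alpha>\<^sub>k\<^sub>-\<^sub>1\<close> is
  \<open>(-1)\<^sup>k\<^sup>-\<^sup>1\<close> times the average of \<open>cnj z\<^sub>I\<close> over all \<open>k\<close>-sets \<open>I\<close> with weights
  \<open>|\<Delta>\<^sub>I|\<^sup>2 \<mu>\<^sub>I e\<^bsup>\<lambda>\<^sub>I t\<^esup>\<close>, where \<open>\<lambda>\<^sub>I\<close> is the sum of the \<open>\<lambda>\<^sub>i\<close>. As \<open>t\<close> grows, the sets of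
  maximal \<open>\<lambda>\<^sub>I\<close> dominate; these are \<open>{1..s(k)} \<union> I\<close> with \<open>I \<subseteq> B\<^sub>k\<close>. If they do not reduce to one
  set, two distinct points of the circle are averaged, so that the limit lies inside the disk.
\<close>

subsection \<open>Complex matrices\<close>

text \<open>The hypotheses fix the spectrum only at time 0, and the eigenvectors of
  \<open>C t\<close> are chosen separately at each time, with no regularity in \<open>t\<close>.
  Conservation of Frobenius norms settles the first point without integrating the equation to a
  unitary conjugation: \<open>h(C t)\<close> vanishes exactly when \<open>h(C 0)\<close> does. For
  the second, the nodes being constant, each mass is a corner entry of one fixed Lagrange polynomial
  of \<open>C t\<close>, hence differentiable. The rate \<open>c(t)\<close> never has to be
  integrated: Heine's quotient is homogeneous in the masses, so a common factor cancels.
  Orthogonality of the polynomials needs no Gram-Schmidt process: consecutive rows of the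
  eigenvector matrix give one relation per degree, and the Szego recursion turns these into all the
  others.\<close>

definition hadj :: "complex^'n^'m \<Rightarrow> complex^'m^'n" where
  "hadj A = (\<chi> i j. cnj (A $ j $ i))"

lemma hadj_mult: "hadj (A ** B) = hadj B ** hadj A"
  by (simp add: hadj_def matrix_matrix_mult_def vec_eq_iff mult.commute)

lemma hadj_hadj [simp]: "hadj (hadj A) = A"
  by (simp add: hadj_def vec_eq_iff)

lemma matrix_mul_zero_left [simp]: "(0 :: 'a::semiring_1^'n^'m) ** A = 0"
  by (simp add: matrix_matrix_mult_def vec_eq_iff)

lemma matrix_mul_zero_right [simp]: "A ** (0 :: 'a::semiring_1^'n^'m) = 0"
  by (simp add: matrix_matrix_mult_def vec_eq_iff)

lemma matrix_mul_diff_left: "(A - B) ** C = A ** C - B ** (C :: 'a::ring_1^'n^'m)"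
  by (simp add: matrix_matrix_mult_def vec_eq_iff left_diff_distrib sum_subtractf)

lemma matrix_mul_diff_right: "C ** (A - B) = C ** A - C ** (B :: 'a::ring_1^'n^'m)"
  by (simp add: matrix_matrix_mult_def vec_eq_iff right_diff_distrib sum_subtractf)

lemma matrix_mul_minus_left: "(- A) ** C = - (A ** (C :: 'a::ring_1^'n^'m))"
  by (simp add: matrix_matrix_mult_def vec_eq_iff sum_negf)

lemma matrix_add_rdistrib: "(A + B) ** C = A ** C + B ** (C :: 'a::semiring_1^'n^'m)"
  by (simp add: matrix_matrix_mult_def vec_eq_iff distrib_right sum.distrib)

lemma matrix_mul_sum_right: "C ** sum f S = (\<Sum>i\<in>S. C ** (f i :: 'a::semiring_1^'n^'m))"
  by (induction S rule: infinite_finite_induct) (simp_all add: matrix_add_ldistrib)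

lemma matrix_mul_sum_left: "sum f S ** C = (\<Sum>i\<in>S. f i ** (C :: 'a::semiring_1^'n^'m))"
  by (induction S rule: infinite_finite_induct) (simp_all add: matrix_add_rdistrib)

lemma mat_mul_nth: "(mat a ** A) $ i $ j = a * A $ i $ j" for a :: "'a::semiring_1"
  by (simp add: matrix_matrix_mult_def mat_def if_distrib [of "\<lambda>x. x * _"] cong: if_cong)

lemma mat_mul_commute: "mat a ** A = A ** mat a" for a :: "'a::comm_semiring_1"
  by (simp add: vec_eq_iff mat_mul_nth)
     (simp add: matrix_matrix_mult_def mat_def if_distrib [of "\<lambda>x. _ * x"] mult.commute cong: if_cong)

lemma mat_add: "mat (a + b) = mat a + (mat b :: 'a::semiring_1^'n^'n)"
  by (simp add: mat_def vec_eq_iff)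

lemma mat_mult: "mat (a * b) = mat a ** (mat b :: 'a::semiring_1^'n^'n)"
  by (simp add: vec_eq_iff mat_mul_nth) (simp add: mat_def)

lemma mat_mul_vec: "mat a *v v = a *s v" for a :: "'a::semiring_1"
  by (simp add: matrix_vector_mult_def mat_def vec_eq_iff if_distrib [of "\<lambda>x. x * _"] cong: if_cong)

subsection \<open>Polynomials of a matrix\<close>

lemma poly_mat_0 [simp]: "poly_mat 0 A = 0"
  by (simp add: poly_mat_def)

lemma poly_mat_pCons: "poly_mat (pCons a p) A = mat a + A ** poly_mat p A"
proof (cases "p = 0")
  case True
  then show ?thesis by (cases "a = 0") (simp_all add: poly_mat_def)
next
  case False
  then have "poly_mat (pCons a p) A =
      mat a + (\<Sum>i\<le>degree p. mat (coeff p i) ** (A ** (((**) A ^^ i) (mat 1))))"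
    by (simp add: poly_mat_def sum.atMost_Suc_shift del: sum.atMost_Suc)
  also have "(\<Sum>i\<le>degree p. mat (coeff p i) ** (A ** (((**) A ^^ i) (mat 1)))) = A ** poly_mat p A"
    unfolding poly_mat_def matrix_mul_sum_right
    by (rule sum.cong) (metis mat_mul_commute matrix_mul_assoc)+
  finally show ?thesis .
qed

lemma poly_mat_add: "poly_mat (p + q) A = poly_mat p A + poly_mat q A"
  by (induction p q rule: poly_induct2) (simp_all add: poly_mat_pCons mat_add matrix_add_ldistrib)

lemma poly_mat_smult: "poly_mat (smult a p) A = mat a ** poly_mat p A"
proof (induction p)
  case (pCons b p)
  have "A ** (mat a ** poly_mat p A) = mat a ** (A ** poly_mat p A)"
    by (metis mat_mul_commute matrix_mul_assoc)
  then show ?case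
    using pCons by (simp add: poly_mat_pCons mat_mult matrix_add_ldistrib)
qed simp

lemma poly_mat_mult: "poly_mat (p * q) A = poly_mat p A ** poly_mat q A"
proof (induction p)
  case (pCons a p)
  then show ?case
    by (simp add: poly_mat_pCons poly_mat_add poly_mat_smult matrix_add_rdistrib matrix_mul_assoc)
qed simp

lemma poly_mat_commute:
  assumes "A ** K = K ** A"
  shows "poly_mat p A ** K = K ** poly_mat p A"
proof (induction p)
  case (pCons a p)
  have "A ** poly_mat p A ** K = K ** (A ** poly_mat p A)"
    using pCons assms by (metis matrix_mul_assoc)
  then show ?case
    by (simp add: poly_mat_pCons matrix_add_ldistrib matrix_add_rdistrib mat_mul_commute)
qed simp

text \<open>\<open>V\<close> intertwines \<open>A\<close> and \<open>B\<close>. With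
  \<open>B\<close> diagonal, its columns are eigenvectors, which is how the lemma is
  applied.\<close>

lemma poly_mat_mult_eigenvectors:
  assumes "A ** V = V ** B"
  shows "poly_mat p A ** V = V ** poly_mat p B"
proof (induction p)
  case (pCons a p)
  have "A ** poly_mat p A ** V = V ** (B ** poly_mat p B)"
    using pCons assms by (metis matrix_mul_assoc)
  then show ?case
    by (simp add: poly_mat_pCons matrix_add_ldistrib matrix_add_rdistrib mat_mul_commute)
qed simp

definition diag :: "('n \<Rightarrow> complex) \<Rightarrow> complex^'n^'n" where
  "diag g = (\<chi> i j. if i = j then g i else 0)"

lemma diag_mult: "diag g ** diag h = diag (\<lambda>i. g i * h i)"
  by (auto simp: diag_def matrix_matrix_mult_def vec_eq_iff if_distrib [of "\<lambda>x. x * _"]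
      if_distrib [of "\<lambda>x. _ * x"] cong: if_cong)

lemma matrix_mult_diag_nth: "(V ** diag g) $ i $ j = V $ i $ j * g j"
  by (simp add: diag_def matrix_matrix_mult_def if_distrib [of "\<lambda>x. _ * x"] cong: if_cong)

lemma hadj_diag: "hadj (diag g) = diag (\<lambda>i. cnj (g i))"
  by (auto simp: diag_def hadj_def vec_eq_iff)

lemma poly_mat_diag: "poly_mat p (diag g) = diag (\<lambda>i. poly p (g i))"
proof (induction p)
  case (pCons a p)
  have "mat a + diag h = diag (\<lambda>i. a + h i)" for h :: "'a \<Rightarrow> complex"
    by (auto simp: diag_def mat_def vec_eq_iff)
  with pCons show ?case by (simp add: poly_mat_pCons diag_mult)
qed (auto simp: diag_def vec_eq_iff)

lemma trace_mult_commute3: "trace (A ** B ** C) = trace (C ** A ** (B :: complex^'n^'n))"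
  by (metis trace_mul_sym matrix_mul_assoc)

subsection \<open>Numbering of the index type\<close>

lemma idx_less: "i < j \<Longrightarrow> idx i < idx (j :: 'n::{finite,linorder})"
  unfolding idx_def by (intro psubset_card_mono) auto

lemma bij_betw_idx: "bij_betw (idx :: 'n::{finite,linorder} \<Rightarrow> nat) UNIV {..<CARD('n)}"
proof -
  have inj: "inj (idx :: 'n \<Rightarrow> nat)"
  proof (rule injI)
    fix i j :: 'n
    assume "idx i = idx j"
    then show "i = j" using idx_less[of i j] idx_less[of j i] by (cases i j rule: linorder_cases) auto
  qed
  have "idx i < CARD('n)" for i :: 'n
    unfolding idx_def by (intro psubset_card_mono) auto
  then have "range (idx :: 'n \<Rightarrow> nat) \<subseteq> {..<CARD('n)}" by auto
  with inj have "range (idx :: 'n \<Rightarrow> nat) = {..<CARD('n)}"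
    by (intro card_subset_eq) (simp_all add: card_image)
  with inj show ?thesis by (simp add: bij_betw_def)
qed

lemma idx_less_CARD [simp]: "idx (i :: 'n::{finite,linorder}) < CARD('n)"
  using bij_betw_idx[where 'n='n] by (auto simp: bij_betw_def)

lemma idx_eq_iff [simp]: "idx (i :: 'n::{finite,linorder}) = idx j \<longleftrightarrow> i = j"
  using bij_betw_idx[where 'n='n] by (auto simp: bij_betw_def inj_eq)

text \<open>The inverse of \<open>idx\<close>; at \<open>k \<ge> CARD('n)\<close> the value is
  arbitrary, hence the range conditions below.\<close>

definition unidx :: "nat \<Rightarrow> 'n::{finite,linorder}" where
  "unidx = inv_into UNIV idx"

lemma idx_unidx [simp]: "k < CARD('n) \<Longrightarrow> idx (unidx k :: 'n::{finite,linorder}) = k"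
  unfolding unidx_def using bij_betw_inv_into_right[OF bij_betw_idx] by auto

lemma unidx_idx [simp]: "unidx (idx i) = i"
  unfolding unidx_def using bij_betw_inv_into_left[OF bij_betw_idx] by auto

lemma idx_eq_unidx: "k < CARD('n) \<Longrightarrow> idx (i :: 'n::{finite,linorder}) = k \<longleftrightarrow> i = unidx k"
  by (metis idx_unidx unidx_idx)

lemma sum_UNIV_unidx: "(\<Sum>i\<in>(UNIV :: 'n::{finite,linorder} set). g i) = (\<Sum>k<CARD('n). g (unidx k))"
  by (rule sum.reindex_bij_witness[of _ unidx idx]) auto

text \<open>Bridges the two numberings: rows from 0, eigenvalues and masses from 1.\<close>

lemma sum_UNIV_Suc_idx: "(\<Sum>j\<in>(UNIV :: 'n::{finite,linorder} set). g (Suc (idx j))) = (\<Sum>j=1..CARD('n). g j)"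
  by (rule sum.reindex_bij_witness[of _ "\<lambda>k. unidx (k - 1)" "\<lambda>j. Suc (idx j)"]) (auto simp: Suc_le_eq)

lemma unidx_0_less: "j \<noteq> unidx 0 \<Longrightarrow> unidx 0 < (j :: 'n::{finite,linorder})"
  using idx_less[of j "unidx 0"] by (cases j "unidx 0 :: 'n" rule: linorder_cases) auto

subsection \<open>The Lax equation\<close>

text \<open>The only candidate for the projection to the skew-Hermitian matrices: the complement
  vanishes above the diagonal and is real on it, so the strict upper triangle and the imaginary
  diagonal of \<open>X\<close> are forced, and skewness dictates the rest.\<close>

definition skew_part :: "complex^'n::{finite,linorder}^'n::{finite,linorder} \<Rightarrow> complex^'n::{finite,linorder}^'n::{finite,linorder}" where
  "skew_part X = (\<chi> i j. if i < j then X $ i $ j else if j < i then - cnj (X $ j $ i)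
     else \<i> * of_real (Im (X $ i $ i)))"

lemma skew_part_in: "skew_part X \<in> skew_hermitian"
  by (auto simp: skew_part_def skew_hermitian_def not_less)

lemma skew_part_diff_in: "X - skew_part X \<in> lower_real_diag"
  by (auto simp: skew_part_def lower_real_diag_def complex_is_Real_iff)

text \<open>Directness of the splitting, which makes the \<open>THE\<close> descriptions of both
  projections unique.\<close>

lemma skew_inter_lower:
  assumes "A \<in> skew_hermitian" "A \<in> lower_real_diag"
  shows "A = 0"
proof -
  have sk: "A $ i $ j = - cnj (A $ j $ i)" for i j
    using assms(1) unfolding skew_hermitian_def by blast
  have lo: "i < j \<Longrightarrow> A $ i $ j = 0" and re: "A $ i $ i \<in> \<real>" for i j
    using assms(2) by (auto simp: lower_real_diag_def)
  have "A $ i $ j = 0" for i j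
  proof (cases i j rule: linorder_cases)
    case equal
    then show ?thesis using sk[of i i] re[of i] by (auto simp: complex_eq_iff complex_is_Real_iff)
  next
    case greater
    then show ?thesis using sk[of i j] lo[of j i] by simp
  qed (rule lo)
  then show ?thesis by (simp add: vec_eq_iff)
qed

lemma skew_hermitian_diff:
  assumes "A \<in> skew_hermitian" "B \<in> skew_hermitian"
  shows "A - B \<in> skew_hermitian"
  unfolding skew_hermitian_def mem_Collect_eq
proof (intro allI)
  fix i j
  have "A $ i $ j = - cnj (A $ j $ i)" "B $ i $ j = - cnj (B $ j $ i)"
    using assms unfolding skew_hermitian_def by blast+
  then show "(A - B) $ i $ j = - cnj ((A - B) $ j $ i)" by simp
qed

lemma lower_real_diag_diff: "A \<in> lower_real_diag \<Longrightarrow> B \<in> lower_real_diag \<Longrightarrow> A - B \<in> lower_real_diag"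
  by (auto simp: lower_real_diag_def)

lemma pi_a_eq: "pi_a X = skew_part X"
  unfolding pi_a_def
proof (rule the_equality)
  fix A assume A: "A \<in> skew_hermitian \<and> X - A \<in> lower_real_diag"
  have "(X - skew_part X) - (X - A) \<in> lower_real_diag"
    using A skew_part_diff_in by (blast intro: lower_real_diag_diff)
  moreover have "A - skew_part X \<in> skew_hermitian"
    using A skew_part_in by (blast intro: skew_hermitian_diff)
  ultimately have "A - skew_part X = 0" by (intro skew_inter_lower) simp_all
  then show "A = skew_part X" by simp
qed (simp add: skew_part_in skew_part_diff_in)

lemma pi_l_eq: "pi_l X = X - skew_part X"
  unfolding pi_l_def
proof (rule the_equality)
  fix L assume A: "L \<in> lower_real_diag \<and> X - L \<in> skew_hermitian"
  have "L - (X - skew_part X) \<in> lower_real_diag"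
    using A skew_part_diff_in by (blast intro: lower_real_diag_diff)
  moreover have "skew_part X - (X - L) \<in> skew_hermitian"
    using A skew_part_in by (blast intro: skew_hermitian_diff)
  ultimately have "L - (X - skew_part X) = 0" by (intro skew_inter_lower) (simp_all add: algebra_simps)
  then show "L = X - skew_part X" by simp
qed (simp add: skew_part_in skew_part_diff_in)

section \<open>The pairing, gradients and the Poisson bracket\<close>

definition mat_unit :: "'n \<Rightarrow> 'n \<Rightarrow> complex \<Rightarrow> complex^'n^'n" where
  "mat_unit i j c = (\<chi> p q. if p = i \<and> q = j then c else 0)"

lemma trace_mat_unit: "trace (mat_unit i j c ** A) = c * A $ j $ i"
proof -
  have "(mat_unit i j c ** A) $ p $ q = (if p = i then c * A $ j $ q else 0)" for p q
  proof -
    have "(mat_unit i j c ** A) $ p $ q = (\<Sum>l\<in>UNIV. if l = j then (if p = i then c * A $ j $ q else 0) else 0)"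
      unfolding matrix_matrix_mult_def mat_unit_def
      by (simp, intro impI, subst sum.remove[of _ j], auto)
    then show ?thesis by simp
  qed
  then show ?thesis by (simp add: trace_def)
qed

text \<open>The pairing with a matrix unit with entry \<open>c\<close> is the imaginary part of
  \<open>c\<close> times an entry; \<open>c = 1\<close> and \<open>c = \<i>\<close> recover
  imaginary and real part. This also makes gradients unique.\<close>

lemma pairing_nondegenerate:
  assumes "\<And>D. pairing G D = pairing H D"
  shows "G = H"
proof -
  have "G $ j $ i = H $ j $ i" for i j
    using assms[of "mat_unit i j 1"] assms[of "mat_unit i j \<i>"]
    unfolding pairing_def by (simp add: trace_mul_sym[of _ "mat_unit _ _ _"] trace_mat_unit complex_eq_iff)
  then show ?thesis by (simp add: vec_eq_iff)
qed

lemma grad_unique: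
  assumes "\<And>D. ((\<lambda>t. \<phi> (B + t *\<^sub>R D)) has_real_derivative pairing G D) (at 0)"
  shows "grad \<phi> B = G"
  unfolding grad_def
proof (rule the_equality)
  fix H assume H: "\<forall>D. ((\<lambda>t. \<phi> (B + t *\<^sub>R D)) has_real_derivative pairing H D) (at 0)"
  show "H = G"
    by (rule pairing_nondegenerate) (metis assms H DERIV_unique)
qed (use assms in blast)

text \<open>Taken entrywise, so that the product rule reduces to finite sums of scalar
  products.\<close>

definition has_mat_derivative :: "(real \<Rightarrow> complex^'n^'m) \<Rightarrow> complex^'n^'m \<Rightarrow> real filter \<Rightarrow> bool" where
  "has_mat_derivative Y D F \<longleftrightarrow> (\<forall>i j. ((\<lambda>t. Y t $ i $ j) has_vector_derivative D $ i $ j) F)"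

lemma has_mat_derivative_mult:
  assumes "has_mat_derivative Y D (at t within S)" "has_mat_derivative Z E (at t within S)"
  shows "has_mat_derivative (\<lambda>s. Y s ** Z s) (D ** Z t + Y t ** E) (at t within S)"
  unfolding has_mat_derivative_def
proof (intro allI)
  fix i j
  have "((\<lambda>s. \<Sum>l\<in>UNIV. Y s $ i $ l * Z s $ l $ j) has_vector_derivative
      (\<Sum>l\<in>UNIV. Y t $ i $ l * E $ l $ j + D $ i $ l * Z t $ l $ j)) (at t within S)"
    using assms unfolding has_mat_derivative_def
    by (intro has_vector_derivative_sum has_vector_derivative_mult) auto
  then show "((\<lambda>s. (Y s ** Z s) $ i $ j) has_vector_derivative (D ** Z t + Y t ** E) $ i $ j) (at t within S)"
    by (simp add: matrix_matrix_mult_def sum.distrib add.commute)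
qed

lemma has_mat_derivative_const_add:
  assumes "has_mat_derivative Y D F"
  shows "has_mat_derivative (\<lambda>s. K + Y s) D F"
  using assms unfolding has_mat_derivative_def by (auto intro!: derivative_eq_intros)

lemma has_mat_derivative_const: "has_mat_derivative (\<lambda>s. K) 0 F"
  unfolding has_mat_derivative_def by (auto intro!: derivative_eq_intros)

text \<open>As \<open>B\<close> and \<open>D\<close> need not commute, \<open>W\<close> has no
  simple closed form, but under a trace against a matrix \<open>K\<close> commuting with
  \<open>B\<close> the factors can be rotated together. The quantifier over \<open>K\<close> drives
  the induction: the factor \<open>B\<close> split off from \<open>pCons a h\<close> is absorbed
  into \<open>K ** B\<close>, which again commutes with \<open>B\<close>.\<close>

lemma trace_poly_mat_derivative:
  fixes B D :: "complex^'n^'n"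
  shows "\<exists>W. has_mat_derivative (\<lambda>t. poly_mat h (B + t *\<^sub>R D)) W (at 0) \<and>
    (\<forall>K. B ** K = K ** B \<longrightarrow> trace (K ** W) = trace (K ** poly_mat (pderiv h) B ** D))"
proof (induction h)
  case 0
  have "trace (0 :: complex^'n^'n) = 0" by (simp add: trace_def)
  then show ?case
    by (intro exI[of _ 0]) (simp add: has_mat_derivative_const)
next
  case (pCons a h)
  then obtain W where W: "has_mat_derivative (\<lambda>t. poly_mat h (B + t *\<^sub>R D)) W (at 0)"
    and tr: "\<And>K. B ** K = K ** B \<Longrightarrow> trace (K ** W) = trace (K ** poly_mat (pderiv h) B ** D)"
    by blast
  have lin: "has_mat_derivative (\<lambda>t. B + t *\<^sub>R D) D (at 0)"
    unfolding has_mat_derivative_def by (auto intro!: derivative_eq_intros)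
  let ?W = "D ** poly_mat h B + B ** W"
  have "has_mat_derivative (\<lambda>t. poly_mat (pCons a h) (B + t *\<^sub>R D)) ?W (at 0)"
    using has_mat_derivative_const_add[OF has_mat_derivative_mult[OF lin W]]
    by (simp add: poly_mat_pCons)
  moreover have "trace (K ** ?W) = trace (K ** poly_mat (pderiv (pCons a h)) B ** D)"
    if K: "B ** K = K ** B" for K
  proof -
    have KB: "B ** (K ** B) = (K ** B) ** B"
      using K by (simp add: matrix_mul_assoc)
    have "trace (K ** D ** poly_mat h B) = trace (K ** poly_mat h B ** D)"
      using poly_mat_commute[OF K, of h] by (metis trace_mul_sym matrix_mul_assoc)
    then show ?thesis using tr[OF KB]
      by (simp add: pderiv_pCons poly_mat_add poly_mat_pCons matrix_add_ldistrib matrix_add_rdistrib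
          matrix_mul_assoc trace_add)
  qed
  ultimately show ?case by blast
qed

lemma has_mat_derivative_trace:
  assumes "has_mat_derivative Y D F"
  shows "((\<lambda>s. trace (Y s)) has_vector_derivative trace D) F"
  using assms unfolding has_mat_derivative_def trace_def by (auto intro!: derivative_eq_intros)

lemma has_vector_derivative_Im:
  assumes "(f has_vector_derivative d) F"
  shows "((\<lambda>s. Im (f s)) has_real_derivative Im d) F"
  using assms bounded_linear.has_vector_derivative[OF bounded_linear_Im]
  by (simp add: has_real_derivative_iff_has_vector_derivative)

lemma has_vector_derivative_Re:
  assumes "(f has_vector_derivative d) F"
  shows "((\<lambda>s. Re (f s)) has_real_derivative Re d) F"
  using assms bounded_linear.has_vector_derivative[OF bounded_linear_Re]
  by (simp add: has_real_derivative_iff_has_vector_derivative)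

lemma has_vector_derivative_complexI:
  assumes "((\<lambda>s. Re (f s)) has_real_derivative Re d) F" "((\<lambda>s. Im (f s)) has_real_derivative Im d) F"
  shows "(f has_vector_derivative d) F"
proof -
  have "((\<lambda>s. of_real (Re (f s)) + \<i> * of_real (Im (f s))) has_vector_derivative
      (of_real (Re d) + \<i> * of_real (Im d))) F"
    using assms
    by (intro has_vector_derivative_add has_vector_derivative_of_real
        bounded_linear.has_vector_derivative[OF bounded_linear_mult_right])
  then show ?thesis by (simp add: complex_eq[symmetric])
qed

lemma grad_trace_poly_mat:
  fixes B :: "complex^'n^'n"
  shows "grad (\<lambda>B. Im (trace (poly_mat f B))) B = poly_mat (pderiv f) B"
proof (rule grad_unique)
  fix D :: "complex^'n^'n"
  obtain W where W: "has_mat_derivative (\<lambda>t. poly_mat f (B + t *\<^sub>R D)) W (at 0)"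
    "\<And>K. B ** K = K ** B \<Longrightarrow> trace (K ** W) = trace (K ** poly_mat (pderiv f) B ** D)"
    using trace_poly_mat_derivative by blast
  from W(2)[of "mat 1"] have "trace W = trace (poly_mat (pderiv f) B ** D)" by simp
  then show "((\<lambda>t. Im (trace (poly_mat f (B + t *\<^sub>R D)))) has_real_derivative
      pairing (poly_mat (pderiv f) B) D) (at 0)"
    using has_vector_derivative_Im[OF has_mat_derivative_trace[OF W(1)]] by (simp add: pairing_def)
qed

lemma linear_pairing: "linear (pairing G)"
proof (rule linearI)
  show "pairing G (A + B) = pairing G A + pairing G B" for A B
    by (simp add: pairing_def matrix_add_ldistrib trace_add)
  show "pairing G (r *\<^sub>R A) = r *\<^sub>R pairing G A" for r A
    by (simp add: pairing_def matrix_matrix_mult_def trace_def sum_distrib_left)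
qed

lemma grad_pairing:
  fixes B :: "complex^'n^'n"
  shows "grad (pairing G) B = G"
proof (rule grad_unique)
  fix D :: "complex^'n^'n"
  interpret linear "pairing G :: complex^'n^'n \<Rightarrow> real" by (rule linear_pairing)
  show "((\<lambda>t. pairing G (B + t *\<^sub>R D)) has_real_derivative pairing G D) (at 0)"
    unfolding add scale by (auto intro!: derivative_eq_intros)
qed

text \<open>Linear observables suffice as tests, since they include the real and imaginary parts of
  all entries. \<open>X = f'(B)\<close> commutes with \<open>B\<close>, so both arguments of
  \<open>R_op\<close> equal \<open>B ** X\<close>, and \<open>R_op (B ** X) = B ** X - 2 A\<close>.
  The contributions of \<open>B ** X\<close> cancel after rotation under the trace, and the factor
  1/2 removes the 2.\<close>

lemma poisson_trace_poly_mat: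
  "poisson (\<lambda>B. Im (trace (poly_mat f B))) (pairing G) B =
     pairing G (pi_a (B ** poly_mat (pderiv f) B) ** B - B ** pi_a (B ** poly_mat (pderiv f) B))"
proof -
  define X where "X = poly_mat (pderiv f) B"
  define A where "A = pi_a (B ** X)"
  have XB: "X ** B = B ** X" unfolding X_def by (rule poly_mat_commute) simp
  have R: "R_op (B ** X) = B ** X - A - A"
    by (simp add: R_op_def pi_l_eq A_def pi_a_eq)
  have rot: "trace (P ** (G ** B)) = trace (G ** (B ** P))" "trace (P ** (B ** G)) = trace (G ** (P ** B))" for P
    by (metis trace_mul_sym matrix_mul_assoc)+
  have "trace ((B ** X - A - A) ** (G ** B)) = trace (G ** (B ** (B ** X))) - trace (G ** (B ** A)) - trace (G ** (B ** A))"
    by (simp only: rot matrix_mul_diff_right trace_sub)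
  moreover have "trace ((B ** X - A - A) ** (B ** G)) = trace (G ** (B ** X ** B)) - trace (G ** (A ** B)) - trace (G ** (A ** B))"
    by (simp only: rot matrix_mul_diff_right matrix_mul_diff_left trace_sub)
  moreover have "B ** X ** B = B ** (B ** X)" using XB by (metis matrix_mul_assoc)
  ultimately have "poisson (\<lambda>B. Im (trace (poly_mat f B))) (pairing G) B
    = pairing G (A ** B - B ** A)"
    unfolding poisson_def Let_def grad_pairing grad_trace_poly_mat X_def[symmetric] XB R pairing_def
    by (simp add: matrix_mul_diff_right trace_sub diff_divide_distrib)
  then show ?thesis by (simp add: A_def X_def)
qed

lemma hamiltonian_flow_lax:
  fixes C :: "real \<Rightarrow> complex^'n::{finite,linorder}^'n::{finite,linorder}"
  assumes "hamiltonian_flow (\<lambda>B. Im (trace (poly_mat f B))) C" and t: "0 \<le> t"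
  defines "A \<equiv> pi_a (C t ** poly_mat (pderiv f) (C t))"
  shows "has_mat_derivative C (A ** C t - C t ** A) (at t within {0..})"
proof -
  have *: "((\<lambda>s. pairing G (C s)) has_real_derivative pairing G (A ** C t - C t ** A)) (at t within {0..})" for G
  proof -
    have "\<forall>B. pairing G differentiable (at B)"
      using linear_pairing linear_imp_differentiable by blast
    then show ?thesis
      using assms(1) t unfolding hamiltonian_flow_def A_def poisson_trace_poly_mat[symmetric] by blast
  qed
  show ?thesis
    unfolding has_mat_derivative_def
  proof (intro allI has_vector_derivative_complexI)
    fix i j
    \<comment> \<open>The indices of the matrix unit are swapped because
      \<open>trace_mat_unit\<close> transposes them.\<close>
    show "((\<lambda>s. Re (C s $ i $ j)) has_real_derivative Re ((A ** C t - C t ** A) $ i $ j)) (at t within {0..})"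
      using *[of "mat_unit j i \<i>"] unfolding pairing_def trace_mat_unit by simp
    show "((\<lambda>s. Im (C s $ i $ j)) has_real_derivative Im ((A ** C t - C t ** A) $ i $ j)) (at t within {0..})"
      using *[of "mat_unit j i 1"] unfolding pairing_def trace_mat_unit by simp
  qed
qed

text \<open>Taking the commutator with \<open>A t\<close> is a derivation, so the product rule
  carries the equation through Horner's scheme.\<close>

lemma lax_poly_mat:
  assumes "has_mat_derivative C (A ** C t - C t ** A) (at t within S)"
  shows "has_mat_derivative (\<lambda>s. poly_mat h (C s)) (A ** poly_mat h (C t) - poly_mat h (C t) ** A) (at t within S)"
proof (induction h)
  case 0
  show ?case by (simp add: has_mat_derivative_const)
next
  case (pCons a h)
  show ?case
    using has_mat_derivative_const_add[OF has_mat_derivative_mult[OF assms pCons.IH], of "mat a"]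
    by (simp add: poly_mat_pCons matrix_mul_diff_left matrix_mul_diff_right matrix_add_ldistrib
        matrix_add_rdistrib mat_mul_commute matrix_mul_assoc)
qed

section \<open>Frobenius norms as conserved quantities\<close>

definition frob :: "complex^'n^'m \<Rightarrow> real" where
  "frob Y = (\<Sum>i\<in>UNIV. \<Sum>j\<in>UNIV. (norm (Y $ i $ j))\<^sup>2)"

lemma frob_eq_0_iff: "frob Y = 0 \<longleftrightarrow> Y = 0"
  by (auto simp: frob_def sum_nonneg_eq_0_iff sum_nonneg vec_eq_iff)

lemma frob_deriv:
  assumes "has_mat_derivative Y D (at t within S)"
  shows "((\<lambda>s. frob (Y s)) has_real_derivative 2 * Re (trace (hadj (Y t) ** D))) (at t within S)"
proof -
  have "((\<lambda>s. (norm (Y s $ i $ j))\<^sup>2) has_real_derivative 2 * Re (cnj (Y t $ i $ j) * D $ i $ j)) (at t within S)" for i j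
  proof -
    have d: "((\<lambda>s. Y s $ i $ j) has_vector_derivative D $ i $ j) (at t within S)"
      using assms by (simp add: has_mat_derivative_def)
    show ?thesis
      unfolding cmod_power2
      by (rule derivative_eq_intros has_vector_derivative_Re[OF d] has_vector_derivative_Im[OF d] refl)+
        (simp add: algebra_simps)
  qed
  then have "((\<lambda>s. frob (Y s)) has_real_derivative
      (\<Sum>i\<in>UNIV. \<Sum>j\<in>UNIV. 2 * Re (cnj (Y t $ i $ j) * D $ i $ j))) (at t within S)"
    unfolding frob_def by (auto intro!: derivative_intros)
  also have "(\<Sum>i\<in>UNIV. \<Sum>j\<in>UNIV. 2 * Re (cnj (Y t $ i $ j) * D $ i $ j)) = 2 * Re (trace (hadj (Y t) ** D))"
    unfolding trace_def hadj_def matrix_matrix_mult_def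
    by (simp add: sum_distrib_left Re_sum) (rule sum.swap)
  finally show ?thesis .
qed

lemma trace_hadj: "trace (hadj A) = cnj (trace A)"
  by (simp add: trace_def hadj_def)

lemma skew_hermitian_iff: "(A :: complex^'n^'n) \<in> skew_hermitian \<longleftrightarrow> hadj A = - A"
proof -
  have swap: "x = - y \<longleftrightarrow> y = - x" for x y :: complex by auto
  show ?thesis
    unfolding skew_hermitian_def hadj_def vec_eq_iff mem_Collect_eq vec_lambda_beta
      vector_uminus_component swap[of "cnj _"] by (rule refl)
qed

text \<open>The adjoint of the product has the negated trace, so the trace is purely
  imaginary.\<close>

lemma trace_skew_hermitian:
  fixes A :: "complex^'n^'n"
  assumes "hadj A = - A" "hadj H = H"
  shows "Re (trace (H ** A)) = 0"
proof -
  have "cnj (trace (H ** A)) = trace (hadj (H ** A))" by (simp add: trace_hadj)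
  also have "\<dots> = - trace (H ** A)"
    unfolding hadj_mult assms matrix_mul_minus_left trace_mul_sym[of H A] by (simp add: trace_def sum_negf)
  finally have "Re (cnj (trace (H ** A))) = Re (- trace (H ** A))" by (rule arg_cong)
  then show ?thesis by simp
qed

text \<open>For \<open>Y = h(C)\<close> the derivative is twice the real part of
  \<open>trace (hadj Y ** [A, Y])\<close>. Rotation turns this into the traces of two Hermitian
  matrices, \<open>Y ** hadj Y\<close> and \<open>hadj Y ** Y\<close>, against the skew-Hermitian
  \<open>A\<close>.\<close>

lemma frob_lax_const:
  fixes C :: "real \<Rightarrow> complex^'n^'n"
  assumes "\<And>t. 0 \<le> t \<Longrightarrow> hadj (A t) = - A t"
    and lax: "\<And>t. 0 \<le> t \<Longrightarrow> has_mat_derivative C (A t ** C t - C t ** A t) (at t within {0..})"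
    and "0 \<le> t"
  shows "frob (poly_mat h (C t)) = frob (poly_mat h (C 0))"
proof -
  have "((\<lambda>s. frob (poly_mat h (C s))) has_real_derivative 0) (at s within {0..})" if s: "s \<in> {0..}" for s
  proof -
    let ?Y = "poly_mat h (C s)"
    have "trace (hadj ?Y ** (A s ** ?Y - ?Y ** A s)) = trace (?Y ** hadj ?Y ** A s) - trace (hadj ?Y ** ?Y ** A s)"
      using trace_mult_commute3[of "hadj ?Y" "A s" ?Y]
      by (simp add: matrix_mul_diff_right trace_sub matrix_mul_assoc)
    also have "Re \<dots> = 0"
      using assms(1) s by (simp add: trace_skew_hermitian hadj_mult)
    finally show ?thesis
      using frob_deriv[OF lax_poly_mat[OF lax, of s h]] s by simp
  qed
  then have "\<exists>c. \<forall>x\<in>{0..}. frob (poly_mat h (C x)) = c"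
    by (intro has_field_derivative_zero_constant) auto
  then show ?thesis using \<open>0 \<le> t\<close> by (metis atLeast_iff order_refl)
qed

subsection \<open>Unitarity of CMV matrices\<close>

lemma Xi_placed_nth:
  "Xi_placed \<alpha> k $ i $ j =
     (if idx i \<in> {k, k + 1} \<and> idx j \<in> {k, k + 1} then Xi (\<alpha> k) (idx i - k) (idx j - k) else 0)"
  by (simp add: Xi_placed_def)

text \<open>A placed block occupies only the rows \<open>k\<close> and \<open>k + 1\<close>, so
  blocks at least two apart share no row.\<close>

lemma hadj_Xi_placed_mult_disjoint:
  assumes "k + 2 \<le> l \<or> l + 2 \<le> k"
  shows "hadj (Xi_placed \<alpha> k) ** Xi_placed \<alpha> l = (0 :: complex^'n::{finite,linorder}^'n::{finite,linorder})"
  unfolding vec_eq_iff matrix_matrix_mult_def hadj_def vec_lambda_beta Xi_placed_nth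
  using assms by (auto intro!: sum.neutral)

text \<open>The two admissible shapes: a full 2 by 2 block, or the last block truncated to a
  unimodular scalar.\<close>

definition block_ok :: "nat \<Rightarrow> (nat \<Rightarrow> complex) \<Rightarrow> nat \<Rightarrow> bool" where
  "block_ok n \<alpha> k \<longleftrightarrow> (k + 1 < n \<and> norm (\<alpha> k) < 1) \<or> (k + 1 = n \<and> norm (\<alpha> k) = 1)"

lemma verblunsky_block_ok: "verblunsky n \<alpha> \<Longrightarrow> k < n \<Longrightarrow> block_ok n \<alpha> k"
  unfolding verblunsky_def block_ok_def
  by (metis Suc_eq_plus1 Suc_leI diff_Suc_1 le_neq_implies_less)

lemma rho_sq:
  assumes "norm a < 1"
  shows "complex_of_real (sqrt (1 - (norm a)\<^sup>2)) * complex_of_real (sqrt (1 - (norm a)\<^sup>2)) = 1 - a * cnj a"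
proof -
  have "(norm a)\<^sup>2 \<le> 1" using assms by (simp add: power_le_one)
  then have "sqrt (1 - (norm a)\<^sup>2) * sqrt (1 - (norm a)\<^sup>2) = 1 - (norm a)\<^sup>2" by simp
  then have "complex_of_real (sqrt (1 - (norm a)\<^sup>2)) * complex_of_real (sqrt (1 - (norm a)\<^sup>2)) = of_real (1 - (norm a)\<^sup>2)"
    by (metis of_real_mult)
  then show ?thesis unfolding complex_norm_square[symmetric] by simp
qed

text \<open>A placed block is a partial isometry. In the truncated case
  \<open>k + 1 = CARD('n)\<close> the index set \<open>{k, k + 1}\<close> meets the matrix in
  \<open>k\<close> alone.\<close>

lemma Xi_placed_isometry:
  assumes ok: "block_ok CARD('n) \<alpha> k"
  shows "hadj (Xi_placed \<alpha> k) ** Xi_placed \<alpha> k =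
    (diag (\<lambda>i. if idx i \<in> {k, k + 1} then 1 else 0) :: complex^'n::{finite,linorder}^'n::{finite,linorder})"
proof -
  have "(\<Sum>m<CARD('n). cnj (Xi_placed \<alpha> k $ (unidx m :: 'n) $ i) * Xi_placed \<alpha> k $ (unidx m) $ j) =
      diag (\<lambda>i. if idx i \<in> {k, k + 1} then 1 else 0) $ i $ j" (is "?S = _") for i j :: 'n
  proof (cases "idx i \<in> {k, k + 1} \<and> idx j \<in> {k, k + 1}")
    case False
    then have "?S = 0" by (intro sum.neutral) (auto simp: Xi_placed_nth)
    with False show ?thesis by (auto simp: diag_def)
  next
    case True
    have S: "?S = (\<Sum>m\<in>{k, k + 1} \<inter> {..<CARD('n)}. cnj (Xi (\<alpha> k) (m - k) (idx i - k)) * Xi (\<alpha> k) (m - k) (idx j - k))"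
      using True by (intro sum.mono_neutral_cong_right) (auto simp: Xi_placed_nth)
    have ij: "i = j \<longleftrightarrow> idx i = idx j" by simp
    show ?thesis
    proof (cases "k + 1 < CARD('n)")
      case inner: True
      then have nk: "norm (\<alpha> k) < 1" using ok by (simp add: block_ok_def)
      have *: "{k, k + 1} \<inter> {..<CARD('n)} = {k, k + 1}" using inner by auto
      show ?thesis
        using True unfolding S * by (auto simp: Xi_def diag_def ij rho_sq[OF nk] simp del: idx_eq_iff)
    next
      case outer: False
      then have nk: "norm (\<alpha> k) = 1" and kn: "k + 1 = CARD('n)" using ok by (auto simp: block_ok_def)
      have *: "{k, k + 1} \<inter> {..<CARD('n)} = {k}" using kn by auto
      have "idx i = k" "idx j = k" using True idx_less_CARD[of i] idx_less_CARD[of j] kn by auto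
      moreover have "\<alpha> k * cnj (\<alpha> k) = 1" using nk by (simp flip: complex_norm_square)
      ultimately show ?thesis
        unfolding S * by (auto simp: Xi_def diag_def ij simp del: idx_eq_iff)
    qed
  qed
  then show ?thesis
    by (simp add: vec_eq_iff hadj_def matrix_matrix_mult_def sum_UNIV_unidx)
qed

lemma hadj_sum: "hadj (sum f S) = (\<Sum>i\<in>S. hadj (f i))"
  by (simp add: hadj_def vec_eq_iff)

lemma hadj_add: "hadj (A + B) = hadj A + hadj B"
  by (simp add: hadj_def vec_eq_iff)

lemma diag_sum: "(\<Sum>l\<in>K. diag (g l)) = diag (\<lambda>i. \<Sum>l\<in>K. g l i)"
  by (auto simp: vec_eq_iff diag_def)

text \<open>The condition \<open>gap\<close> serves both parities: it kills the cross terms and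
  makes the covered index pairs disjoint, so that the projections of the single blocks add up to one
  projection.\<close>

lemma Xi_placed_sum_isometry:
  assumes ok: "\<And>k. k \<in> K \<Longrightarrow> block_ok CARD('n) \<alpha> k" and fin: "finite K"
    and gap: "\<And>k l. k \<in> K \<Longrightarrow> l \<in> K \<Longrightarrow> k < l \<Longrightarrow> k + 2 \<le> l"
  shows "hadj (\<Sum>k\<in>K. Xi_placed \<alpha> k) ** (\<Sum>k\<in>K. Xi_placed \<alpha> k) =
    (diag (\<lambda>i. if \<exists>k\<in>K. idx i \<in> {k, k + 1} then 1 else 0) :: complex^'n::{finite,linorder}^'n::{finite,linorder})"
proof -
  let ?T = "\<lambda>k. Xi_placed \<alpha> k :: complex^'n::{finite,linorder}^'n::{finite,linorder}"
  have "hadj (\<Sum>k\<in>K. ?T k) ** (\<Sum>k\<in>K. ?T k) = (\<Sum>l\<in>K. \<Sum>k\<in>K. hadj (?T k) ** ?T l)"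
    by (simp add: hadj_sum matrix_mul_sum_right matrix_mul_sum_left)
  also have "\<dots> = (\<Sum>l\<in>K. hadj (?T l) ** ?T l)"
  proof (rule sum.cong[OF refl])
    fix l assume l: "l \<in> K"
    have "k + 2 \<le> l \<or> l + 2 \<le> k" if "k \<in> K - {l}" for k
      using that l gap[of k l] gap[of l k] by (cases k l rule: linorder_cases) auto
    then have "hadj (?T k) ** ?T l = 0" if "k \<in> K - {l}" for k
      using that by (intro hadj_Xi_placed_mult_disjoint)
    then show "(\<Sum>k\<in>K. hadj (?T k) ** ?T l) = hadj (?T l) ** ?T l"
      using l fin by (subst sum.remove[of K l]) auto
  qed
  also have "\<dots> = (\<Sum>l\<in>K. diag (\<lambda>i. if idx i \<in> {l, l + 1} then 1 else 0))"
    by (intro sum.cong refl Xi_placed_isometry ok)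
  also have "\<dots> = diag (\<lambda>i. if \<exists>k\<in>K. idx i \<in> {k, k + 1} then 1 else 0)"
  proof -
    have "(\<Sum>l\<in>K. if idx i \<in> {l, l + 1} then 1 else 0) = (if \<exists>k\<in>K. idx i \<in> {k, k + 1} then 1 else (0::complex))"
      for i :: 'n
    proof (cases "\<exists>k\<in>K. idx i \<in> {k, k + 1}")
      case True
      then obtain k where k: "k \<in> K" "idx i \<in> {k, k + 1}" by blast
      have "l = k" if "l \<in> K" "idx i \<in> {l, l + 1}" for l
        using that k gap[of k l] gap[of l k] by (cases k l rule: linorder_cases) auto
      then have "idx i \<in> {l, l + 1} \<longleftrightarrow> l = k" if "l \<in> K" for l
        using that k(2) by blast
      then have "(\<Sum>l\<in>K. if idx i \<in> {l, l + 1} then 1 else 0) = (\<Sum>l\<in>K. if l = k then 1 else (0::complex))"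
        by (intro sum.cong if_cong refl)
      then show ?thesis using True k fin by simp
    qed (auto intro!: sum.neutral)
    then show ?thesis by (simp only: diag_sum)
  qed
  finally show ?thesis .
qed

text \<open>Only one block meets row \<open>i\<close>, which turns the matrix equations for an
  eigenvector into two-term relations.\<close>

lemma Xi_placed_sum_mult_vec:
  fixes u :: "complex^'n::{finite,linorder}"
  assumes fin: "finite K" and gap: "\<And>k l. k \<in> K \<Longrightarrow> l \<in> K \<Longrightarrow> k < l \<Longrightarrow> k + 2 \<le> l"
    and k: "k \<in> K" "k + 1 < CARD('n)" and i: "idx i \<in> {k, k + 1}"
  shows "((\<Sum>k\<in>K. Xi_placed \<alpha> k) *v u) $ i =
     Xi (\<alpha> k) (idx i - k) 0 * u $ unidx k + Xi (\<alpha> k) (idx i - k) 1 * u $ unidx (k + 1)"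
proof -
  have row: "(\<Sum>k\<in>K. Xi_placed \<alpha> k) $ i $ j = Xi_placed \<alpha> k $ i $ j" for j :: 'n
  proof -
    have "Xi_placed \<alpha> l $ i $ j = 0" if "l \<in> K - {k}" for l
      using that k i gap[of k l] gap[of l k]
      by (cases k l rule: linorder_cases) (auto simp: Xi_placed_nth)
    then show ?thesis using k fin by (simp add: sum.remove[of K k])
  qed
  have "((\<Sum>k\<in>K. Xi_placed \<alpha> k) *v u) $ i = (\<Sum>m<CARD('n). Xi_placed \<alpha> k $ i $ (unidx m) * u $ unidx m)"
    unfolding matrix_vector_mult_def vec_lambda_beta row by (rule sum_UNIV_unidx)
  also have "\<dots> = (\<Sum>m\<in>{k, k + 1}. Xi (\<alpha> k) (idx i - k) (m - k) * u $ unidx m)"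
    using k i by (intro sum.mono_neutral_cong_right) (auto simp: Xi_placed_nth)
  finally show ?thesis by simp
qed

lemma gap_even: "even k \<Longrightarrow> even l \<Longrightarrow> k < l \<Longrightarrow> Suc (Suc k) \<le> l" for k l :: nat
  by presburger

lemma gap_odd: "odd k \<Longrightarrow> odd l \<Longrightarrow> k < l \<Longrightarrow> Suc (Suc k) \<le> l" for k l :: nat
  by presburger

lemma cmv_L_isometry:
  assumes "verblunsky CARD('n) \<alpha>"
  shows "hadj (cmv_L \<alpha>) ** cmv_L \<alpha> = (mat 1 :: complex^'n::{finite,linorder}^'n::{finite,linorder})"
proof -
  let ?K = "{k. k < CARD('n) \<and> even k}"
  have "\<exists>k\<in>?K. idx i \<in> {k, k + 1}" for i :: 'n
  proof
    \<comment> \<open>Even blocks pair \<open>2 m\<close> with \<open>2 m + 1\<close>, so the block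
      covering \<open>i\<close> starts at \<open>idx i\<close> rounded down to an even
      number.\<close>
    show "idx i \<in> {2 * (idx i div 2), 2 * (idx i div 2) + 1}" by (auto elim: oddE)
    have "2 * (idx i div 2) < CARD('n)" by (rule le_less_trans[OF _ idx_less_CARD[of i]]) simp
    then show "2 * (idx i div 2) \<in> ?K" by simp
  qed
  moreover have "hadj (cmv_L \<alpha>) ** cmv_L \<alpha> =
      (diag (\<lambda>i. if \<exists>k\<in>?K. idx i \<in> {k, k + 1} then 1 else 0) :: complex^'n::{finite,linorder}^'n::{finite,linorder})"
    unfolding cmv_L_def
    using assms by (intro Xi_placed_sum_isometry) (auto intro: verblunsky_block_ok simp: gap_even)
  ultimately show ?thesis by (simp add: diag_def mat_def)
qed

definition corner :: "complex^'n::{finite,linorder}^'n::{finite,linorder}" where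
  "corner = (\<chi> i j. if idx i = 0 \<and> idx j = 0 then 1 else 0)"

text \<open>The odd blocks cover every index but 0, and \<open>corner\<close> supplies that one.
  Cross terms vanish because the odd blocks have a zero row 0.\<close>

lemma cmv_M_isometry:
  assumes "verblunsky CARD('n) \<alpha>"
  shows "hadj (cmv_M \<alpha>) ** cmv_M \<alpha> = (mat 1 :: complex^'n::{finite,linorder}^'n::{finite,linorder})"
proof -
  let ?K = "{k. k < CARD('n) \<and> odd k}"
  let ?S = "(\<Sum>k\<in>?K. Xi_placed \<alpha> k) :: complex^'n::{finite,linorder}^'n::{finite,linorder}"
  have ex: "(\<exists>k\<in>?K. idx i \<in> {k, k + 1}) \<longleftrightarrow> idx i \<noteq> 0" for i :: 'n
  proof
    assume i0: "idx i \<noteq> 0"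
    show "\<exists>k\<in>?K. idx i \<in> {k, k + 1}"
    proof (cases "even (idx i)")
      case True
      have "idx i - 1 < CARD('n)" by (rule le_less_trans[OF _ idx_less_CARD[of i]]) simp
      with True i0 show ?thesis by (intro bexI[of _ "idx i - 1"]) auto
    next
      case False
      with idx_less_CARD[of i] show ?thesis by (intro bexI[of _ "idx i"]) auto
    qed
  next
    assume "\<exists>k\<in>?K. idx i \<in> {k, k + 1}"
    then obtain k where "odd k" "idx i \<in> {k, k + 1}" by blast
    then show "idx i \<noteq> 0" by (cases k) auto
  qed
  have S: "hadj ?S ** ?S = diag (\<lambda>i. if idx i \<noteq> 0 then 1 else 0)"
    using assms unfolding ex[symmetric]
    by (intro Xi_placed_sum_isometry) (auto intro: verblunsky_block_ok simp: gap_odd)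
  have S0: "?S $ i $ j = 0" if "idx i = 0" for i j
    using that by (auto simp: Xi_placed_nth intro!: sum.neutral)
  have c: "hadj (corner :: complex^'n::{finite,linorder}^'n::{finite,linorder}) = corner"
    by (auto simp: hadj_def corner_def vec_eq_iff)
  have cS: "corner ** ?S = 0"
    unfolding matrix_matrix_mult_def vec_eq_iff corner_def vec_lambda_beta
    by (auto intro!: sum.neutral simp: S0 simp del: sum_component)
  then have "hadj (corner ** ?S) = 0" by (simp add: hadj_def vec_eq_iff)
  then have Sc: "hadj ?S ** corner = 0" by (simp add: hadj_mult c)
  have cc: "corner ** corner = (corner :: complex^'n::{finite,linorder}^'n::{finite,linorder})"
  proof -
    have d: "corner = (diag (\<lambda>i. if idx i = 0 then 1 else 0) :: complex^'n::{finite,linorder}^'n::{finite,linorder})"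
      by (auto simp: corner_def diag_def vec_eq_iff) (metis idx_eq_iff)
    show ?thesis unfolding d diag_mult by (auto simp: diag_def vec_eq_iff)
  qed
  have "cmv_M \<alpha> = corner + ?S" by (simp add: cmv_M_def corner_def)
  then have "hadj (cmv_M \<alpha>) ** cmv_M \<alpha> = corner + diag (\<lambda>i::'n. if idx i \<noteq> 0 then 1 else 0)"
    by (simp add: hadj_add matrix_add_ldistrib matrix_add_rdistrib S c cS Sc cc)
  also have "\<dots> = mat 1"
    by (auto simp: corner_def diag_def mat_def vec_eq_iff) (metis idx_eq_iff)
  finally show ?thesis .
qed

lemma cmv_unitary:
  assumes "verblunsky CARD('n) \<alpha>"
  shows "hadj (cmv \<alpha>) ** cmv \<alpha> = (mat 1 :: complex^'n::{finite,linorder}^'n::{finite,linorder})"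
  using cmv_L_isometry[OF assms] cmv_M_isometry[OF assms] unfolding cmv_def hadj_mult
  by (metis matrix_mul_assoc matrix_mul_lid)

subsection \<open>The Szego recursion\<close>

text \<open>The monic Szego polynomials and their reversals, introduced through the recursion alone;
  their orthogonality has to be proved. That \<open>Phis\<close> is the reversal is recorded on the
  unit circle in \<open>poly_Phis_circle\<close>.\<close>

fun Phi and Phis :: "(nat \<Rightarrow> complex) \<Rightarrow> nat \<Rightarrow> complex poly" where
  "Phi \<alpha> 0 = 1"
| "Phi \<alpha> (Suc k) = pCons 0 (Phi \<alpha> k) - smult (cnj (\<alpha> k)) (Phis \<alpha> k)"
| "Phis \<alpha> 0 = 1"
| "Phis \<alpha> (Suc k) = Phis \<alpha> k - smult (\<alpha> k) (pCons 0 (Phi \<alpha> k))"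

lemma degree_Phi_Phis: "degree (Phi \<alpha> k) \<le> k \<and> degree (Phis \<alpha> k) \<le> k"
proof (induction k)
  case (Suc k)
  have "degree (pCons 0 (Phi \<alpha> k)) \<le> Suc k"
    using Suc by (metis degree_pCons_le Suc_le_mono order_trans)
  then show ?case using Suc
    by (auto intro!: degree_diff_le order_trans[OF degree_smult_le])
qed auto

lemma coeff_Phi_self: "coeff (Phi \<alpha> k) k = 1"
  using degree_Phi_Phis by (induction k) (auto simp: coeff_eq_0 le_imp_less_Suc)

lemma poly_Phis_0: "poly (Phis \<alpha> k) 0 = 1"
  by (induction k) auto

lemma poly_Phi_Suc_0: "poly (Phi \<alpha> (Suc k)) 0 = - cnj (\<alpha> k)"
  by (simp add: poly_Phis_0)

lemma poly_Phis_circle: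
  assumes "z * cnj z = 1"
  shows "poly (Phis \<alpha> k) z = z ^ k * cnj (poly (Phi \<alpha> k) z)"
proof (induction k)
  case (Suc k)
  have "z ^ k * cnj z ^ k = 1" using assms by (metis power_mult_distrib power_one)
  then have cancel: "z ^ k * (cnj z ^ k * x) = x" "z * (cnj z * x) = x" for x
    using assms by (metis mult.assoc mult_1)+
  from Suc show ?case by (simp add: algebra_simps cancel)
qed auto

text \<open>\<open>u = M v\<close> and \<open>z v = L u\<close> are the two families of basis functions of Cantero, Moral and
  Velazquez: up to a power of \<open>z\<close> and a constant they are the orthogonal polynomial and its reversal,
  in an order that depends on the parity of the index.\<close>

lemma cmv_components:
  fixes u v :: "nat \<Rightarrow> complex"
  assumes z: "z * cnj z = 1"
    and lt: "\<And>k. k + 1 < n \<Longrightarrow> norm (\<alpha> k) < 1"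
    and u0: "u 0 = v 0"
    and even: "\<And>k. even k \<Longrightarrow> k + 1 < n \<Longrightarrow>
        z * v k = cnj (\<alpha> k) * u k + of_real (sqrt (1 - (norm (\<alpha> k))\<^sup>2)) * u (k + 1) \<and>
        z * v (k + 1) = of_real (sqrt (1 - (norm (\<alpha> k))\<^sup>2)) * u k - \<alpha> k * u (k + 1)"
    and odd: "\<And>k. odd k \<Longrightarrow> k + 1 < n \<Longrightarrow>
        u k = cnj (\<alpha> k) * v k + of_real (sqrt (1 - (norm (\<alpha> k))\<^sup>2)) * v (k + 1) \<and>
        u (k + 1) = of_real (sqrt (1 - (norm (\<alpha> k))\<^sup>2)) * v k - \<alpha> k * v (k + 1)"
    and "k < n"
  defines "r \<equiv> \<lambda>k. \<Prod>i<k. complex_of_real (sqrt (1 - (norm (\<alpha> i))\<^sup>2))"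
    and "w \<equiv> \<lambda>k. cnj z ^ (k div 2)"
  shows "if even k
    then r k * v k = w k * poly (Phi \<alpha> k) z * v 0 \<and> r k * u k = w k * poly (Phis \<alpha> k) z * v 0
    else r k * u k = w k * poly (Phi \<alpha> k) z * v 0 \<and> r k * v k = cnj z * w k * poly (Phis \<alpha> k) z * v 0"
  using \<open>k < n\<close>
proof (induction k)
  case 0
  then show ?case by (simp add: r_def w_def u0)
next
  case (Suc k)
  let ?a = "\<alpha> k" and ?P = "poly (Phi \<alpha> k) z" and ?Q = "poly (Phis \<alpha> k) z"
  define \<rho> where "\<rho> = complex_of_real (sqrt (1 - (norm (\<alpha> k))\<^sup>2))"
  have rr: "\<rho> * \<rho> = 1 - ?a * cnj ?a"
    unfolding \<rho>_def using Suc.prems by (intro rho_sq lt) simp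
  have rS: "r (Suc k) = r k * \<rho>" by (simp add: r_def \<rho>_def)
  have zz: "cnj z * (z * x) = x" for x by (metis z mult.assoc mult.commute mult_1)
  have zz': "z * (cnj z * x) = x" for x by (metis z mult.assoc mult_1)
  show ?case
  proof (cases "even k")
    case True
    have e: "z * v k = cnj ?a * u k + \<rho> * u (Suc k)" "z * v (Suc k) = \<rho> * u k - ?a * u (Suc k)"
      using even[OF True] Suc.prems by (auto simp: \<rho>_def)
    have IH: "r k * v k = w k * ?P * v 0" "r k * u k = w k * ?Q * v 0"
      using Suc True by auto
    have w: "w (Suc k) = w k" using True by (simp add: w_def)
    have "r k * \<rho> * u (Suc k) = z * (r k * v k) - cnj ?a * (r k * u k)"
      using arg_cong[OF e(1), of "(*) (r k)"] by (simp add: algebra_simps)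
    \<comment> \<open>Multiplying by \<open>\<rho>\<close> and eliminating
      \<open>\<rho> * u (Suc k)\<close> through the first relation leaves only quantities of index
      \<open>k\<close>, since \<open>\<rho> * \<rho> = 1 - ?a * cnj ?a\<close>.\<close>
    moreover have "\<rho> * (z * v (Suc k)) = (\<rho> * \<rho>) * u k - ?a * (z * v k - cnj ?a * u k)"
      unfolding e by (simp add: algebra_simps)
    then have "\<rho> * (z * v (Suc k)) = u k - ?a * (z * v k)"
      unfolding rr by (simp add: algebra_simps)
    from arg_cong[OF this, of "(*) (r k)"]
    have "z * (r k * \<rho> * v (Suc k)) = r k * u k - ?a * z * (r k * v k)"
      by (simp add: algebra_simps)
    then have "r k * \<rho> * v (Suc k) = cnj z * (r k * u k - ?a * z * (r k * v k))"
      using zz by metis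
    ultimately show ?thesis
      using True unfolding rS w IH by (simp add: algebra_simps)
  next
    case False
    have e: "u k = cnj ?a * v k + \<rho> * v (Suc k)" "u (Suc k) = \<rho> * v k - ?a * v (Suc k)"
      using odd[OF False] Suc.prems by (auto simp: \<rho>_def)
    have IH: "r k * u k = w k * ?P * v 0" "r k * v k = cnj z * w k * ?Q * v 0"
      using Suc False by auto
    \<comment> \<open>\<open>k div 2\<close> increases only when \<open>k\<close> is odd, so each
      pair of steps costs one factor \<open>cnj z\<close>.\<close>
    have w: "w (Suc k) = cnj z * w k" using False by (auto simp: w_def elim!: oddE)
    have "r k * \<rho> * v (Suc k) = r k * u k - cnj ?a * (r k * v k)"
      using arg_cong[OF e(1), of "(*) (r k)"] by (simp add: algebra_simps)
    moreover have "\<rho> * u (Suc k) = (\<rho> * \<rho>) * v k - ?a * (u k - cnj ?a * v k)"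
      unfolding e by (simp add: algebra_simps)
    then have "\<rho> * u (Suc k) = v k - ?a * u k"
      unfolding rr by (simp add: algebra_simps)
    from arg_cong[OF this, of "(*) (r k)"]
    have "r k * \<rho> * u (Suc k) = r k * v k - ?a * (r k * u k)"
      by (simp add: algebra_simps)
    ultimately show ?thesis
      using False unfolding rS w IH by (simp add: algebra_simps zz')
  qed
qed

text \<open>With \<open>y = M x\<close> the eigenvalue equation splits into \<open>y = M x\<close>
  and \<open>L y = z x\<close>, the two first-order relations of \<open>cmv_components\<close>.
  Every component is thereby a multiple of the first one.\<close>

lemma cmv_eigenvector_components:
  fixes x :: "complex^'n::{finite,linorder}"
  assumes verb: "verblunsky CARD('n) \<alpha>" and z: "z * cnj z = 1" and x: "cmv \<alpha> *v x = z *s x"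
    and k: "k < CARD('n)"
  shows "(\<Prod>i<k. complex_of_real (sqrt (1 - (norm (\<alpha> i))\<^sup>2))) * x $ unidx k =
     cnj z ^ (k div 2) * (if even k then poly (Phi \<alpha> k) z else cnj z * poly (Phis \<alpha> k) z) * x $ unidx 0"
proof -
  define y where "y = cmv_M \<alpha> *v x"
  define u v where "u = (\<lambda>k. y $ unidx k)" and "v = (\<lambda>k. x $ unidx k)"
  have Ly: "cmv_L \<alpha> *v y = z *s x"
    using x unfolding y_def cmv_def by (simp add: matrix_vector_mul_assoc)
  have lt: "norm (\<alpha> k) < 1" if "k + 1 < CARD('n)" for k
    using verb that by (simp add: verblunsky_def)
  have M: "y $ i = (if idx i = 0 then x $ unidx 0 else 0) +
      ((\<Sum>k | k < CARD('n) \<and> odd k. Xi_placed \<alpha> k) *v x) $ i" for i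
  proof -
    have "(\<Sum>j\<in>UNIV. (if idx i = 0 \<and> idx (j :: 'n) = 0 then 1 else 0) * x $ j) = (if idx i = 0 then x $ unidx 0 else 0)"
    proof (cases "idx i = 0")
      case True
      then have "(\<Sum>j\<in>UNIV. (if idx i = 0 \<and> idx (j :: 'n) = 0 then 1 else 0) * x $ j) =
          (\<Sum>j\<in>UNIV. if j = unidx 0 then x $ j else 0)"
        by (intro sum.cong) (auto simp: idx_eq_unidx)
      then show ?thesis using True by simp
    qed simp
    then show ?thesis
      unfolding y_def cmv_M_def matrix_vector_mult_add_rdistrib
      by (simp add: matrix_vector_mult_def)
  qed
  have u0: "u 0 = v 0"
  proof -
    have "((\<Sum>k | k < CARD('n) \<and> odd k. Xi_placed \<alpha> k) *v x) $ unidx 0 = 0"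
      unfolding matrix_vector_mult_def
      by (auto simp: Xi_placed_nth intro!: sum.neutral)
    then show ?thesis by (simp add: u_def v_def M)
  qed
  have even: "z * v k = cnj (\<alpha> k) * u k + of_real (sqrt (1 - (norm (\<alpha> k))\<^sup>2)) * u (k + 1) \<and>
      z * v (k + 1) = of_real (sqrt (1 - (norm (\<alpha> k))\<^sup>2)) * u k - \<alpha> k * u (k + 1)"
    if "even k" "k + 1 < CARD('n)" for k
  proof -
    have "(z *s x) $ i = Xi (\<alpha> k) (idx i - k) 0 * u k + Xi (\<alpha> k) (idx i - k) 1 * u (k + 1)"
      if "idx i \<in> {k, k + 1}" for i
      unfolding u_def Ly[symmetric] cmv_L_def
      using \<open>even k\<close> \<open>k + 1 < CARD('n)\<close> that by (intro Xi_placed_sum_mult_vec) (auto simp: gap_even)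
    from this[of "unidx k"] this[of "unidx (k + 1)"] show ?thesis
      using that by (simp add: Xi_def v_def)
  qed
  have odd: "u k = cnj (\<alpha> k) * v k + of_real (sqrt (1 - (norm (\<alpha> k))\<^sup>2)) * v (k + 1) \<and>
      u (k + 1) = of_real (sqrt (1 - (norm (\<alpha> k))\<^sup>2)) * v k - \<alpha> k * v (k + 1)"
    if "odd k" "k + 1 < CARD('n)" for k
  proof -
    have "y $ i = Xi (\<alpha> k) (idx i - k) 0 * v k + Xi (\<alpha> k) (idx i - k) 1 * v (k + 1)"
      if "idx i \<in> {k, k + 1}" for i
    proof -
      have "idx i \<noteq> 0" using that \<open>odd k\<close> by (cases k) auto
      then have "y $ i = ((\<Sum>k | k < CARD('n) \<and> odd k. Xi_placed \<alpha> k) *v x) $ i" by (simp add: M)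
      also have "\<dots> = Xi (\<alpha> k) (idx i - k) 0 * v k + Xi (\<alpha> k) (idx i - k) 1 * v (k + 1)"
        unfolding v_def
        using \<open>odd k\<close> \<open>k + 1 < CARD('n)\<close> that by (intro Xi_placed_sum_mult_vec) (auto simp: gap_odd)
      finally show ?thesis .
    qed
    from this[of "unidx k"] this[of "unidx (k + 1)"] show ?thesis
      using that by (simp add: Xi_def u_def)
  qed
  show ?thesis
    using cmv_components[of z "CARD('n)" \<alpha> u v k, OF z lt u0 even odd k]
    by (auto simp: v_def split: if_splits)
qed

subsection \<open>Heine's formula on finitely many nodes\<close>

text \<open>The left side is a divided difference. The polynomial \<open>p\<close> equals its
  Lagrange interpolant \<open>r\<close>, both having degree below the number of nodes; comparing
  coefficients in degree \<open>card S - 1\<close> gives the claim. It is 0 if \<open>p\<close> has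
  still smaller degree.\<close>

lemma sum_div_prod_diff:
  fixes z :: "'b \<Rightarrow> complex"
  assumes fin: "finite S" and inj: "inj_on z S" and deg: "degree p < card S"
  shows "(\<Sum>s\<in>S. poly p (z s) / (\<Prod>y\<in>S - {s}. z s - z y)) = coeff p (card S - 1)"
proof -
  define q where "q s = (\<Prod>y\<in>S - {s}. [:- z y, 1:])" for s
  define c where "c s = poly p (z s) / (\<Prod>y\<in>S - {s}. z s - z y)" for s
  define r where "r = (\<Sum>s\<in>S. smult (c s) (q s))"
  have degq: "degree (q s) = card S - 1" if "s \<in> S" for s
    using that fin by (simp add: q_def degree_prod_eq_sum_degree)
  have lcq: "coeff (q s) (card S - 1) = 1" if "s \<in> S" for s
  proof -
    have "lead_coeff (q s) = 1" unfolding q_def lead_coeff_prod by simp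
    then show ?thesis using degq[OF that] by simp
  qed
  have nz: "(\<Prod>y\<in>S - {s}. z s - z y) \<noteq> 0" if "s \<in> S" for s
    using that fin inj by (auto simp: inj_on_def)
  have qz: "poly (q s) (z t) = (if s = t then \<Prod>y\<in>S - {s}. z s - z y else 0)" if "s \<in> S" "t \<in> S" for s t
    using that fin by (auto simp: q_def poly_prod)
  have "poly r (z t) = poly p (z t)" if "t \<in> S" for t
  proof -
    have "poly r (z t) = (\<Sum>s\<in>S. if s = t then poly p (z t) else 0)"
      unfolding r_def poly_sum using that nz by (intro sum.cong) (auto simp: qz c_def)
    then show ?thesis using that fin by simp
  qed
  moreover have "degree r < card (z ` S)"
  proof -
    have "degree r \<le> card S - 1"
      unfolding r_def using degq by (intro degree_sum_le) (auto intro: order_trans[OF degree_smult_le] fin)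
    then show ?thesis using deg inj by (simp add: card_image)
  qed
  moreover have "degree p < card (z ` S)" using deg inj by (simp add: card_image)
  ultimately have "r = p" by (intro poly_eqI_degree[of "z ` S"]) auto
  then have "coeff p (card S - 1) = (\<Sum>s\<in>S. c s * coeff (q s) (card S - 1))"
    by (auto simp: r_def coeff_sum)
  then show ?thesis using lcq by (simp add: c_def)
qed

section \<open>Vandermonde weights and orthogonal polynomials\<close>

lemma finite_pairs: "finite I \<Longrightarrow> finite {(i, j). i \<in> I \<and> j \<in> I \<and> i < (j :: nat)}"
  by (rule finite_subset[of _ "I \<times> I"]) auto

text \<open>\<open>Delta\<close> depends on the order of the indices, its modulus does not. The new
  pairs are the \<open>(min i x, max i x)\<close>, wherever \<open>x\<close> falls within
  \<open>I\<close>.\<close>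

lemma norm_Delta_insert:
  assumes "finite I" "x \<notin> I"
  shows "(norm (Delta z (insert x I)))\<^sup>2 = (norm (Delta z I))\<^sup>2 * (\<Prod>i\<in>I. (norm (z x - z i))\<^sup>2)"
proof -
  let ?P = "\<lambda>I. {(i, j). i \<in> I \<and> j \<in> I \<and> i < (j :: nat)}"
  let ?g = "\<lambda>i. (min i x, max i x)"
  have eq: "?P (insert x I) = ?P I \<union> ?g ` I"
  proof (intro equalityI subsetI)
    fix p assume p: "p \<in> ?P (insert x I)"
    obtain i j where ij: "p = (i, j)" by force
    show "p \<in> ?P I \<union> ?g ` I"
    proof (cases "i = x \<or> j = x")
      case True
      then show ?thesis
        using p ij assms by (auto simp: min_def max_def intro: image_eqI[where x=i] image_eqI[where x=j])
    next
      case False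
      then show ?thesis using p ij by auto
    qed
  next
    fix p assume "p \<in> ?P I \<union> ?g ` I"
    then show "p \<in> ?P (insert x I)"
      using assms by (auto simp: min_def max_def split: if_splits)
        (metis linorder_neqE_nat not_le_imp_less less_le)+
  qed
  have inj: "inj_on ?g I"
    by (auto simp: inj_on_def min_def max_def split: if_splits)
  have disj: "?P I \<inter> ?g ` I = {}"
    using assms by (auto simp: min_def max_def split: if_splits)
  have "Delta z (insert x I) = Delta z I * (\<Prod>i\<in>I. z (max i x) - z (min i x))"
    unfolding Delta_def eq
    by (subst prod.union_disjoint[OF finite_pairs[OF assms(1)] finite_imageI[OF assms(1)] disj])
       (simp add: prod.reindex[OF inj])
  moreover have "(norm (z (max i x) - z (min i x)))\<^sup>2 = (norm (z x - z i))\<^sup>2" for i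
    by (auto simp: max_def min_def norm_minus_commute)
  ultimately show ?thesis
    by (simp add: norm_mult power_mult_distrib prod_norm[symmetric] prod_power_distrib[symmetric])
qed

lemma norm_Delta_pos:
  assumes "finite I" "inj_on z I"
  shows "0 < (norm (Delta z I))\<^sup>2"
proof -
  have "Delta z I \<noteq> 0"
    unfolding Delta_def using assms finite_pairs[OF assms(1)]
    by (auto simp: inj_on_def prod_zero_iff)
  then show ?thesis by simp
qed

text \<open>The integrand of Heine's multiple integral for a discrete measure. Tuples with a
  repetition contribute 0 and each set arises from \<open>k!\<close> tuples, a factor that cancels
  in quotients; hence the sums over sets.\<close>

definition heine_weight :: "(nat \<Rightarrow> complex) \<Rightarrow> (nat \<Rightarrow> real) \<Rightarrow> nat set \<Rightarrow> real" where
  "heine_weight z m I = (norm (Delta z I))\<^sup>2 * (\<Prod>i\<in>I. m i)"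

definition ksubsets :: "nat \<Rightarrow> nat \<Rightarrow> nat set set" where
  "ksubsets n k = {I. I \<subseteq> {1..n} \<and> card I = k}"

lemma finite_ksubsets [simp]: "finite (ksubsets n k)"
  by (rule finite_subset[of _ "Pow {1..n}"]) (auto simp: ksubsets_def)

lemma ksubsets_finite: "I \<in> ksubsets n k \<Longrightarrow> finite I"
  by (auto simp: ksubsets_def intro: finite_subset)

lemma heine_weight_pos:
  assumes "inj_on z {1..n}" "\<And>j. j \<in> {1..n} \<Longrightarrow> 0 < m j" "I \<in> ksubsets n k"
  shows "0 < heine_weight z m I"
  unfolding heine_weight_def using assms ksubsets_finite[OF assms(3)]
  by (intro mult_pos_pos norm_Delta_pos prod_pos) (auto simp: ksubsets_def intro: inj_on_subset)

text \<open>The orthogonal polynomial without normalization: its coefficient in degree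
  \<open>k\<close> is the total weight, see \<open>coeff_heine\<close>.\<close>

definition heine :: "(nat \<Rightarrow> complex) \<Rightarrow> (nat \<Rightarrow> real) \<Rightarrow> nat \<Rightarrow> nat \<Rightarrow> complex poly" where
  "heine z m n k = (\<Sum>I\<in>ksubsets n k. smult (of_real (heine_weight z m I)) (\<Prod>i\<in>I. [:- z i, 1:]))"

text \<open>Multiplying out, the pair of a \<open>k\<close>-set \<open>I\<close> and a node \<open>x \<notin> I\<close> contributes a term of
  \<open>sum_div_prod_diff\<close> for the \<open>(k + 1)\<close>-set \<open>S = I \<union> {x}\<close>.\<close>

lemma heine_orthogonal:
  assumes inj: "inj_on z {1..n}" and l: "l < k"
  shows "(\<Sum>x=1..n. of_real (m x) * cnj (z x) ^ l * poly (heine z m n k) (z x)) = 0"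
proof -
  let ?W = "heine_weight z m"
  define g where "g x I = of_real (m x) * cnj (z x) ^ l * (of_real (?W I) * (\<Prod>i\<in>I. z x - z i))" for x I
  have "(\<Sum>x=1..n. of_real (m x) * cnj (z x) ^ l * poly (heine z m n k) (z x))
      = (\<Sum>x\<in>{1..n}. \<Sum>I\<in>ksubsets n k. g x I)"
    by (simp add: heine_def poly_sum poly_prod sum_distrib_left g_def)
  also have "\<dots> = (\<Sum>(x, I)\<in>{1..n} \<times> ksubsets n k. g x I)"
    by (simp add: sum.cartesian_product)
  \<comment> \<open>For \<open>x \<in> I\<close> the node \<open>z x\<close> is a root of the
    product over \<open>I\<close>.\<close>
  also have "\<dots> = (\<Sum>(x, I)\<in>{(x, I). x \<in> {1..n} \<and> I \<in> ksubsets n k \<and> x \<notin> I}. g x I)"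
  proof (rule sum.mono_neutral_right)
    show "\<forall>i\<in>{1..n} \<times> ksubsets n k - {(x, I). x \<in> {1..n} \<and> I \<in> ksubsets n k \<and> x \<notin> I}. (case i of (x, I) \<Rightarrow> g x I) = 0"
      using ksubsets_finite by (fastforce simp: g_def prod_zero_iff)
  qed auto
  also have "\<dots> = (\<Sum>(S, x)\<in>Sigma (ksubsets n (Suc k)) (\<lambda>S. S). g x (S - {x}))"
  proof (rule sum.reindex_bij_witness[of _ "\<lambda>(S, x). (x, S - {x})" "\<lambda>(x, I). (insert x I, x)"])
  qed (auto simp: ksubsets_def card_insert_if dest: finite_subset split: prod.splits)
  also have "\<dots> = (\<Sum>S\<in>ksubsets n (Suc k). \<Sum>x\<in>S. g x (S - {x}))"
    by (rule sum.Sigma[symmetric]) (auto dest: ksubsets_finite)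
  also have "\<dots> = 0"
  proof (rule sum.neutral, rule ballI)
    fix S assume S: "S \<in> ksubsets n (Suc k)"
    then have fin: "finite S" and injS: "inj_on z S" and card: "card S = Suc k"
      using inj by (auto simp: ksubsets_def intro: finite_subset inj_on_subset)
    have "g x (S - {x}) = of_real (?W S) * cnj (poly (monom 1 l) (z x) / (\<Prod>y\<in>S - {x}. z x - z y))"
      if x: "x \<in> S" for x
    proof -
      define p where "p = (\<Prod>y\<in>S - {x}. z x - z y)"
      have nz: "p \<noteq> 0" using x fin injS by (auto simp: inj_on_def p_def)
      \<comment> \<open>Adjoining \<open>x\<close> multiplies the weight by \<open>m x\<close> and
        the squared modulus of \<open>p\<close>. Hence \<open>?W (S - {x}) * m x * p\<close> equals
        \<open>?W S / cnj p\<close>, where the weight no longer depends on \<open>x\<close>.\<close>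
      have "?W S = ?W (S - {x}) * m x * (\<Prod>y\<in>S - {x}. (norm (z x - z y))\<^sup>2)"
        using norm_Delta_insert[of "S - {x}" x z] x fin
        by (simp add: heine_weight_def insert_absorb prod.remove[OF fin x])
      also have "(\<Prod>y\<in>S - {x}. (norm (z x - z y))\<^sup>2) = (norm p)\<^sup>2"
        by (simp add: p_def prod_norm[symmetric] prod_power_distrib)
      finally have "complex_of_real (?W S) = of_real (?W (S - {x})) * of_real (m x) * (p * cnj p)"
        by (simp only: of_real_mult complex_norm_square)
      then show ?thesis unfolding g_def p_def[symmetric] using nz by (simp add: poly_monom field_simps)
    qed
    then have "(\<Sum>x\<in>S. g x (S - {x})) =
        of_real (?W S) * cnj (\<Sum>x\<in>S. poly (monom 1 l) (z x) / (\<Prod>y\<in>S - {x}. z x - z y))"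
      by (simp add: sum_distrib_left)
    \<comment> \<open>The top coefficient has index \<open>card S - 1 = k\<close>, and the monomial
      has degree \<open>l < k\<close>.\<close>
    also have "(\<Sum>x\<in>S. poly (monom 1 l) (z x) / (\<Prod>y\<in>S - {x}. z x - z y)) = 0"
      using sum_div_prod_diff[OF fin injS, of "monom 1 l"] l card by (simp add: degree_monom_eq)
    finally show "(\<Sum>x\<in>S. g x (S - {x})) = 0" by simp
  qed
  finally show ?thesis .
qed

lemma coeff_heine: "coeff (heine z m n k) k = of_real (\<Sum>I\<in>ksubsets n k. heine_weight z m I)"
proof -
  have "coeff (\<Prod>i\<in>I. [:- z i, 1:]) k = 1" if "I \<in> ksubsets n k" for I
  proof -
    have "degree (\<Prod>i\<in>I. [:- z i, 1:]) = k" "lead_coeff (\<Prod>i\<in>I. [:- z i, 1:]) = 1"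
      using that unfolding lead_coeff_prod by (auto simp: degree_prod_eq_sum_degree ksubsets_def)
    then show ?thesis by simp
  qed
  then show ?thesis by (simp add: heine_def coeff_sum)
qed

lemma degree_heine: "degree (heine z m n k) \<le> k"
proof -
  have "degree (\<Prod>i\<in>I. [:- z i, 1:]) = k" if "I \<in> ksubsets n k" for I
    using that by (auto simp: degree_prod_eq_sum_degree ksubsets_def)
  then show ?thesis unfolding heine_def
    by (intro degree_sum_le) (auto intro: order_trans[OF degree_smult_le])
qed

lemma poly_heine_0:
  "poly (heine z m n k) 0 = (-1) ^ k * (\<Sum>I\<in>ksubsets n k. of_real (heine_weight z m I) * (\<Prod>i\<in>I. z i))"
proof -
  have "(\<Prod>i\<in>I. - z i) = (-1) ^ k * (\<Prod>i\<in>I. z i)" if "I \<in> ksubsets n k" for I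
    using that by (auto simp: prod_uminus ksubsets_def)
  then show ?thesis
    by (simp add: heine_def poly_sum poly_prod sum_distrib_left mult.left_commute)
qed

lemma poly_sum_atMost:
  fixes p :: "complex poly"
  shows "degree p \<le> k \<Longrightarrow> poly p x = (\<Sum>i\<le>k. coeff p i * x ^ i)"
  unfolding poly_altdef by (rule sum.mono_neutral_left) (auto simp: coeff_eq_0)

text \<open>The difference \<open>q\<close> of both sides has degree below \<open>k\<close> and is
  orthogonal to all powers below \<open>k\<close>, hence to itself. Positive masses force it to
  vanish at \<open>n\<close> nodes, more than its degree allows.\<close>

lemma orthogonal_monic_eq_heine:
  assumes inj: "inj_on z {1..n}" and m: "\<And>j. j \<in> {1..n} \<Longrightarrow> 0 < m j" and kn: "k < n"
    and deg: "degree p \<le> k" and monic: "coeff p k = 1"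
    and orth: "\<And>l. l < k \<Longrightarrow> (\<Sum>x=1..n. of_real (m x) * cnj (z x) ^ l * poly p (z x)) = 0"
  shows "smult (of_real (\<Sum>I\<in>ksubsets n k. heine_weight z m I)) p = heine z m n k"
proof -
  define D where "D = complex_of_real (\<Sum>I\<in>ksubsets n k. heine_weight z m I)"
  define q where "q = smult D p - heine z m n k"
  have qk: "coeff q k = 0" by (simp add: q_def D_def coeff_heine monic)
  have degq: "degree q \<le> k"
    unfolding q_def using deg degree_heine by (intro degree_diff_le) (auto intro: order_trans[OF degree_smult_le])
  have q_orth: "(\<Sum>x=1..n. of_real (m x) * cnj (z x) ^ l * poly q (z x)) = 0" if "l < k" for l
  proof -
    have "(\<Sum>x=1..n. of_real (m x) * cnj (z x) ^ l * poly q (z x)) =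
       D * (\<Sum>x=1..n. of_real (m x) * cnj (z x) ^ l * poly p (z x))
       - (\<Sum>x=1..n. of_real (m x) * cnj (z x) ^ l * poly (heine z m n k) (z x))"
      by (simp add: q_def sum_distrib_left sum_subtractf algebra_simps)
    then show ?thesis using orth heine_orthogonal[OF inj] that by simp
  qed
  have qsum: "poly q w = (\<Sum>l<k. coeff q l * w ^ l)" for w
  proof -
    have "poly q w = (\<Sum>l\<le>k. coeff q l * w ^ l)"
      using degq by (rule poly_sum_atMost)
    then show ?thesis using qk by (simp add: lessThan_Suc_atMost[symmetric])
  qed
  have "complex_of_real (\<Sum>x=1..n. m x * (norm (poly q (z x)))\<^sup>2) =
      (\<Sum>x=1..n. of_real (m x) * cnj (poly q (z x)) * poly q (z x))"
    by (simp add: complex_norm_square mult_ac del: of_real_power)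
  also have "\<dots> = (\<Sum>x=1..n. of_real (m x) * cnj (\<Sum>l<k. coeff q l * z x ^ l) * poly q (z x))"
    by (simp only: qsum)
  also have "\<dots> = (\<Sum>x=1..n. \<Sum>l<k. cnj (coeff q l) * (of_real (m x) * cnj (z x) ^ l * poly q (z x)))"
    by (simp add: sum_distrib_left sum_distrib_right mult_ac)
  also have "\<dots> = (\<Sum>l<k. cnj (coeff q l) * (\<Sum>x=1..n. of_real (m x) * cnj (z x) ^ l * poly q (z x)))"
    by (subst sum.swap) (simp add: sum_distrib_left)
  also have "\<dots> = 0" using q_orth by simp
  finally have "(\<Sum>x=1..n. m x * (norm (poly q (z x)))\<^sup>2) = 0"
    by (simp only: of_real_eq_0_iff)
  then have z0: "poly q (z x) = 0" if "x \<in> {1..n}" for x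
    using m that by (subst (asm) sum_nonneg_eq_0_iff) (fastforce intro: less_imp_le)+
  have "q = 0"
  proof (rule poly_eqI_degree[of "z ` {1..n}"])
    show "degree q < card (z ` {1..n})" "degree (0 :: complex poly) < card (z ` {1..n})"
      using degq kn inj by (auto simp: card_image)
  qed (use z0 in auto)
  then show ?thesis by (simp add: q_def D_def)
qed

text \<open>The hypothesis \<open>adj\<close> is a single relation per degree. For the powers 1 to
  \<open>k\<close> the recursion reduces orthogonality of \<open>Phi (Suc k)\<close> to the
  induction hypothesis; \<open>adj\<close> is needed for the power 0 only, because
  \<open>Phis k\<close> is 1 plus higher powers.\<close>

lemma Phi_orthogonal:
  assumes circ: "\<And>j. j \<in> {1..n} \<Longrightarrow> z j * cnj (z j) = 1"
    and adj: "\<And>k. k + 1 < n \<Longrightarrow>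
      (\<Sum>j=1..n. of_real (m j) * cnj (poly (Phis \<alpha> k) (z j)) * poly (Phi \<alpha> (k + 1)) (z j)) = 0"
    and "k < n" "l < k"
  shows "(\<Sum>j=1..n. of_real (m j) * cnj (z j) ^ l * poly (Phi \<alpha> k) (z j)) = 0"
  using \<open>k < n\<close> \<open>l < k\<close>
proof (induction k arbitrary: l)
  case (Suc k)
  let ?E = "\<lambda>g. \<Sum>j=1..n. complex_of_real (m j) * g (z j)"
  have IH: "?E (\<lambda>w. cnj w ^ l * poly (Phi \<alpha> k) w) = 0" if "l < k" for l
    using Suc.IH[OF _ that] Suc.prems by (simp add: mult.assoc)
  have step: "?E (\<lambda>w. cnj w ^ Suc l * poly (Phi \<alpha> (Suc k)) w) = 0" if l: "l < k" for l
  proof -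
    \<comment> \<open>On the circle \<open>Phis\<close> is the reversal of \<open>Phi\<close>, so
      its contribution is the conjugate of an orthogonality relation with the complementary exponent
      \<open>k - Suc l\<close>, again below \<open>k\<close>.\<close>
    have "?E (\<lambda>w. cnj w ^ Suc l * poly (Phi \<alpha> (Suc k)) w) =
        (\<Sum>j=1..n. of_real (m j) * (cnj (z j) ^ l * poly (Phi \<alpha> k) (z j))
          - cnj (\<alpha> k) * cnj (of_real (m j) * (cnj (z j) ^ (k - Suc l) * poly (Phi \<alpha> k) (z j))))"
    proof (rule sum.cong[OF refl])
      fix j assume j: "j \<in> {1..n}"
      let ?w = "z j"
      have c: "?w * cnj ?w = 1" by (rule circ[OF j])
      have "?w ^ k = ?w ^ Suc l * ?w ^ (k - Suc l)"
        using l by (simp add: power_add[symmetric] del: power_Suc)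
      moreover have "cnj ?w ^ Suc l * ?w ^ Suc l = 1"
        using c by (simp add: power_mult_distrib[symmetric] mult.commute del: power_Suc)
      ultimately have k: "cnj ?w ^ Suc l * (?w ^ k * x) = ?w ^ (k - Suc l) * x" for x
        by (simp add: mult.assoc[symmetric] del: power_Suc)
      have c': "cnj ?w ^ Suc l * (?w * x) = cnj ?w ^ l * x" for x
        using c by (simp add: mult.commute mult.left_commute[of _ "cnj ?w"])
      show "of_real (m j) * (cnj ?w ^ Suc l * poly (Phi \<alpha> (Suc k)) ?w) =
         of_real (m j) * (cnj ?w ^ l * poly (Phi \<alpha> k) ?w)
          - cnj (\<alpha> k) * cnj (of_real (m j) * (cnj ?w ^ (k - Suc l) * poly (Phi \<alpha> k) ?w))"
      proof -
        have "of_real (m j) * (cnj ?w ^ Suc l * poly (Phi \<alpha> (Suc k)) ?w) =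
            of_real (m j) * (cnj ?w ^ Suc l * (?w * poly (Phi \<alpha> k) ?w))
            - cnj (\<alpha> k) * (of_real (m j) * (cnj ?w ^ Suc l * (?w ^ k * cnj (poly (Phi \<alpha> k) ?w))))"
          by (simp add: poly_Phis_circle[OF c] right_diff_distrib mult_ac del: power_Suc)
        then show ?thesis unfolding c' k by simp
      qed
    qed
    also have "\<dots> = ?E (\<lambda>w. cnj w ^ l * poly (Phi \<alpha> k) w)
        - cnj (\<alpha> k) * cnj (?E (\<lambda>w. cnj w ^ (k - Suc l) * poly (Phi \<alpha> k) w))"
      by (simp add: sum_subtractf sum_distrib_left)
    also have "\<dots> = 0" using IH[OF l] IH[of "k - Suc l"] l by simp
    finally show ?thesis .
  qed
  have zero: "?E (\<lambda>w. poly (Phi \<alpha> (Suc k)) w) = 0"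
  proof -
    let ?c = "\<lambda>i. coeff (Phis \<alpha> k) i"
    have "0 = ?E (\<lambda>w. cnj (poly (Phis \<alpha> k) w) * poly (Phi \<alpha> (Suc k)) w)"
      using adj[of k] Suc.prems by (simp add: mult.assoc)
    also have "\<dots> = ?E (\<lambda>w. cnj (\<Sum>i\<le>k. ?c i * w ^ i) * poly (Phi \<alpha> (Suc k)) w)"
      by (simp only: poly_sum_atMost[OF conjunct2[OF degree_Phi_Phis[of \<alpha> k]]])
    also have "\<dots> = (\<Sum>j=1..n. \<Sum>i\<le>k. cnj (?c i) * (of_real (m j) * (cnj (z j) ^ i * poly (Phi \<alpha> (Suc k)) (z j))))"
      by (simp only: cnj_sum sum_distrib_left sum_distrib_right complex_cnj_mult complex_cnj_power mult_ac)
    also have "\<dots> = (\<Sum>i\<le>k. cnj (?c i) * ?E (\<lambda>w. cnj w ^ i * poly (Phi \<alpha> (Suc k)) w))"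
      by (subst sum.swap) (simp only: sum_distrib_left)
    \<comment> \<open>The positive powers drop out by \<open>step\<close>; the remaining coefficient
      is 1 by \<open>poly_Phis_0\<close>.\<close>
    also have "\<dots> = (\<Sum>i\<in>{0}. cnj (?c i) * ?E (\<lambda>w. cnj w ^ i * poly (Phi \<alpha> (Suc k)) w))"
    proof (rule sum.mono_neutral_right)
      show "\<forall>i\<in>{..k} - {0}. cnj (?c i) * ?E (\<lambda>w. cnj w ^ i * poly (Phi \<alpha> (Suc k)) w) = 0"
      proof
        fix i assume "i \<in> {..k} - {0}"
        then obtain l where "i = Suc l" "l < k" by (cases i) auto
        then show "cnj (?c i) * ?E (\<lambda>w. cnj w ^ i * poly (Phi \<alpha> (Suc k)) w) = 0"
          using step[of l] by simp
      qed
    qed auto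
    also have "\<dots> = ?E (\<lambda>w. poly (Phi \<alpha> (Suc k)) w)"
      using poly_Phis_0[of \<alpha> k] by (simp add: poly_0_coeff_0)
    finally show ?thesis by simp
  qed
  show ?case
  proof (cases l)
    case 0
    then show ?thesis using zero by simp
  next
    case (Suc l')
    then show ?thesis using step[of l'] Suc.prems by (simp only: mult.assoc)
  qed
qed simp

text \<open>Both forms of the orthogonal polynomial are evaluated at 0 and conjugated. The sign is
  that of the product of the \<open>- z i\<close> times the one from \<open>- cnj\<close>, whence
  the exponent \<open>k - 1\<close>.\<close>

lemma verblunsky_heine:
  assumes inj: "inj_on z {1..n}" and m: "\<And>j. j \<in> {1..n} \<Longrightarrow> 0 < m j"
    and circ: "\<And>j. j \<in> {1..n} \<Longrightarrow> z j * cnj (z j) = 1"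
    and adj: "\<And>k. k + 1 < n \<Longrightarrow>
      (\<Sum>j=1..n. of_real (m j) * cnj (poly (Phis \<alpha> k) (z j)) * poly (Phi \<alpha> (k + 1)) (z j)) = 0"
    and k: "1 \<le> k" "k \<le> n - 1"
  shows "\<alpha> (k - 1) * of_real (\<Sum>I\<in>ksubsets n k. heine_weight z m I) =
    (-1) ^ (k - 1) * (\<Sum>I\<in>ksubsets n k. of_real (heine_weight z m I) * (\<Prod>i\<in>I. cnj (z i)))"
proof -
  let ?D = "complex_of_real (\<Sum>I\<in>ksubsets n k. heine_weight z m I)"
  have kn: "k < n" using k by simp
  have "smult ?D (Phi \<alpha> k) = heine z m n k"
    by (rule orthogonal_monic_eq_heine[OF inj m kn])
       (use degree_Phi_Phis[of \<alpha> k] coeff_Phi_self Phi_orthogonal[OF circ adj kn] in auto)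
  then have "?D * poly (Phi \<alpha> k) 0 = poly (heine z m n k) 0" by (metis poly_smult)
  moreover have "poly (Phi \<alpha> k) 0 = - cnj (\<alpha> (k - 1))"
    using k poly_Phi_Suc_0[of \<alpha> "k - 1"] by simp
  ultimately have "cnj (?D * (- cnj (\<alpha> (k - 1)))) = cnj (poly (heine z m n k) 0)" by simp
  moreover have "(-1 :: complex) ^ k = - ((-1) ^ (k - 1))" using k by (cases k) auto
  ultimately show ?thesis by (simp add: poly_heine_0 mult.commute)
qed

subsection \<open>Diagonalization of CMV matrices\<close>

lemma hinner_mult_vec: "hinner u (A *v w) = hinner (hadj A *v u) w"
proof -
  have "hinner u (A *v w) = (\<Sum>i\<in>UNIV. \<Sum>j\<in>UNIV. cnj (u $ i) * A $ i $ j * w $ j)"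
    by (simp add: hinner_def matrix_vector_mult_def sum_distrib_left mult.assoc)
  also have "\<dots> = (\<Sum>j\<in>UNIV. \<Sum>i\<in>UNIV. cnj (u $ i) * A $ i $ j * w $ j)" by (rule sum.swap)
  also have "\<dots> = hinner (hadj A *v u) w"
    by (simp add: hinner_def matrix_vector_mult_def sum_distrib_right hadj_def mult_ac sum_distrib_left)
  finally show ?thesis .
qed

lemma hinner_unitary: "hadj A ** A = mat 1 \<Longrightarrow> hinner (A *v u) (A *v w) = hinner u w"
  by (simp add: hinner_mult_vec matrix_vector_mul_assoc)

lemma hinner_smult: "hinner (a *s u) (b *s w) = cnj a * b * hinner u w"
  by (simp add: hinner_def sum_distrib_left mult_ac)

lemma hinner_self: "hinner v v = of_real (\<Sum>i\<in>UNIV. (norm (v $ i))\<^sup>2)"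
  by (simp add: hinner_def complex_norm_square mult.commute del: of_real_power)

lemma hinner_self_pos: "v \<noteq> 0 \<Longrightarrow> 0 < (\<Sum>i\<in>UNIV. (norm (v $ i :: complex))\<^sup>2)"
  by (auto simp: vec_eq_iff intro!: sum_pos2)

lemma hinner_e1:
  fixes A :: "complex^'n::{finite,linorder}^'n::{finite,linorder}"
  shows "hinner e1 (A *v e1) = A $ unidx 0 $ unidx 0"
proof -
  have e: "e1 $ i = (if i = unidx 0 then 1 else 0)" for i :: 'n
    by (simp add: e1_def idx_eq_unidx)
  show ?thesis
    by (simp add: hinner_def matrix_vector_mult_def e if_distrib[of "\<lambda>x. x * _"]
        if_distrib[of "\<lambda>x. _ * x"] if_distrib[of cnj] cong: if_cong)
qed

text \<open>Column \<open>j\<close> of the unitary \<open>V\<close> is a normalized eigenvector for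
  eigenvalue number \<open>Suc (idx j)\<close>. The squared moduli in the first row are then the
  masses of the spectral measure at the first basis vector.\<close>

definition diagonalizes ::
    "complex^'n::{finite,linorder}^'n::{finite,linorder} \<Rightarrow> (nat \<Rightarrow> complex) \<Rightarrow> (nat \<Rightarrow> real) \<Rightarrow>
      complex^'n::{finite,linorder}^'n::{finite,linorder} \<Rightarrow> bool" where
  "diagonalizes V z m A \<longleftrightarrow> hadj V ** V = mat 1 \<and> V ** hadj V = mat 1 \<and>
     A ** V = V ** diag (\<lambda>j. z (Suc (idx j))) \<and>
     (\<forall>j. (norm (V $ unidx 0 $ j))\<^sup>2 = m (Suc (idx j)))"

lemma diagonalizes_poly_mat:
  assumes "diagonalizes V z m A"
  shows "poly_mat h A = V ** diag (\<lambda>j. poly h (z (Suc (idx j)))) ** hadj V"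
proof -
  have "poly_mat h A ** V = V ** diag (\<lambda>j. poly h (z (Suc (idx j))))"
    using poly_mat_mult_eigenvectors[of A V _ h] assms unfolding diagonalizes_def by (simp add: poly_mat_diag)
  then show ?thesis
    using assms unfolding diagonalizes_def by (metis matrix_mul_assoc matrix_mul_rid)
qed

text \<open>\<open>g\<close> is an arbitrary function of the index rather than a polynomial in the
  nodes, because adjoints bring in conjugates.\<close>

lemma diagonalizes_corner:
  fixes V :: "complex^'n::{finite,linorder}^'n::{finite,linorder}"
  assumes "diagonalizes V z m A"
  shows "(V ** diag (\<lambda>j. g (Suc (idx j))) ** hadj V) $ unidx 0 $ unidx 0 = (\<Sum>j=1..CARD('n). g j * of_real (m j))"
proof -
  have "(V ** diag (\<lambda>j. g (Suc (idx j))) ** hadj V) $ unidx 0 $ unidx 0 =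
      (\<Sum>j\<in>UNIV. g (Suc (idx j)) * of_real ((norm (V $ unidx 0 $ j))\<^sup>2))"
    unfolding matrix_matrix_mult_def[of "V ** _"] matrix_mult_diag_nth vec_lambda_beta
    by (simp add: hadj_def complex_norm_square mult_ac del: of_real_power)
  also have "\<dots> = (\<Sum>j\<in>UNIV. g (Suc (idx (j :: 'n))) * of_real (m (Suc (idx j))))"
    using assms by (simp add: diagonalizes_def)
  also have "\<dots> = (\<Sum>j=1..CARD('n). g j * of_real (m j))"
    by (rule sum_UNIV_Suc_idx[where g = "\<lambda>k. g k * of_real (m k)"])
  finally show ?thesis .
qed

text \<open>The normalized eigenvectors form an orthonormal family of full size, so the rows of
  \<open>V\<close> are orthonormal as well. Rows \<open>k\<close> and \<open>k + 1\<close> are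
  expressed through \<open>Phi\<close> and \<open>Phis\<close>, and their orthogonality is the last
  conclusion.\<close>

lemma cmv_diagonalizes:
  fixes \<alpha> :: "nat \<Rightarrow> complex"
  assumes verb: "verblunsky CARD('n) \<alpha>" and inj: "inj_on z {1..CARD('n)}"
    and eig: "\<And>j. j \<in> {1..CARD('n)} \<Longrightarrow> z j \<in> eigenvalues (cmv \<alpha> :: complex^'n::{finite,linorder}^'n::{finite,linorder})"
  obtains V m where "diagonalizes V z m (cmv \<alpha> :: complex^'n::{finite,linorder}^'n::{finite,linorder})"
    "\<And>j. j \<in> {1..CARD('n)} \<Longrightarrow> 0 < m j"
    "\<And>j. j \<in> {1..CARD('n)} \<Longrightarrow> z j * cnj (z j) = 1"
    "\<And>k. k + 1 < CARD('n) \<Longrightarrow>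
      (\<Sum>j=1..CARD('n). of_real (m j) * cnj (poly (Phis \<alpha> k) (z j)) * poly (Phi \<alpha> (k + 1)) (z j)) = 0"
proof -
  let ?C = "cmv \<alpha> :: complex^'n::{finite,linorder}^'n::{finite,linorder}"
  let ?N = "{1..CARD('n)}"
  have "\<forall>j\<in>?N. \<exists>y. hinner y y = 1 \<and> ?C *v y = z j *s y"
  proof
    fix j assume "j \<in> ?N"
    then obtain x where x: "x \<noteq> 0" "?C *v x = z j *s x"
      using eig[of j] by (auto simp: eigenvalues_def)
    define N where "N = (\<Sum>i\<in>UNIV. (norm (x $ i))\<^sup>2)"
    have N: "0 < N" unfolding N_def by (rule hinner_self_pos[OF x(1)])
    let ?y = "of_real (1 / sqrt N) *s x"
    have "hinner ?y ?y = of_real (1 / sqrt N) * of_real (1 / sqrt N) * of_real N"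
      by (subst hinner_smult) (simp only: hinner_self N_def[symmetric] complex_cnj_complex_of_real)
    also have "\<dots> = of_real ((1 / sqrt N) * (1 / sqrt N) * N)" by (simp only: of_real_mult)
    also have "\<dots> = 1" using N by simp
    finally have "hinner ?y ?y = 1" .
    moreover have "?C *v ?y = z j *s ?y"
      using x(2) by (simp add: vector_scalar_commute vec.scale mult.commute vector_smult_assoc)
    ultimately show "\<exists>y. hinner y y = 1 \<and> ?C *v y = z j *s y" by blast
  qed
  then obtain y where y1: "\<And>j. j \<in> ?N \<Longrightarrow> hinner (y j) (y j) = 1"
    and yC: "\<And>j. j \<in> ?N \<Longrightarrow> ?C *v y j = z j *s y j" by metis
  \<comment> \<open>Unitarity read on two eigenvectors: \<open>i = j\<close> puts \<open>z i\<close>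
    on the circle, and distinct nodes force the inner product to vanish.\<close>
  have herm: "hinner (y i) (y j) = cnj (z i) * z j * hinner (y i) (y j)" if "i \<in> ?N" "j \<in> ?N" for i j
    using hinner_unitary[OF cmv_unitary[OF verb], of "y i" "y j"] yC that by (simp add: hinner_smult)
  have circ: "z j * cnj (z j) = 1" if "j \<in> ?N" for j
    using herm[OF that that] y1[OF that] by (simp add: mult.commute)
  have orth: "hinner (y i) (y j) = (if i = j then 1 else 0)" if ij: "i \<in> ?N" "j \<in> ?N" for i j
  proof (cases "i = j")
    case False
    have "cnj (z i) * z j \<noteq> 1"
    proof
      assume "cnj (z i) * z j = 1"
      then have "z i = z j" using circ[OF ij(1)] by (metis mult.assoc mult.left_neutral mult.right_neutral)
      then show False using inj_onD[OF inj _ ij] False by blast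
    qed
    then show ?thesis using herm[OF ij] False by auto
  qed (use y1 ij in auto)
  define V where "V = (\<chi> i j. y (Suc (idx j)) $ i :: complex^'n::{finite,linorder}^'n::{finite,linorder})"
  define m where "m j = (norm (y j $ unidx 0))\<^sup>2" for j
  have in_N: "Suc (idx j) \<in> ?N" for j :: 'n by (simp add: Suc_le_eq)
  have VV: "hadj V ** V = mat 1"
  proof -
    have "(hadj V ** V) $ i $ j = hinner (y (Suc (idx i))) (y (Suc (idx j)))" for i j
      by (simp add: matrix_matrix_mult_def hadj_def V_def hinner_def)
    then show ?thesis using orth[OF in_N in_N] by (simp add: vec_eq_iff mat_def)
  qed
  then have VV': "V ** hadj V = mat 1" by (simp add: matrix_left_right_inverse)
  have CV: "?C ** V = V ** diag (\<lambda>j. z (Suc (idx j)))"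
  proof -
    have "(?C ** V) $ i $ j = (?C *v y (Suc (idx j))) $ i" for i j
      by (simp add: matrix_matrix_mult_def matrix_vector_mult_def V_def)
    then show ?thesis
      using yC[OF in_N] by (simp add: vec_eq_iff matrix_mult_diag_nth V_def mult.commute)
  qed
  have diagV: "diagonalizes V z m ?C"
    unfolding diagonalizes_def using VV VV' CV by (simp add: V_def m_def)
  let ?r = "\<lambda>k. \<Prod>i<k. complex_of_real (sqrt (1 - (norm (\<alpha> i))\<^sup>2))"
  have comp: "?r k * y j $ unidx k = cnj (z j) ^ (k div 2) *
      (if even k then poly (Phi \<alpha> k) (z j) else cnj (z j) * poly (Phis \<alpha> k) (z j)) * y j $ unidx 0"
    if "j \<in> ?N" "k < CARD('n)" for j k
    using cmv_eigenvector_components[OF verb circ[OF that(1)] yC[OF that(1)] that(2)] .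
  have r: "?r k \<noteq> 0" if "k < CARD('n)" for k
  proof -
    have "(norm (\<alpha> i))\<^sup>2 \<noteq> 1" if "i < k" for i
    proof -
      have "norm (\<alpha> i) < 1" using verb \<open>k < CARD('n)\<close> that by (simp add: verblunsky_def)
      then show ?thesis by (simp add: abs_square_eq_1)
    qed
    then show ?thesis by (simp add: prod_zero_iff)
  qed
  \<comment> \<open>If the first component were 0, all components would be. Dividing by
    \<open>?r k\<close> is allowed since \<open>k < CARD('n)\<close> keeps the unimodular last
    coefficient out of the product.\<close>
  have mpos: "0 < m j" if j: "j \<in> ?N" for j
  proof -
    have "y j $ unidx 0 \<noteq> 0"
    proof
      assume 0: "y j $ unidx 0 = 0"
      have "y j $ i = 0" for i
        using comp[OF j, of "idx i"] r[of "idx i"] 0 by simp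
      then show False using y1[OF j] by (simp add: hinner_def)
    qed
    then show ?thesis by (simp add: m_def)
  qed
  have adj: "(\<Sum>j\<in>?N. of_real (m j) * cnj (poly (Phis \<alpha> k) (z j)) * poly (Phi \<alpha> (k + 1)) (z j)) = 0"
    if k: "k + 1 < CARD('n)" for k
  proof -
    let ?g = "\<lambda>j. of_real (m j) * cnj (poly (Phis \<alpha> k) (z j)) * poly (Phi \<alpha> (k + 1)) (z j)"
    let ?R = "?r (k + 1) * cnj (?r k)"
    \<comment> \<open>For odd \<open>k\<close> the two components carry \<open>Phi\<close> and
      \<open>Phis\<close> as wanted. For even \<open>k\<close> the roles are exchanged, and
      reversing both factors produces the conjugate.\<close>
    have summand: "?R * (y j $ unidx (k + 1) * cnj (y j $ unidx k)) = (if even k then cnj (?g j) else ?g j)"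
      if j: "j \<in> ?N" for j
    proof -
      define w where "w = cnj (z j) ^ (k div 2)"
      define y0 where "y0 = y j $ unidx 0"
      have w: "w * cnj w = 1" and c: "z j * cnj (z j) = 1"
        using circ[OF j] by (simp_all add: w_def power_mult_distrib[symmetric] mult.commute)
      have m: "complex_of_real (m j) = y0 * cnj y0"
        by (simp add: m_def y0_def complex_norm_square del: of_real_power)
      have "?R * (y j $ unidx (k + 1) * cnj (y j $ unidx k)) = (?r (k + 1) * y j $ unidx (k + 1)) * cnj (?r k * y j $ unidx k)"
        by (simp only: complex_cnj_mult mult_ac)
      also have "\<dots> = (if even k then cnj (?g j) else ?g j)"
      proof (cases "even k")
        case True
        have "?r (k + 1) * y j $ unidx (k + 1) = w * (cnj (z j) * poly (Phis \<alpha> (k + 1)) (z j)) * y0"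
          "?r k * y j $ unidx k = w * poly (Phi \<alpha> k) (z j) * y0"
          unfolding w_def y0_def using comp[OF j, of k] comp[OF j, of "k + 1"] k True by simp_all
        moreover have "cnj (z j) * poly (Phis \<alpha> (k + 1)) (z j) = z j ^ k * cnj (poly (Phi \<alpha> (k + 1)) (z j))"
          using c by (simp only: poly_Phis_circle[OF c] power_add power_one_right) (simp add: mult_ac)
        ultimately have "(?r (k + 1) * y j $ unidx (k + 1)) * cnj (?r k * y j $ unidx k) =
            (w * cnj w) * (y0 * cnj y0) * (z j ^ k * cnj (poly (Phi \<alpha> k) (z j))) * cnj (poly (Phi \<alpha> (k + 1)) (z j))"
          by (simp only: complex_cnj_mult mult_ac)
        also have "\<dots> = of_real (m j) * poly (Phis \<alpha> k) (z j) * cnj (poly (Phi \<alpha> (k + 1)) (z j))"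
          by (simp only: w m poly_Phis_circle[OF c] mult_1)
        finally show ?thesis using True by simp
      next
        case False
        have "?r (k + 1) * y j $ unidx (k + 1) = cnj (z j) * w * poly (Phi \<alpha> (k + 1)) (z j) * y0"
          "?r k * y j $ unidx k = w * (cnj (z j) * poly (Phis \<alpha> k) (z j)) * y0"
          unfolding w_def y0_def using comp[OF j, of k] comp[OF j, of "k + 1"] k False by (auto elim!: oddE)
        then have "(?r (k + 1) * y j $ unidx (k + 1)) * cnj (?r k * y j $ unidx k) =
            (w * cnj w) * (z j * cnj (z j)) * (y0 * cnj y0) * cnj (poly (Phis \<alpha> k) (z j)) * poly (Phi \<alpha> (k + 1)) (z j)"
          by (simp only: complex_cnj_mult complex_cnj_cnj mult_ac)
        also have "\<dots> = ?g j"
          by (simp only: w m c mult_1)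
        finally show ?thesis using False by simp
      qed
      finally show ?thesis .
    qed
    have "(V ** hadj V) $ unidx (k + 1) $ unidx k = 0"
      using k unfolding VV' mat_def by (simp flip: idx_eq_iff)
    then have "(\<Sum>j\<in>UNIV. y (Suc (idx (j :: 'n))) $ unidx (k + 1) * cnj (y (Suc (idx j)) $ unidx k)) = 0"
      by (simp add: matrix_matrix_mult_def V_def hadj_def)
    then have "(\<Sum>j\<in>?N. y j $ unidx (k + 1) * cnj (y j $ unidx k)) = 0"
      using sum_UNIV_Suc_idx[where g = "\<lambda>l. y l $ unidx (k + 1) * cnj (y l $ unidx k)" and 'n='n] by simp
    then have "0 = (\<Sum>j\<in>?N. ?R * (y j $ unidx (k + 1) * cnj (y j $ unidx k)))"
      unfolding sum_distrib_left[symmetric] by simp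
    also have "\<dots> = (\<Sum>j\<in>?N. if even k then cnj (?g j) else ?g j)"
      using summand by (intro sum.cong refl)
    also have "\<dots> = (if even k then cnj (sum ?g ?N) else sum ?g ?N)"
      by simp
    finally show ?thesis by (auto split: if_splits simp del: cnj_sum)
  qed
  show ?thesis using that[OF diagV mpos circ adj] by blast
qed

subsection \<open>Evolution of the spectral measure\<close>

text \<open>Row 0 of the skew part is row 0 of \<open>X\<close>, and column 0 is that of
  \<open>- hadj X\<close>, both up to the real part of the corner entry. So the corner of the
  commutator sees only \<open>X\<close> and its adjoint, both functions of the matrix along the
  flow.\<close>

lemma pi_a_corner:
  fixes X Y :: "complex^'n::{finite,linorder}^'n::{finite,linorder}"
  shows "(pi_a X ** Y - Y ** pi_a X) $ unidx 0 $ unidx 0 =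
    (X ** Y + Y ** hadj X) $ unidx 0 $ unidx 0 - of_real (2 * Re (X $ unidx 0 $ unidx 0)) * Y $ unidx 0 $ unidx 0"
proof -
  let ?o = "unidx 0 :: 'n" and ?A = "skew_part X"
  let ?r = "complex_of_real (Re (X $ ?o $ ?o))"
  have im: "\<i> * complex_of_real (Im c) = c - of_real (Re c)" "\<i> * complex_of_real (Im c) = of_real (Re c) - cnj c" for c
    by (simp_all add: complex_eq_iff)
  have row: "?A $ ?o $ j = X $ ?o $ j - (if j = ?o then ?r else 0)" for j
    using unidx_0_less[of j] by (auto simp: skew_part_def im(1))
  have col: "?A $ j $ ?o = (if j = ?o then ?r else 0) - hadj X $ j $ ?o" for j
    using unidx_0_less[of j] by (auto simp: skew_part_def hadj_def im(2) not_less_iff_gr_or_eq)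
  have "(?A ** Y) $ ?o $ ?o = (X ** Y) $ ?o $ ?o - ?r * Y $ ?o $ ?o"
    unfolding matrix_matrix_mult_def vec_lambda_beta row
    by (simp add: left_diff_distrib sum_subtractf if_distrib[of "\<lambda>x. x * _"] cong: if_cong)
  moreover have "(Y ** ?A) $ ?o $ ?o = ?r * Y $ ?o $ ?o - (Y ** hadj X) $ ?o $ ?o"
    unfolding matrix_matrix_mult_def vec_lambda_beta col
    by (simp add: right_diff_distrib sum_subtractf if_distrib[of "\<lambda>x. _ * x"] mult.commute cong: if_cong)
  ultimately show ?thesis by (simp add: pi_a_eq)
qed

section \<open>Node polynomials and isospectrality\<close>

definition node_poly :: "(nat \<Rightarrow> complex) \<Rightarrow> nat set \<Rightarrow> complex poly" where
  "node_poly z S = (\<Prod>i\<in>S. [:- z i, 1:])"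

lemma poly_node_poly_eq_0_iff:
  assumes "finite S"
  shows "poly (node_poly z S) w = 0 \<longleftrightarrow> w \<in> z ` S"
proof -
  have "poly (node_poly z S) w = (\<Prod>i\<in>S. w - z i)"
    by (simp add: node_poly_def poly_prod)
  then show ?thesis using assms by (simp add: prod_zero_iff image_iff)
qed

text \<open>Evaluated at a matrix diagonalized with these nodes, this is the spectral projection for
  \<open>z j\<close>; its corner entry is the mass \<open>m j\<close>.\<close>

definition lagrange :: "(nat \<Rightarrow> complex) \<Rightarrow> nat \<Rightarrow> nat \<Rightarrow> complex poly" where
  "lagrange z n j = smult (inverse (poly (node_poly z ({1..n} - {j})) (z j))) (node_poly z ({1..n} - {j}))"

lemma poly_lagrange:
  assumes "inj_on z {1..n}" "i \<in> {1..n}" "j \<in> {1..n}"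
  shows "poly (lagrange z n j) (z i) = (if i = j then 1 else 0)"
proof -
  have mem: "z i \<in> z ` ({1..n} - {j}) \<longleftrightarrow> i \<noteq> j"
    using inj_onD[OF assms(1) _ assms(2)] assms(2) by blast
  have "poly (node_poly z ({1..n} - {j})) (z i) = 0 \<longleftrightarrow> i \<noteq> j"
    by (simp only: poly_node_poly_eq_0_iff finite_Diff finite_atLeastAtMost mem)
  then show ?thesis by (cases "i = j") (simp_all add: lagrange_def)
qed

text \<open>Equal Frobenius norms mean that \<open>A\<close> and \<open>B\<close> are annihilated by
  the same polynomials. The full node polynomial kills \<open>B\<close>, the one without the factor
  of \<open>z j\<close> does not, and any nonzero column of the latter's value at \<open>B\<close>
  is an eigenvector.\<close>

lemma eigenvalues_isospectral:
  fixes A B :: "complex^'n::{finite,linorder}^'n::{finite,linorder}"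
  assumes frob: "\<And>h. frob (poly_mat h B) = frob (poly_mat h A)"
    and A: "diagonalizes V z m A" and inj: "inj_on z {1..CARD('n)}" and j: "j \<in> {1..CARD('n)}"
  shows "z j \<in> eigenvalues B"
proof -
  let ?N = "{1..CARD('n)}"
  let ?q = "node_poly z (?N - {j})"
  have in_N: "Suc (idx i) \<in> ?N" for i :: 'n by (simp add: Suc_le_eq)
  have V: "V ** hadj V = mat 1" "hadj V ** V = mat 1" using A by (auto simp: diagonalizes_def)
  have "poly_mat (node_poly z ?N) A = 0"
  proof -
    have "poly (node_poly z ?N) (z (Suc (idx i))) = 0" for i :: 'n
      using in_N[of i] by (simp add: poly_node_poly_eq_0_iff del: atLeastAtMost_iff)
    then have "diag (\<lambda>i :: 'n. poly (node_poly z ?N) (z (Suc (idx i)))) = 0"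
      by (simp add: diag_def vec_eq_iff)
    then show ?thesis by (simp add: diagonalizes_poly_mat[OF A])
  qed
  then have "poly_mat (node_poly z ?N) B = 0"
    using frob[of "node_poly z ?N"] frob_eq_0_iff by metis
  moreover have "node_poly z ?N = [:- z j, 1:] * ?q"
    unfolding node_poly_def using j by (rule prod.remove[rotated]) simp
  ultimately have zero: "(mat (- z j) + B) ** poly_mat ?q B = 0"
    by (simp add: poly_mat_mult poly_mat_pCons del: mult_pCons_left)
  have "poly_mat ?q A \<noteq> 0"
  proof
    assume "poly_mat ?q A = 0"
    then have "V ** diag (\<lambda>j. poly ?q (z (Suc (idx j)))) ** hadj V = 0"
      by (simp add: diagonalizes_poly_mat[OF A])
    then have "hadj V ** (V ** diag (\<lambda>j. poly ?q (z (Suc (idx j)))) ** hadj V) ** V = 0" by simp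
    then have "diag (\<lambda>j :: 'n. poly ?q (z (Suc (idx j)))) = 0"
      using V by (metis matrix_mul_assoc matrix_mul_lid matrix_mul_rid)
    then have "poly ?q (z (Suc (idx i))) = 0" for i :: 'n
      by (simp add: diag_def vec_eq_iff) metis
    moreover have "idx (unidx (j - 1) :: 'n) = j - 1" using j by (intro idx_unidx) auto
    ultimately have "poly ?q (z (Suc (j - 1))) = 0" by metis
    then have "poly ?q (z j) = 0" using j by simp
    then have "z j \<in> z ` (?N - {j})"
      by (simp only: poly_node_poly_eq_0_iff finite_Diff finite_atLeastAtMost)
    then obtain i where "i \<in> ?N" "i \<noteq> j" "z j = z i" by blast
    then show False using inj_onD[OF inj, of j i] j by blast
  qed
  then have "poly_mat ?q B \<noteq> 0" using frob[of ?q] frob_eq_0_iff by metis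
  then obtain a b where ab: "poly_mat ?q B $ a $ b \<noteq> 0" by (auto simp: vec_eq_iff)
  define v where "v = (\<chi> i. poly_mat ?q B $ i $ b)"
  have "(mat (- z j) + B) *v v = 0"
    using zero by (simp add: vec_eq_iff matrix_matrix_mult_def matrix_vector_mult_def v_def)
  then have "B *v v = z j *s v"
    by (simp add: matrix_vector_mult_add_rdistrib mat_mul_vec add_eq_0_iff2 vec_eq_iff)
  moreover have "v \<noteq> 0" using ab by (auto simp: v_def vec_eq_iff)
  ultimately show ?thesis unfolding eigenvalues_def by blast
qed

section \<open>Masses as corner entries and their evolution\<close>

lemma diagonalizes_corner_poly:
  fixes V :: "complex^'n::{finite,linorder}^'n::{finite,linorder}"
  assumes "diagonalizes V z m A"
  shows "poly_mat h A $ unidx 0 $ unidx 0 = (\<Sum>j=1..CARD('n). poly h (z j) * of_real (m j))"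
  unfolding diagonalizes_poly_mat[OF assms]
  by (rule diagonalizes_corner[OF assms, where g = "\<lambda>j. poly h (z j)"])

lemma diagonalizes_lagrange:
  fixes V :: "complex^'n::{finite,linorder}^'n::{finite,linorder}"
  assumes "diagonalizes V z m A" "inj_on z {1..CARD('n)}" "j \<in> {1..CARD('n)}"
  shows "poly_mat (lagrange z CARD('n) j) A $ unidx 0 $ unidx 0 = of_real (m j)"
proof -
  have "(\<Sum>i=1..CARD('n). poly (lagrange z CARD('n) j) (z i) * of_real (m i)) =
      (\<Sum>i=1..CARD('n). if i = j then complex_of_real (m j) else 0)"
    using assms by (intro sum.cong) (auto simp: poly_lagrange)
  then show ?thesis using assms by (simp add: diagonalizes_corner_poly[OF assms(1)])
qed

text \<open>\<open>X\<close>, its adjoint and \<open>Y\<close> are all diagonal in the basis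
  \<open>V\<close>. Node \<open>k\<close> contributes twice the real part of its value under
  \<open>X\<close>, and the Lagrange polynomial in \<open>Y\<close> retains only
  \<open>k = j\<close>.\<close>

lemma lax_corner_derivative:
  fixes f :: "complex poly" and V A :: "complex^'n::{finite,linorder}^'n::{finite,linorder}"
  assumes V: "diagonalizes V z m A" and inj: "inj_on z {1..CARD('n)}" and j: "j \<in> {1..CARD('n)}"
  defines "X \<equiv> A ** poly_mat (pderiv f) A" and "Y \<equiv> poly_mat (lagrange z CARD('n) j) A"
  shows "(pi_a X ** Y - Y ** pi_a X) $ unidx 0 $ unidx 0 =
    of_real ((2 * Re (z j * poly (pderiv f) (z j)) - 2 * Re (X $ unidx 0 $ unidx 0)) * m j)"
proof -
  let ?n = "CARD('n)"
  let ?x = "\<lambda>k. z k * poly (pderiv f) (z k)" and ?l = "\<lambda>k. poly (lagrange z ?n j) (z k)"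
  let ?d = "\<lambda>g. diag (\<lambda>i :: 'n. g (Suc (idx i)))"
  have VV: "hadj V ** V = mat 1" using V by (simp add: diagonalizes_def)
  have "X = poly_mat (pCons 0 (pderiv f)) A" by (simp add: X_def poly_mat_pCons)
  then have X: "X = V ** ?d ?x ** hadj V" by (simp add: diagonalizes_poly_mat[OF V])
  have Y: "Y = V ** ?d ?l ** hadj V" by (simp add: Y_def diagonalizes_poly_mat[OF V])
  have X': "hadj X = V ** ?d (\<lambda>k. cnj (?x k)) ** hadj V"
    by (simp add: X hadj_mult hadj_diag matrix_mul_assoc)
  have mul: "(V ** ?d g ** hadj V) ** (V ** ?d h ** hadj V) = V ** ?d (\<lambda>k. g k * h k) ** hadj V" for g h
  proof -
    have "(V ** ?d g ** hadj V) ** (V ** ?d h ** hadj V) = V ** ?d g ** (hadj V ** V) ** ?d h ** hadj V"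
      by (simp only: matrix_mul_assoc)
    also have "\<dots> = V ** (?d g ** ?d h) ** hadj V"
      unfolding VV by (simp add: matrix_mul_assoc)
    finally show ?thesis by (simp only: diag_mult)
  qed
  have XY: "X ** Y = V ** ?d (\<lambda>k. ?x k * ?l k) ** hadj V"
    unfolding X Y by (rule mul)
  have YX: "Y ** hadj X = V ** ?d (\<lambda>k. ?l k * cnj (?x k)) ** hadj V"
    unfolding X' Y by (rule mul)
  have "(X ** Y) $ unidx 0 $ unidx 0 = (\<Sum>k=1..?n. ?x k * ?l k * of_real (m k))"
    unfolding XY by (rule diagonalizes_corner[OF V, where g = "\<lambda>k. ?x k * ?l k"])
  moreover have "(Y ** hadj X) $ unidx 0 $ unidx 0 = (\<Sum>k=1..?n. ?l k * cnj (?x k) * of_real (m k))"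
    unfolding YX by (rule diagonalizes_corner[OF V, where g = "\<lambda>k. ?l k * cnj (?x k)"])
  ultimately have "(X ** Y + Y ** hadj X) $ unidx 0 $ unidx 0 =
      (\<Sum>k=1..?n. ?x k * ?l k * of_real (m k)) + (\<Sum>k=1..?n. ?l k * cnj (?x k) * of_real (m k))"
    by (simp only: vector_add_component)
  also have "\<dots> = (\<Sum>k=1..?n. if k = j then of_real (2 * Re (?x j) * m j) else 0)"
    unfolding sum.distrib[symmetric]
  proof (rule sum.cong[OF refl])
    fix k assume k: "k \<in> {1..?n}"
    have "c * of_real r + cnj c * of_real r = of_real (2 * Re c * r)" for c r
      by (simp add: complex_eq_iff)
    note re = this[of "?x j" "m j"]
    show "?x k * ?l k * of_real (m k) + ?l k * cnj (?x k) * of_real (m k) =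
        (if k = j then of_real (2 * Re (?x j) * m j) else 0)"
    proof (cases "k = j")
      case True
      have l1: "?l j = 1" using poly_lagrange[OF inj j j] by simp
      have "?x j * ?l j * of_real (m j) + ?l j * cnj (?x j) * of_real (m j) = of_real (2 * Re (?x j) * m j)"
        by (simp only: l1 mult_1 mult_1_right re)
      with \<open>k = j\<close> show ?thesis by metis
    next
      case False
      then show ?thesis using poly_lagrange[OF inj k j] by simp
    qed
  qed
  also have "\<dots> = of_real (2 * Re (?x j) * m j)" using j by simp
  finally show ?thesis
    unfolding pi_a_corner using diagonalizes_lagrange[OF V inj j]
    by (simp add: Y_def algebra_simps)
qed

text \<open>Each \<open>M t j * exp (- lam j * t)\<close> solves the same scalar equation with rate
  \<open>- c t\<close>, so quotients of two of them are constant and \<open>c\<close> cancels.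
  \<open>i0\<close> serves as the reference solution.\<close>

lemma proportional_solutions:
  fixes M :: "real \<Rightarrow> 'b \<Rightarrow> real"
  assumes deriv: "\<And>j t. j \<in> S \<Longrightarrow> 0 \<le> t \<Longrightarrow>
      ((\<lambda>s. M s j) has_real_derivative (lam j - c t) * M t j) (at t within {0..})"
    and pos: "\<And>j t. j \<in> S \<Longrightarrow> 0 \<le> t \<Longrightarrow> 0 < M t j" and i0: "i0 \<in> S" and j: "j \<in> S" and t: "0 \<le> t"
  shows "M t j = M t i0 * exp (- lam i0 * t) / M 0 i0 * exp (lam j * t) * M 0 j"
proof -
  let ?g = "\<lambda>j t. M t j * exp (- lam j * t)"
  have g: "((\<lambda>s. ?g j s) has_real_derivative - c s * ?g j s) (at s within {0..})" if "j \<in> S" "0 \<le> s" for j s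
    by (rule derivative_eq_intros deriv[OF that] refl)+ (simp add: algebra_simps)
  have "((\<lambda>s. ?g j s / ?g i0 s) has_real_derivative 0) (at s within {0..})" if "s \<in> {0..}" for s
  proof -
    have "?g i0 s \<noteq> 0" using pos[OF i0, of s] that by simp
    from DERIV_divide[OF g[OF j] g[OF i0] this] show ?thesis using that by (simp add: algebra_simps)
  qed
  then have "\<exists>k. \<forall>x\<in>{0..}. ?g j x / ?g i0 x = k"
    by (intro has_field_derivative_zero_constant) auto
  then have "?g j t / ?g i0 t = ?g j 0 / ?g i0 0" using t by (metis atLeast_iff order_refl)
  then have "M t j * exp (- lam j * t) = M t i0 * exp (- lam i0 * t) / M 0 i0 * M 0 j"
    using pos[OF i0, of t] pos[OF i0, of 0] t by (simp add: field_simps)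
  then have "(M t j * exp (- lam j * t)) * exp (lam j * t) = M t i0 * exp (- lam i0 * t) / M 0 i0 * M 0 j * exp (lam j * t)"
    by simp
  then show ?thesis by (simp add: mult.assoc flip: exp_add)
qed

text \<open>Positivity of the masses and unimodularity of the nodes come from diagonalizing the CMV
  matrix. The fourth claim is Heine's formula at time \<open>t\<close>, written in the masses at
  time 0 and cleared of its denominator.\<close>

lemma verblunsky_evolution:
  fixes f :: "complex poly"
    and C :: "real \<Rightarrow> complex^'n::{finite,linorder}^'n::{finite,linorder}"
    and \<alpha> :: "real \<Rightarrow> nat \<Rightarrow> complex"
  defines "n \<equiv> CARD('n)"
  assumes flow: "hamiltonian_flow (\<lambda>B. Im (trace (poly_mat f B))) C"
    and verb: "\<And>t. 0 \<le> t \<Longrightarrow> verblunsky n (\<alpha> t)"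
    and cmv: "\<And>t. 0 \<le> t \<Longrightarrow> C t = cmv (\<alpha> t)"
    and spec: "spectral_data (C 0) z \<mu>"
    and lam: "\<And>j. lam j = 2 * Re (z j * poly (pderiv f) (z j))"
  shows "inj_on z {1..n}" and "\<And>j. j \<in> {1..n} \<Longrightarrow> 0 < \<mu> j"
    and "\<And>j. j \<in> {1..n} \<Longrightarrow> z j * cnj (z j) = 1"
    and "\<And>t k. 0 \<le> t \<Longrightarrow> 1 \<le> k \<Longrightarrow> k \<le> n - 1 \<Longrightarrow>
      \<alpha> t (k - 1) * of_real (\<Sum>I\<in>ksubsets n k. heine_weight z \<mu> I * exp (sum lam I * t)) =
      (-1) ^ (k - 1) * (\<Sum>I\<in>ksubsets n k. of_real (heine_weight z \<mu> I * exp (sum lam I * t)) * (\<Prod>i\<in>I. cnj (z i)))"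
proof -
  let ?N = "{1..n}"
  have bij: "bij_betw z ?N (eigenvalues (C 0))"
    using spec by (simp add: spectral_data_def n_def)
  then show inj: "inj_on z ?N" by (simp add: bij_betw_def)
  note inj' = inj[unfolded n_def]
  have ev0: "z j \<in> eigenvalues (C 0)" if "j \<in> ?N" for j
    using bij that by (auto simp: bij_betw_def)
  define A where "A t = pi_a (C t ** poly_mat (pderiv f) (C t))" for t
  have lax: "has_mat_derivative C (A t ** C t - C t ** A t) (at t within {0..})" if "0 \<le> t" for t
    unfolding A_def by (rule hamiltonian_flow_lax[OF flow that])
  have skew: "hadj (A t) = - A t" for t
    unfolding A_def pi_a_eq using skew_part_in skew_hermitian_iff by blast
  have ex: "\<exists>V m. diagonalizes V z m (C t) \<and> (\<forall>j\<in>?N. 0 < m j) \<and> (\<forall>j\<in>?N. z j * cnj (z j) = 1) \<and>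
      (\<forall>k. k + 1 < n \<longrightarrow>
      (\<Sum>j\<in>?N. of_real (m j) * cnj (poly (Phis (\<alpha> t) k) (z j)) * poly (Phi (\<alpha> t) (k + 1)) (z j)) = 0)"
    if t: "0 \<le> t" and ev: "\<And>j. j \<in> ?N \<Longrightarrow> z j \<in> eigenvalues (C t)" for t
  proof (rule cmv_diagonalizes)
    show "verblunsky CARD('n) (\<alpha> t)" using verb[OF t] by (simp add: n_def)
    show "inj_on z {1..CARD('n)}" by (rule inj')
    show "z j \<in> eigenvalues (cmv (\<alpha> t) :: complex^'n::{finite,linorder}^'n::{finite,linorder})"
      if "j \<in> {1..CARD('n)}" for j
      using ev[of j] that by (simp add: cmv[OF t] n_def)
  qed (unfold n_def cmv[OF t], blast)
  \<comment> \<open>Only at time 0 are the eigenvalues given; this diagonalization carries every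
    \<open>z j\<close> to later times.\<close>
  obtain V0 m0 where V0: "diagonalizes V0 z m0 (C 0)"
    using ex[OF order_refl ev0] by blast
  have ev: "z j \<in> eigenvalues (C t)" if j: "j \<in> ?N" and t: "0 \<le> t" for j t
  proof (rule eigenvalues_isospectral[OF _ V0 inj'])
    show "frob (poly_mat h (C t)) = frob (poly_mat h (C 0))" for h
      by (rule frob_lax_const[of A]) (use skew lax t in auto)
    show "j \<in> {1..CARD('n)}" using j by (simp add: n_def)
  qed
  \<comment> \<open>The masses \<open>m t\<close> below come from a pointwise choice.
    \<open>M\<close> agrees with them but is an entry of a polynomial of \<open>C t\<close>, so it
    can be differentiated.\<close>
  define M where "M t j = Re (poly_mat (lagrange z n j) (C t) $ unidx 0 $ unidx 0)" for t j
  have "\<forall>t. \<exists>V m. 0 \<le> t \<longrightarrow> diagonalizes V z m (C t) \<and> (\<forall>j\<in>?N. 0 < m j) \<and> (\<forall>j\<in>?N. z j * cnj (z j) = 1) \<and>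
      (\<forall>k. k + 1 < n \<longrightarrow>
      (\<Sum>j\<in>?N. of_real (m j) * cnj (poly (Phis (\<alpha> t) k) (z j)) * poly (Phi (\<alpha> t) (k + 1)) (z j)) = 0)"
    using ex ev by blast
  from choice[OF this] obtain V where "\<forall>t. \<exists>m. 0 \<le> t \<longrightarrow> diagonalizes (V t) z m (C t) \<and> (\<forall>j\<in>?N. 0 < m j) \<and> (\<forall>j\<in>?N. z j * cnj (z j) = 1) \<and>
      (\<forall>k. k + 1 < n \<longrightarrow>
      (\<Sum>j\<in>?N. of_real (m j) * cnj (poly (Phis (\<alpha> t) k) (z j)) * poly (Phi (\<alpha> t) (k + 1)) (z j)) = 0)" ..
  from choice[OF this] obtain m where Vm: "\<forall>t. 0 \<le> t \<longrightarrow> diagonalizes (V t) z (m t) (C t) \<and> (\<forall>j\<in>?N. 0 < m t j) \<and> (\<forall>j\<in>?N. z j * cnj (z j) = 1) \<and>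
      (\<forall>k. k + 1 < n \<longrightarrow>
      (\<Sum>j\<in>?N. of_real (m t j) * cnj (poly (Phis (\<alpha> t) k) (z j)) * poly (Phi (\<alpha> t) (k + 1)) (z j)) = 0)" ..
  have V: "\<And>t. 0 \<le> t \<Longrightarrow> diagonalizes (V t) z (m t) (C t)"
    and mpos: "\<And>t j. 0 \<le> t \<Longrightarrow> j \<in> ?N \<Longrightarrow> 0 < m t j"
    and circ: "\<And>j. j \<in> ?N \<Longrightarrow> z j * cnj (z j) = 1"
    and adj: "\<And>t k. 0 \<le> t \<Longrightarrow> k + 1 < n \<Longrightarrow>
      (\<Sum>j\<in>?N. of_real (m t j) * cnj (poly (Phis (\<alpha> t) k) (z j)) * poly (Phi (\<alpha> t) (k + 1)) (z j)) = 0"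
    using Vm by blast+
  have Mm: "M t j = m t j" if "0 \<le> t" "j \<in> ?N" for t j
    using diagonalizes_lagrange[OF V[OF that(1)] inj', of j] that(2) by (simp add: M_def n_def)
  define c where "c t = 2 * Re ((C t ** poly_mat (pderiv f) (C t)) $ unidx 0 $ unidx 0)" for t
  have dM: "((\<lambda>s. M s j) has_real_derivative (lam j - c t) * M t j) (at t within {0..})"
    if "j \<in> ?N" "0 \<le> t" for j t
  proof -
    have "((\<lambda>s. poly_mat (lagrange z n j) (C s) $ unidx 0 $ unidx 0) has_vector_derivative
        of_real ((lam j - c t) * m t j)) (at t within {0..})"
      using lax_poly_mat[OF lax[OF that(2)], of "lagrange z n j"]
        lax_corner_derivative[OF V[OF that(2)] inj', of j f] that(1)
      unfolding has_mat_derivative_def A_def c_def lam n_def by metis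
    from has_vector_derivative_Re[OF this] show ?thesis
      using Mm[OF that(2,1)] by (simp add: M_def)
  qed
  have Mpos: "0 < M t j" if "j \<in> ?N" "0 \<le> t" for j t
    using mpos Mm that by simp
  \<comment> \<open>The spectral measure tested against a Lagrange polynomial isolates one
    mass.\<close>
  have M0: "M 0 j = \<mu> j" if j: "j \<in> ?N" for j
  proof -
    have "poly_mat (lagrange z n j) (C 0) $ unidx 0 $ unidx 0 =
        (\<Sum>k=1..n. poly (lagrange z n j) (z k) * of_real (\<mu> k))"
      using spec unfolding spectral_data_def hinner_e1 n_def by blast
    also have "\<dots> = (\<Sum>k=1..n. if k = j then of_real (\<mu> j) else 0)"
      using poly_lagrange[OF inj] j by (intro sum.cong) auto
    finally show ?thesis using j by (simp add: M_def)
  qed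
  show mu: "0 < \<mu> j" if "j \<in> ?N" for j using Mpos[OF that, of 0] M0[OF that] by simp
  show "z j * cnj (z j) = 1" if "j \<in> ?N" for j using circ[OF that] .
  show "\<alpha> t (k - 1) * of_real (\<Sum>I\<in>ksubsets n k. heine_weight z \<mu> I * exp (sum lam I * t)) =
      (-1) ^ (k - 1) * (\<Sum>I\<in>ksubsets n k. of_real (heine_weight z \<mu> I * exp (sum lam I * t)) * (\<Prod>i\<in>I. cnj (z i)))"
    if t: "0 \<le> t" and k: "1 \<le> k" "k \<le> n - 1" for t k
  proof -
    have one: "1 \<in> ?N" using k by simp
    \<comment> \<open>The common factor of all masses, with node 1 as reference. Each weight of a
      \<open>k\<close>-set scales by its \<open>k\<close>-th power, which cancels between the two
      sides.\<close>
    define \<kappa> where "\<kappa> = M t 1 * exp (- lam 1 * t) / M 0 1"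
    have "0 < \<kappa>" using Mpos[OF one t] Mpos[OF one, of 0] by (simp add: \<kappa>_def)
    have m: "m t j = \<kappa> * exp (lam j * t) * \<mu> j" if "j \<in> ?N" for j
      using proportional_solutions[of ?N M lam c 1 j t, OF dM Mpos one that t] Mm[OF t that] M0[OF that]
      by (simp add: \<kappa>_def)
    have W: "heine_weight z (m t) I = \<kappa> ^ k * (heine_weight z \<mu> I * exp (sum lam I * t))"
      if I: "I \<in> ksubsets n k" for I
    proof -
      have "(\<Prod>i\<in>I. m t i) = (\<Prod>i\<in>I. \<kappa> * (exp (lam i * t) * \<mu> i))"
        using I m by (intro prod.cong) (auto simp: ksubsets_def)
      also have "\<dots> = \<kappa> ^ k * (exp (sum lam I * t) * (\<Prod>i\<in>I. \<mu> i))"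
        using I ksubsets_finite[OF I]
        by (simp add: prod.distrib ksubsets_def exp_sum sum_distrib_right)
      finally show ?thesis by (simp add: heine_weight_def)
    qed
    have "\<alpha> t (k - 1) * of_real (\<Sum>I\<in>ksubsets n k. heine_weight z (m t) I) =
        (-1) ^ (k - 1) * (\<Sum>I\<in>ksubsets n k. of_real (heine_weight z (m t) I) * (\<Prod>i\<in>I. cnj (z i)))"
      by (rule verblunsky_heine[OF inj mpos[OF t] circ adj[OF t] k])
    moreover have "(\<Sum>I\<in>ksubsets n k. heine_weight z (m t) I) =
        \<kappa> ^ k * (\<Sum>I\<in>ksubsets n k. heine_weight z \<mu> I * exp (sum lam I * t))"
      by (simp add: sum_distrib_left W)
    moreover have "(\<Sum>I\<in>ksubsets n k. of_real (heine_weight z (m t) I) * (\<Prod>i\<in>I. cnj (z i))) =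
        of_real (\<kappa> ^ k) * (\<Sum>I\<in>ksubsets n k. of_real (heine_weight z \<mu> I * exp (sum lam I * t)) * (\<Prod>i\<in>I. cnj (z i)))"
      by (simp add: sum_distrib_left W mult.assoc)
    ultimately have "of_real (\<kappa> ^ k) * (\<alpha> t (k - 1) * of_real (\<Sum>I\<in>ksubsets n k. heine_weight z \<mu> I * exp (sum lam I * t))) =
        of_real (\<kappa> ^ k) * ((-1) ^ (k - 1) * (\<Sum>I\<in>ksubsets n k. of_real (heine_weight z \<mu> I * exp (sum lam I * t)) * (\<Prod>i\<in>I. cnj (z i))))"
      by (simp only: of_real_mult mult_ac)
    then show ?thesis using \<open>0 < \<kappa>\<close> by (subst (asm) mult_cancel_left) auto
  qed
qed

subsection \<open>Ratios of exponential sums\<close>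

text \<open>\<open>d I\<close> is the deficit from the maximal exponent, so only terms with
  \<open>d I = 0\<close> survive; their positive weights keep the limit of the denominator away from
  0.\<close>

lemma exp_ratio_limit:
  fixes W d :: "'i \<Rightarrow> real" and c :: "'i \<Rightarrow> complex" and a :: "real \<Rightarrow> complex"
  assumes fin: "finite S" and W: "\<And>I. I \<in> S \<Longrightarrow> 0 < W I" and d: "\<And>I. I \<in> S \<Longrightarrow> 0 \<le> d I"
    and ne: "{I \<in> S. d I = 0} \<noteq> {}"
    and a: "\<And>t. 0 \<le> t \<Longrightarrow> a t * of_real (\<Sum>I\<in>S. W I * exp (- d I * t)) =
      u * (\<Sum>I\<in>S. of_real (W I * exp (- d I * t)) * c I)"
  shows "(a \<longlongrightarrow> u * ((\<Sum>I | I \<in> S \<and> d I = 0. of_real (W I) * c I) / of_real (\<Sum>I | I \<in> S \<and> d I = 0. W I))) at_top"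
proof -
  let ?D = "\<lambda>t. \<Sum>I\<in>S. W I * exp (- d I * t)" and ?N = "\<lambda>t. \<Sum>I\<in>S. of_real (W I * exp (- d I * t)) * c I"
  have lim: "((\<lambda>t. W I * exp (- d I * t)) \<longlongrightarrow> (if d I = 0 then W I else 0)) at_top" if "I \<in> S" for I
  proof (cases "d I = 0")
    case False
    then have "- d I < 0" using d[OF that] by simp
    then have "filterlim (\<lambda>t. - d I * t) at_bot at_top"
      by (intro filterlim_tendsto_neg_mult_at_bot[OF tendsto_const _ filterlim_ident])
    then have "((\<lambda>t. exp (- d I * t)) \<longlongrightarrow> 0) at_top"
      by (rule filterlim_compose[OF exp_at_bot])
    from tendsto_mult_right_zero[OF this] False show ?thesis by simp
  qed simp
  have limN: "(?N \<longlongrightarrow> (\<Sum>I\<in>S. of_real (if d I = 0 then W I else 0) * c I)) at_top"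
    by (intro tendsto_sum tendsto_mult tendsto_of_real lim tendsto_const)
  have limD: "((\<lambda>t. complex_of_real (?D t)) \<longlongrightarrow> of_real (\<Sum>I\<in>S. if d I = 0 then W I else 0)) at_top"
    by (intro tendsto_of_real tendsto_sum lim)
  have N: "(\<Sum>I\<in>S. of_real (if d I = 0 then W I else 0) * c I) = (\<Sum>I | I \<in> S \<and> d I = 0. of_real (W I) * c I)"
    using fin by (intro sum.mono_neutral_cong_right) auto
  have D: "(\<Sum>I\<in>S. if d I = 0 then W I else 0) = (\<Sum>I | I \<in> S \<and> d I = 0. W I)"
    using fin by (intro sum.mono_neutral_cong_right) auto
  have "0 < (\<Sum>I | I \<in> S \<and> d I = 0. W I)"
    using ne fin W by (intro sum_pos) auto
  then have nz: "complex_of_real (\<Sum>I | I \<in> S \<and> d I = 0. W I) \<noteq> 0"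
    by (metis less_irrefl of_real_eq_0_iff)
  have "((\<lambda>t. u * (?N t / of_real (?D t))) \<longlongrightarrow>
      u * ((\<Sum>I | I \<in> S \<and> d I = 0. of_real (W I) * c I) / of_real (\<Sum>I | I \<in> S \<and> d I = 0. W I))) at_top"
    by (rule tendsto_mult[OF tendsto_const tendsto_divide[OF limN[unfolded N] limD[unfolded D] nz]])
  moreover have "\<forall>\<^sub>F t in at_top. u * (?N t / of_real (?D t)) = a t"
    using eventually_ge_at_top[of 0]
  proof eventually_elim
    case (elim t)
    have "0 < ?D t" using ne fin W by (intro sum_pos) auto
    then have "complex_of_real (?D t) \<noteq> 0" by (metis less_irrefl of_real_eq_0_iff)
    then have "a t = u * ?N t / of_real (?D t)"
      using a[OF elim] by (metis nonzero_mult_div_cancel_right)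
    then show ?case by simp
  qed
  ultimately show ?thesis by (rule Lim_transform_eventually)
qed

text \<open>Dividing by the dominant term, the ratio is \<open>1 + (\<Sum>\<^sub>I r\<^sub>I e\<^sub>I (b\<^sub>I - 1)) / D\<close> with
  \<open>D = 1 + \<Sum>\<^sub>I r\<^sub>I e\<^sub>I \<ge> 1\<close>. Replacing \<open>D\<close> by \<open>1\<close> in the term of \<open>I\<^sub>1\<close> costs
  \<open>O(e\<^sup>-\<^sup>2\<^sup>\<delta>\<^sup>t)\<close>.\<close>

lemma exp_ratio_expansion:
  fixes W d :: "'i \<Rightarrow> real" and c :: "'i \<Rightarrow> complex" and a :: "real \<Rightarrow> complex"
  assumes fin: "finite S" and W: "\<And>I. I \<in> S \<Longrightarrow> 0 < W I" and c: "\<And>I. I \<in> S \<Longrightarrow> norm (c I) = 1"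
    and I0: "I0 \<in> S" "d I0 = 0" and I1: "I1 \<in> S" "d I1 = \<delta>" "0 < \<delta>"
    and rest: "\<And>I. I \<in> S \<Longrightarrow> I \<noteq> I0 \<Longrightarrow> I \<noteq> I1 \<Longrightarrow> \<delta> < d I"
    and a: "\<And>t. 0 \<le> t \<Longrightarrow> a t * of_real (\<Sum>I\<in>S. W I * exp (- d I * t)) =
      u * (\<Sum>I\<in>S. of_real (W I * exp (- d I * t)) * c I)"
  shows "\<exists>\<gamma> E. \<gamma> > \<delta> \<and> E \<in> O[at_top](\<lambda>t. complex_of_real (exp (- \<gamma> * t))) \<and>
    (\<forall>t\<ge>0. a t = u * c I0 * (1 + (cnj (c I0) * c I1 - 1) * of_real (W I1 / W I0) * of_real (exp (- \<delta> * t)) + E t))"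
proof -
  define T where "T = S - {I0, I1}"
  define r where "r I = W I / W I0" for I
  define e where "e t I = r I * exp (- d I * t)" for t I
  define b where "b I = cnj (c I0) * c I" for I
  define D where "D t = 1 + (\<Sum>I\<in>S - {I0}. e t I)" for t
  define E where "E t = (\<Sum>I\<in>S - {I0}. of_real (e t I) * (b I - 1)) / of_real (D t) - of_real (e t I1) * (b I1 - 1)" for t
  \<comment> \<open>The rate \<open>2 * \<delta>\<close> comes from replacing \<open>D\<close> by 1
    in the term of \<open>I1\<close>, the other rates from the sets in \<open>T\<close>. Its
    presence also keeps the minimum meaningful when \<open>T\<close> is empty.\<close>
  define \<gamma> where "\<gamma> = Min (insert (2 * \<delta>) (d ` T))"
  have finT: "finite T" using fin by (simp add: T_def)
  have \<gamma>: "\<gamma> > \<delta>" using finT I1(3) rest by (auto simp: \<gamma>_def T_def)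
  have \<gamma>2: "\<gamma> \<le> 2 * \<delta>" and \<gamma>T: "\<And>I. I \<in> T \<Longrightarrow> \<gamma> \<le> d I" using finT by (auto simp: \<gamma>_def)
  have ne: "I1 \<noteq> I0" using I0 I1 by auto
  have S1: "S - {I0} = insert I1 T" and I1T: "I1 \<notin> T" using I1 ne by (auto simp: T_def)
  have rpos: "0 < r I" if "I \<in> S" for I using W that I0 by (simp add: r_def)
  have epos: "0 < e t I" if "I \<in> S" for t I using rpos[OF that] by (simp add: e_def)
  have D1: "1 \<le> D t" for t
  proof -
    have "0 \<le> (\<Sum>I\<in>S - {I0}. e t I)"
      by (rule sum_nonneg) (use epos in \<open>auto intro: less_imp_le\<close>)
    then show ?thesis by (simp add: D_def)
  qed
  have c0: "c I0 * cnj (c I0) = 1" using c[OF I0(1)] by (simp flip: complex_norm_square)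
  have b: "norm (b I - 1) \<le> 2" if "I \<in> S" for I
    using norm_triangle_ineq4[of "b I" 1] c[OF that] c[OF I0(1)] by (simp add: b_def norm_mult)
  have main: "a t = u * c I0 * (1 + (b I1 - 1) * of_real (e t I1) + E t)" if t: "0 \<le> t" for t
  proof -
    have W0: "W I0 \<noteq> 0" using W[OF I0(1)] by simp
    have We: "W I * exp (- d I * t) = W I0 * e t I" for I using W0 by (simp add: e_def r_def)
    have e0: "e t I0 = 1" using W0 by (simp add: e_def r_def I0)
    have sD: "(\<Sum>I\<in>S. W I * exp (- d I * t)) = W I0 * D t"
      unfolding We sum_distrib_left[symmetric] D_def by (simp add: sum.remove[OF fin I0(1)] e0)
    have "(\<Sum>I\<in>S. of_real (W I * exp (- d I * t)) * c I) = of_real (W I0) * (\<Sum>I\<in>S. of_real (e t I) * c I)"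
      unfolding We by (simp add: sum_distrib_left mult.assoc)
    also have "(\<Sum>I\<in>S. of_real (e t I) * c I) = c I0 * (\<Sum>I\<in>S. of_real (e t I) * b I)"
    proof -
      have "c I0 * (x * b I) = (c I0 * cnj (c I0)) * (x * c I)" for x I
        unfolding b_def by (simp only: mult_ac)
      then have "x * c I = c I0 * (x * b I)" for x I by (simp only: c0 mult_1)
      then show ?thesis by (simp only: sum_distrib_left)
    qed
    also have "(\<Sum>I\<in>S. of_real (e t I) * b I) = of_real (D t) + (\<Sum>I\<in>S - {I0}. of_real (e t I) * (b I - 1))"
      using c0 by (simp add: sum.remove[OF fin I0(1)] e0 D_def right_diff_distrib sum_subtractf b_def mult.commute)
    finally have "of_real (W I0) * (a t * of_real (D t)) = of_real (W I0) *
        (u * (c I0 * (of_real (D t) + (\<Sum>I\<in>S - {I0}. of_real (e t I) * (b I - 1)))))"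
      using a[OF t] unfolding sD by (simp add: mult_ac)
    then have "a t * of_real (D t) = u * (c I0 * (of_real (D t) + (\<Sum>I\<in>S - {I0}. of_real (e t I) * (b I - 1))))"
      using W0 by simp
    moreover have "complex_of_real (D t) \<noteq> 0" using D1[of t] by simp
    ultimately have "a t = u * c I0 * (1 + (\<Sum>I\<in>S - {I0}. of_real (e t I) * (b I - 1)) / of_real (D t))"
      by (simp add: field_simps)
    then show ?thesis by (simp add: E_def mult.commute)
  qed
  \<comment> \<open>The first sum bounds the sets in \<open>T\<close>, the second part the
    replacement of \<open>D\<close> by 1; each 2 bounds a \<open>norm (b I - 1)\<close>.\<close>
  define K where "K = (\<Sum>I\<in>T. r I * 2) + r I1 * 2 * (\<Sum>I\<in>S - {I0}. r I)"
  have bound: "norm (E t) \<le> K * exp (- \<gamma> * t)" if t: "0 \<le> t" for t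
  proof -
    have D0: "complex_of_real (D t) \<noteq> 0" using D1[of t] by simp
    have "E t = (of_real (e t I1) * (b I1 - 1) + (\<Sum>I\<in>T. of_real (e t I) * (b I - 1))) / of_real (D t)
        - of_real (e t I1) * (b I1 - 1)"
      unfolding E_def S1 sum.insert[OF finT I1T] ..
    moreover have "((x + y) / of_real (D t) - x) * of_real (D t) = y + x * of_real (1 - D t)" for x y :: complex
      using D0 by (simp add: field_simps)
    ultimately have ED: "E t * of_real (D t) =
        (\<Sum>I\<in>T. of_real (e t I) * (b I - 1)) + of_real (e t I1) * (b I1 - 1) * of_real (1 - D t)"
      by (simp only:)
    have "norm (E t) * D t = norm (E t * of_real (D t))"
      using D1[of t] by (simp add: norm_mult)
    also have "\<dots> = norm ((\<Sum>I\<in>T. of_real (e t I) * (b I - 1)) + of_real (e t I1) * (b I1 - 1) * of_real (1 - D t))"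
      by (simp only: ED)
    also have "\<dots> \<le> norm (\<Sum>I\<in>T. of_real (e t I) * (b I - 1)) + norm (of_real (e t I1) * (b I1 - 1) * of_real (1 - D t))"
      by (rule norm_triangle_ineq)
    also have "norm (\<Sum>I\<in>T. of_real (e t I) * (b I - 1)) \<le> (\<Sum>I\<in>T. r I * 2 * exp (- \<gamma> * t))"
    proof (rule sum_norm_le)
      fix I assume I: "I \<in> T"
      then have IS: "I \<in> S" by (simp add: T_def)
      have "norm (of_real (e t I) * (b I - 1)) = e t I * norm (b I - 1)"
        using epos[OF IS, of t] by (simp add: norm_mult)
      also have "\<dots> \<le> (r I * exp (- \<gamma> * t)) * 2"
        unfolding e_def using \<gamma>T[OF I] t rpos[OF IS] b[OF IS]
        by (intro mult_mono) (auto intro: mult_right_mono)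
      finally show "norm (of_real (e t I) * (b I - 1)) \<le> r I * 2 * exp (- \<gamma> * t)" by (simp add: mult_ac)
    qed
    also have "norm (of_real (e t I1) * (b I1 - 1) * of_real (1 - D t)) \<le>
        (r I1 * exp (- \<delta> * t)) * 2 * ((\<Sum>I\<in>S - {I0}. r I) * exp (- \<delta> * t))"
    proof -
      have "e t I \<le> r I * exp (- \<delta> * t)" if "I \<in> S - {I0}" for I
      proof -
        have "\<delta> \<le> d I" using that rest[of I] I1 by (cases "I = I1") auto
        then show ?thesis unfolding e_def using t rpos[of I] that
          by (intro mult_left_mono) (auto intro: mult_right_mono)
      qed
      then have "(\<Sum>I\<in>S - {I0}. e t I) \<le> (\<Sum>I\<in>S - {I0}. r I * exp (- \<delta> * t))" by (rule sum_mono)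
      then have "D t - 1 \<le> (\<Sum>I\<in>S - {I0}. r I) * exp (- \<delta> * t)"
        by (simp add: D_def sum_distrib_right)
      moreover have "norm (of_real (e t I1) * (b I1 - 1) * of_real (1 - D t)) = e t I1 * norm (b I1 - 1) * (D t - 1)"
      proof -
        have "norm (complex_of_real (1 - D t)) = D t - 1"
          unfolding norm_of_real using D1[of t] by simp
        moreover have "norm (complex_of_real (e t I1)) = e t I1"
          unfolding norm_of_real using epos[OF I1(1), of t] by simp
        ultimately show ?thesis by (simp only: norm_mult)
      qed
      moreover have "e t I1 = r I1 * exp (- \<delta> * t)" by (simp add: e_def I1)
      ultimately show ?thesis
        using b[OF I1(1)] rpos[OF I1(1)] D1[of t] by (auto intro!: mult_mono)
    qed
    also have "(r I1 * exp (- \<delta> * t)) * 2 * ((\<Sum>I\<in>S - {I0}. r I) * exp (- \<delta> * t)) =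
        r I1 * 2 * (\<Sum>I\<in>S - {I0}. r I) * exp (- (2 * \<delta>) * t)"
    proof -
      have "exp (- (2 * \<delta>) * t) = exp (- \<delta> * t) * exp (- \<delta> * t)"
        by (simp flip: exp_add)
      then show ?thesis by simp
    qed
    also have "\<dots> \<le> r I1 * 2 * (\<Sum>I\<in>S - {I0}. r I) * exp (- \<gamma> * t)"
    proof (rule mult_left_mono)
      show "exp (- (2 * \<delta>) * t) \<le> exp (- \<gamma> * t)"
        using mult_right_mono[OF \<gamma>2 t] by simp
      show "0 \<le> r I1 * 2 * (\<Sum>I\<in>S - {I0}. r I)"
        using rpos I1(1) by (intro mult_nonneg_nonneg sum_nonneg) (auto intro: less_imp_le)
    qed
    finally have "norm (E t) * D t \<le> K * exp (- \<gamma> * t)"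
      by (simp add: K_def distrib_right sum_distrib_right)
    \<comment> \<open>\<open>D t \<ge> 1\<close> transfers the bound from \<open>E t * D t\<close>
      to \<open>E t\<close>.\<close>
    moreover have "norm (E t) * 1 \<le> norm (E t) * D t" using D1[of t] by (intro mult_left_mono) auto
    ultimately show ?thesis by simp
  qed
  have "E \<in> O[at_top](\<lambda>t. complex_of_real (exp (- \<gamma> * t)))"
  proof (rule bigoI)
    show "\<forall>\<^sub>F t in at_top. norm (E t) \<le> K * norm (complex_of_real (exp (- \<gamma> * t)))"
      using eventually_ge_at_top[of 0] by eventually_elim (use bound in simp)
  qed
  moreover have "of_real (e t I1) = complex_of_real (W I1 / W I0) * of_real (exp (- \<delta> * t))" for t
    by (simp add: e_def r_def I1)
  ultimately show ?thesis
    using \<gamma> main unfolding b_def by (intro exI[of _ \<gamma>] exI[of _ E]) (simp add: mult.assoc)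
qed

text \<open>Equality in the triangle inequality would make the two chosen terms positively
  proportional, and unimodular numbers with that property coincide.\<close>

lemma norm_convex_combination_less:
  fixes c :: "'i \<Rightarrow> complex"
  assumes fin: "finite S" and W: "\<And>I. I \<in> S \<Longrightarrow> 0 < W I" and c: "\<And>I. I \<in> S \<Longrightarrow> norm (c I) = 1"
    and I: "I0 \<in> S" "I1 \<in> S" "c I0 \<noteq> c I1"
  shows "norm (\<Sum>I\<in>S. of_real (W I) * c I) < (\<Sum>I\<in>S. W I)"
proof -
  have ne: "I1 \<in> S - {I0}" using I by auto
  have split: "sum g S = (g I0 + g I1) + sum g (S - {I0} - {I1})" for g :: "'i \<Rightarrow> 'b::comm_monoid_add"
    using fin I(1) ne by (simp add: sum.remove[of S I0] sum.remove[of "S - {I0}" I1] add.assoc)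
  let ?x = "of_real (W I0) * c I0" and ?y = "of_real (W I1) * c I1"
  have n: "norm (of_real (W I) * c I) = W I" if "I \<in> S" for I
    using W[OF that] c[OF that] by (simp add: norm_mult)
  have "norm (?x + ?y) \<noteq> norm ?x + norm ?y"
  proof
    assume "norm (?x + ?y) = norm ?x + norm ?y"
    then have "norm ?x *\<^sub>R ?y = norm ?y *\<^sub>R ?x" by (simp only: norm_triangle_eq)
    then have "W I0 *\<^sub>R ?y = W I1 *\<^sub>R ?x" by (simp only: n[OF I(1)] n[OF I(2)])
    then show False using W[OF I(1)] W[OF I(2)] I(3) by (simp add: scaleR_conv_of_real)
  qed
  then have "norm (?x + ?y) < W I0 + W I1"
    using norm_triangle_ineq[of ?x ?y] n[OF I(1)] n[OF I(2)] by linarith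
  moreover have "norm (\<Sum>I\<in>S - {I0} - {I1}. of_real (W I) * c I) \<le> (\<Sum>I\<in>S - {I0} - {I1}. W I)"
    by (rule sum_norm_le) (use n in auto)
  ultimately show ?thesis
    unfolding split using norm_triangle_ineq[of "?x + ?y" "\<Sum>I\<in>S - {I0} - {I1}. of_real (W I) * c I"] by linarith
qed

subsection \<open>Dominant multi-indices\<close>

text \<open>By monotonicity an index below \<open>k\<close> outside \<open>Bset n lam k\<close> has
  a larger exponent, and so have all its predecessors. With the default 0 the segment
  \<open>{1..s_index n lam k}\<close> is empty.\<close>

lemma s_index_props:
  assumes anti: "antimono_on {1..n} lam"
    and k: "1 \<le> k" "k \<le> n"
  shows "s_index n lam k < k"
    and "\<And>i. i \<in> {1..n} \<Longrightarrow> lam k < lam i \<longleftrightarrow> i \<le> s_index n lam k"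
proof -
  have dec: "lam j \<le> lam i" if "1 \<le> i" "i \<le> j" "j \<le> n" for i j
    using anti that by (auto simp: monotone_on_def)
  let ?T = "{l \<in> {1..<k}. l \<notin> Bset n lam k}" and ?s = "s_index n lam k"
  have s: "?s \<in> insert 0 ?T" unfolding s_index_def by (rule Max_in) auto
  then show lt: "?s < k" using k by auto
  show "lam k < lam i \<longleftrightarrow> i \<le> ?s" if i: "i \<in> {1..n}" for i
  proof
    assume "lam k < lam i"
    then have "i < k" using dec[of k i] i k by (cases "k \<le> i") auto
    then have "i \<in> ?T" using i \<open>lam k < lam i\<close> by (auto simp: Bset_def)
    then show "i \<le> ?s" unfolding s_index_def by (intro Max_ge) auto
  next
    assume le: "i \<le> ?s"
    then have sT: "?s \<in> ?T" using s i by auto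
    then have "lam ?s \<noteq> lam k" using k by (auto simp: Bset_def)
    moreover have "lam k \<le> lam ?s" using dec[of ?s k] sT k by auto
    moreover have "lam ?s \<le> lam i" using dec[of i ?s] le i lt k by auto
    ultimately show "lam k < lam i" by simp
  qed
qed

text \<open>The decay rate of the weight of \<open>I\<close> relative to that of
  \<open>{1..k}\<close>, a set with maximal exponent sum.\<close>

definition lam_gap :: "(nat \<Rightarrow> real) \<Rightarrow> nat \<Rightarrow> nat set \<Rightarrow> real" where
  "lam_gap lam k I = sum lam {1..k} - sum lam I"

text \<open>Both sets have \<open>k\<close> elements, so \<open>lam k\<close> may be subtracted from
  every term. The indices from \<open>s + 1\<close> to \<open>k\<close> then contribute 0 and the
  common part of \<open>I\<close> and \<open>{1..s}\<close> cancels, leaving terms of known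
  sign.\<close>

lemma lam_gap_eq:
  assumes anti: "antimono_on {1..n} lam"
    and k: "1 \<le> k" "k \<le> n" and I: "I \<in> ksubsets n k"
  defines "s \<equiv> s_index n lam k"
  shows "lam_gap lam k I = (\<Sum>i\<in>{1..s} - I. lam i - lam k) + (\<Sum>i\<in>I - {1..s}. lam k - lam i)"
proof -
  have dec: "lam j \<le> lam i" if "1 \<le> i" "i \<le> j" "j \<le> n" for i j
    using anti that by (auto simp: monotone_on_def)
  note sp = s_index_props[OF anti k, folded s_def]
  have fin: "finite I" and card: "card I = k" and sub: "I \<subseteq> {1..n}"
    using I by (auto simp: ksubsets_def intro: finite_subset)
  let ?g = "\<lambda>i. lam i - lam k"
  have "lam_gap lam k I = sum ?g {1..k} - sum ?g I"
    by (simp add: lam_gap_def sum_subtractf card)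
  also have "sum ?g {1..k} = sum ?g {1..s}"
  proof (rule sum.mono_neutral_right)
    show "\<forall>i\<in>{1..k} - {1..s}. ?g i = 0"
    proof
      fix i assume i: "i \<in> {1..k} - {1..s}"
      then show "?g i = 0" using sp(2)[of i] dec[of i k] k by auto
    qed
  qed (use sp(1) in auto)
  also have "sum ?g {1..s} = sum ?g ({1..s} - I) + sum ?g ({1..s} \<inter> I)"
    using sum.Int_Diff[of "{1..s}" ?g I] by simp
  also have "sum ?g I = sum ?g (I - {1..s}) + sum ?g ({1..s} \<inter> I)"
    using sum.Int_Diff[OF fin, of ?g "{1..s}"] by (simp add: Int_commute)
  finally show ?thesis
    by (simp add: sum_subtractf)
qed

text \<open>Omitting an index up to \<open>s_index n lam k\<close> has a strictly positive cost;
  including a later one is free exactly within \<open>Bset n lam k\<close>.\<close>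

lemma lam_gap_nonneg:
  assumes anti: "antimono_on {1..n} lam"
    and k: "1 \<le> k" "k \<le> n" and I: "I \<in> ksubsets n k"
  shows "0 \<le> lam_gap lam k I"
    and "lam_gap lam k I = 0 \<longleftrightarrow> {1..s_index n lam k} \<subseteq> I \<and> I - {1..s_index n lam k} \<subseteq> Bset n lam k"
proof -
  let ?s = "s_index n lam k"
  note sp = s_index_props[OF anti k]
  have fin: "finite I" and sub: "I \<subseteq> {1..n}"
    using I by (auto simp: ksubsets_def intro: finite_subset)
  have pos: "0 < lam i - lam k" if "i \<in> {1..?s} - I" for i
    using sp(2)[of i] sp(1) that k by auto
  have nn: "0 \<le> lam k - lam i" if "i \<in> I - {1..?s}" for i
    using sp(2)[of i] that sub by (auto simp: not_le[symmetric])
  have A: "0 \<le> (\<Sum>i\<in>{1..?s} - I. lam i - lam k)" by (rule sum_nonneg) (use pos in \<open>simp add: less_imp_le\<close>)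
  have B: "0 \<le> (\<Sum>i\<in>I - {1..?s}. lam k - lam i)" by (rule sum_nonneg) (use nn in simp)
  show "0 \<le> lam_gap lam k I"
    unfolding lam_gap_eq[OF anti k I] using A B by simp
  have "lam_gap lam k I = 0 \<longleftrightarrow>
      (\<Sum>i\<in>{1..?s} - I. lam i - lam k) = 0 \<and> (\<Sum>i\<in>I - {1..?s}. lam k - lam i) = 0"
    unfolding lam_gap_eq[OF anti k I] using A B by linarith
  also have "(\<Sum>i\<in>{1..?s} - I. lam i - lam k) = 0 \<longleftrightarrow> (\<forall>i\<in>{1..?s} - I. lam i - lam k = 0)"
    by (rule sum_nonneg_eq_0_iff) (use pos in \<open>auto intro: less_imp_le\<close>)
  also have "(\<forall>i\<in>{1..?s} - I. lam i - lam k = 0) \<longleftrightarrow> {1..?s} \<subseteq> I"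
    using pos by fastforce
  also have "(\<Sum>i\<in>I - {1..?s}. lam k - lam i) = 0 \<longleftrightarrow> (\<forall>i\<in>I - {1..?s}. lam k - lam i = 0)"
    by (rule sum_nonneg_eq_0_iff) (use nn fin in auto)
  also have "(\<forall>i\<in>I - {1..?s}. lam k - lam i = 0) \<longleftrightarrow> I - {1..?s} \<subseteq> Bset n lam k"
    using sub by (auto simp: Bset_def)
  finally show "lam_gap lam k I = 0 \<longleftrightarrow> {1..?s} \<subseteq> I \<and> I - {1..?s} \<subseteq> Bset n lam k" .
qed

lemma dominant_ksubsets:
  assumes anti: "antimono_on {1..n} lam"
    and k: "1 \<le> k" "k \<le> n"
  shows "bij_betw (\<lambda>I. {1..s_index n lam k} \<union> I) (Isets n lam k) {I \<in> ksubsets n k. lam_gap lam k I = 0}"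
    and "Bset n lam k \<inter> {1..s_index n lam k} = {}"
proof -
  let ?s = "s_index n lam k"
  note sp = s_index_props[OF anti k]
  show disj: "Bset n lam k \<inter> {1..?s} = {}"
    using sp by (fastforce simp: Bset_def)
  have Bn: "Bset n lam k \<subseteq> {1..n}" by (auto simp: Bset_def)
  show "bij_betw (\<lambda>I. {1..?s} \<union> I) (Isets n lam k) {I \<in> ksubsets n k. lam_gap lam k I = 0}"
  proof (rule bij_betw_byWitness[where f' = "\<lambda>I. I - {1..?s}"])
    show "\<forall>I\<in>Isets n lam k. {1..?s} \<union> I - {1..?s} = I"
      using disj by (auto simp: Isets_def)
    show "\<forall>I\<in>{I \<in> ksubsets n k. lam_gap lam k I = 0}. {1..?s} \<union> (I - {1..?s}) = I"
      using lam_gap_nonneg(2)[OF anti k] by blast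
    show "(\<lambda>I. {1..?s} \<union> I) ` Isets n lam k \<subseteq> {I \<in> ksubsets n k. lam_gap lam k I = 0}"
    proof (clarify, intro conjI)
      fix I assume I: "I \<in> Isets n lam k"
      then have sub: "I \<subseteq> Bset n lam k" and card: "card I = k - ?s" by (auto simp: Isets_def)
      have "finite I" using sub Bn by (meson finite_atLeastAtMost finite_subset)
      moreover have "{1..?s} \<inter> I = {}" using disj sub by blast
      ultimately have "card ({1..?s} \<union> I) = k" using card sp(1) by (simp add: card_Un_disjoint)
      moreover have "{1..?s} \<union> I \<subseteq> {1..n}" using sub Bn sp(1) k by auto
      ultimately show mem: "{1..?s} \<union> I \<in> ksubsets n k" by (simp add: ksubsets_def)
      show "lam_gap lam k ({1..?s} \<union> I) = 0"
        unfolding lam_gap_nonneg(2)[OF anti k mem] using sub by blast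
    qed
    show "(\<lambda>I. I - {1..?s}) ` {I \<in> ksubsets n k. lam_gap lam k I = 0} \<subseteq> Isets n lam k"
    proof clarify
      fix I assume I: "I \<in> ksubsets n k" "lam_gap lam k I = 0"
      then have sub: "{1..?s} \<subseteq> I" "I - {1..?s} \<subseteq> Bset n lam k"
        using lam_gap_nonneg(2)[OF anti k I(1)] by auto
      have "card (I - {1..?s}) = k - ?s"
        using I sub by (simp add: card_Diff_subset ksubsets_def)
      then show "I - {1..?s} \<in> Isets n lam k" using sub by (simp add: Isets_def)
    qed
  qed
qed

section \<open>The leading set and its runner-up\<close>

lemma initial_segment_ksubset: "k \<le> n \<Longrightarrow> {1..k} \<in> ksubsets n k"
  by (simp add: ksubsets_def)

lemma swapped_segment_ksubset: "1 \<le> k \<Longrightarrow> k + 1 \<le> n \<Longrightarrow> insert (k + 1) {1..k - 1} \<in> ksubsets n k"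
  by (auto simp: ksubsets_def)

lemma initial_segment_insert: "1 \<le> k \<Longrightarrow> {1..k} = insert k {1..k - 1 :: nat}"
  by auto

lemma lam_gap_swapped:
  assumes "1 \<le> k"
  shows "lam_gap lam k (insert (k + 1) {1..k - 1}) = lam k - lam (k + 1)"
  unfolding lam_gap_def initial_segment_insert[OF assms] using assms by simp

text \<open>Passing from \<open>{1..k}\<close> to \<open>I\<close> exchanges equally many indices,
  each exchange costing at least \<open>lam k - lam (k + 1)\<close>. Two exchanges cost at least
  twice that; a single one attains the minimum only for \<open>k\<close> against
  \<open>k + 1\<close>.\<close>

lemma lam_gap_distinct:
  assumes anti: "antimono_on {1..n} lam"
    and inj: "inj_on lam {1..n}" and k: "1 \<le> k" "k + 1 \<le> n" and I: "I \<in> ksubsets n k"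
    and ne: "I \<noteq> {1..k}" "I \<noteq> insert (k + 1) {1..k - 1}"
  shows "lam k - lam (k + 1) < lam_gap lam k I"
proof -
  have dec: "lam j \<le> lam i" if "1 \<le> i" "i \<le> j" "j \<le> n" for i j
    using anti that by (auto simp: monotone_on_def)
  let ?J = "{1..k}" and ?\<delta> = "lam k - lam (k + 1)"
  have fin: "finite I" and card: "card I = k" and sub: "I \<subseteq> {1..n}"
    using I by (auto simp: ksubsets_def intro: finite_subset)
  have strict: "lam j < lam i" if "1 \<le> i" "i < j" "j \<le> n" for i j
    using dec[of i j] inj_onD[OF inj, of i j] that by fastforce
  have \<delta>: "0 < ?\<delta>" using strict[of k "k + 1"] k by simp
  have up: "lam k \<le> lam i" if "i \<in> ?J - I" for i using dec[of i k] that k by auto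
  have lo: "lam i \<le> lam (k + 1)" if "i \<in> I - ?J" for i using dec[of "k + 1" i] that k sub by auto
  have q: "card (?J - I) = card (I - ?J)"
    using card_Diff_subset_Int[of ?J I] card_Diff_subset_Int[of I ?J] fin card by (simp add: Int_commute)
  have q1: "1 \<le> card (I - ?J)"
  proof -
    have "I - ?J \<noteq> {}"
    proof
      assume "I - ?J = {}"
      then have "I = ?J" using card by (intro card_subset_eq) auto
      then show False using ne by simp
    qed
    then show ?thesis using fin by (simp add: Suc_le_eq card_gt_0_iff)
  qed
  have "lam_gap lam k I = sum lam (?J - I) - sum lam (I - ?J)"
    using sum.Int_Diff[of ?J lam I] sum.Int_Diff[OF fin, of lam ?J] by (simp add: lam_gap_def Int_commute)
  \<comment> \<open>The values \<open>lam k\<close> and \<open>lam (k + 1)\<close> are inserted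
    between removed and added indices.\<close>
  then have gap: "lam_gap lam k I = (\<Sum>i\<in>?J - I. lam i - lam k) + (\<Sum>i\<in>I - ?J. lam (k + 1) - lam i)
      + of_nat (card (I - ?J)) * ?\<delta>"
    unfolding sum_subtractf sum_constant q by (simp add: right_diff_distrib)
  have A: "0 \<le> (\<Sum>i\<in>?J - I. lam i - lam k)" by (rule sum_nonneg) (use up in simp)
  have B: "0 \<le> (\<Sum>i\<in>I - ?J. lam (k + 1) - lam i)" by (rule sum_nonneg) (use lo in simp)
  show ?thesis
  proof (cases "card (I - ?J) = 1")
    case False
    then have "2 \<le> real (card (I - ?J))" using q1 by linarith
    then have "2 * ?\<delta> \<le> real (card (I - ?J)) * ?\<delta>" using \<delta> by (intro mult_right_mono) auto
    moreover have "r < x + y + p" if "2 * r \<le> p" "0 \<le> x" "0 \<le> y" "0 < r" for r x y p :: real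
      using that by linarith
    ultimately show ?thesis unfolding gap using A B \<delta> by blast
  next
    case True
    then obtain a b where ab: "?J - I = {a}" "I - ?J = {b}" using q by (auto simp: card_1_singleton_iff)
    have abk: "a \<noteq> k \<or> b \<noteq> k + 1"
    proof (rule ccontr)
      assume "\<not> (a \<noteq> k \<or> b \<noteq> k + 1)"
      then have *: "?J - I = {k}" "I - ?J = {k + 1}" using ab by auto
      have "I = (?J - (?J - I)) \<union> (I - ?J)" by blast
      also have "\<dots> = insert (k + 1) {1..k - 1}" unfolding * using k by auto
      finally show False using ne by simp
    qed
    have mem: "a \<in> ?J" "b \<in> I" "b \<notin> ?J" using ab by blast+
    have "lam k < lam a \<or> lam b < lam (k + 1)"
    proof (cases "a = k")
      case False
      then show ?thesis using strict[of a k] mem(1) k by simp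
    next
      case True
      then have "b \<noteq> k + 1" using abk by simp
      moreover have "1 \<le> b" "b \<le> n" using mem(2) sub by auto
      ultimately show ?thesis using strict[of "k + 1" b] mem(3) by simp
    qed
    moreover have "lam k \<le> lam a" by (rule up) (unfold ab(1), simp)
    moreover have "lam b \<le> lam (k + 1)" by (rule lo) (unfold ab(2), simp)
    moreover have "lam_gap lam k I = (lam a - lam k) + (lam (k + 1) - lam b) + ?\<delta>"
      unfolding gap unfolding ab by simp
    ultimately show ?thesis by linarith
  qed
qed

lemma tendsto_at_top_iff_eq:
  fixes g :: "real \<Rightarrow> real"
  assumes "(g \<longlongrightarrow> l) at_top"
  shows "(g \<longlongrightarrow> a) at_top \<longleftrightarrow> l = a"
proof
  assume "(g \<longlongrightarrow> a) at_top"
  with assms show "l = a" by (rule tendsto_unique[OF trivial_limit_at_top_linorder])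
qed (use assms in simp)

text \<open>Taking \<open>w\<close> as the conjugated nodes gives the numerator of the limit,
  \<open>w = 1\<close> the denominator. The masses of \<open>J\<close> then cancel, while the
  product of \<open>w\<close> over \<open>J\<close> remains as prefactor.\<close>

lemma weighted_sum_dominant:
  fixes lam \<mu> :: "nat \<Rightarrow> real" and z w :: "nat \<Rightarrow> complex"
  assumes anti: "antimono_on {1..n} lam" and k: "1 \<le> k" "k \<le> n"
  defines "J \<equiv> {1..s_index n lam k}"
  shows "(\<Sum>I | I \<in> ksubsets n k \<and> lam_gap lam k I = 0. of_real (heine_weight z \<mu> I) * (\<Prod>i\<in>I. w i)) =
    of_real (\<Prod>i\<in>J. \<mu> i) * (\<Prod>i\<in>J. w i) *
    (\<Sum>I\<in>Isets n lam k. of_real ((norm (Delta z (J \<union> I)))\<^sup>2 * (\<Prod>i\<in>I. \<mu> i)) * (\<Prod>i\<in>I. w i))"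
proof -
  have "(\<Sum>I | I \<in> ksubsets n k \<and> lam_gap lam k I = 0. of_real (heine_weight z \<mu> I) * (\<Prod>i\<in>I. w i)) =
      (\<Sum>I\<in>Isets n lam k. of_real (heine_weight z \<mu> (J \<union> I)) * (\<Prod>i\<in>J \<union> I. w i))"
    by (rule sum.reindex_bij_betw[OF dominant_ksubsets(1)[OF anti k, folded J_def], symmetric])
  also have "\<dots> = (\<Sum>I\<in>Isets n lam k. of_real (\<Prod>i\<in>J. \<mu> i) * (\<Prod>i\<in>J. w i) *
      (of_real ((norm (Delta z (J \<union> I)))\<^sup>2 * (\<Prod>i\<in>I. \<mu> i)) * (\<Prod>i\<in>I. w i)))"
  proof (rule sum.cong[OF refl])
    fix I assume I: "I \<in> Isets n lam k"
    have sub: "I \<subseteq> Bset n lam k" using I by (simp add: Isets_def)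
    have fin: "finite I" by (rule finite_subset[OF sub]) (simp add: Bset_def)
    have disj: "J \<inter> I = {}" using sub dominant_ksubsets(2)[OF anti k] unfolding J_def by blast
    have finJ: "finite J" by (simp add: J_def)
    have \<mu>: "(\<Prod>i\<in>J \<union> I. \<mu> i) = (\<Prod>i\<in>J. \<mu> i) * (\<Prod>i\<in>I. \<mu> i)"
      and w: "(\<Prod>i\<in>J \<union> I. w i) = (\<Prod>i\<in>J. w i) * (\<Prod>i\<in>I. w i)"
      by (rule prod.union_disjoint[OF finJ fin disj])+
    show "of_real (heine_weight z \<mu> (J \<union> I)) * (\<Prod>i\<in>J \<union> I. w i) = of_real (\<Prod>i\<in>J. \<mu> i) * (\<Prod>i\<in>J. w i) *
      (of_real ((norm (Delta z (J \<union> I)))\<^sup>2 * (\<Prod>i\<in>I. \<mu> i)) * (\<Prod>i\<in>I. w i))"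
      unfolding heine_weight_def \<mu> w of_real_mult by (simp only: mult_ac)
  qed
  finally show ?thesis by (simp only: sum_distrib_left)
qed

theorem theorem7p3:
  fixes f :: "complex poly"
    and C :: "real \<Rightarrow> complex^'n::{finite,linorder}^'n::{finite,linorder}"
    and \<alpha> :: "real \<Rightarrow> nat \<Rightarrow> complex"
    and z :: "nat \<Rightarrow> complex"
    and \<mu> lam :: "nat \<Rightarrow> real"
    and n k :: nat
  assumes n_def: "n = CARD('n)"
    and flow: "hamiltonian_flow (\<lambda>B. Im (trace (poly_mat f B))) C"
    and verb: "\<And>t. 0 \<le> t \<Longrightarrow> verblunsky n (\<alpha> t)"
    and cmv: "\<And>t. 0 \<le> t \<Longrightarrow> C t = cmv (\<alpha> t)"
    and spec: "spectral_data (C 0) z \<mu>"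
    and lam_def: "\<And>j. lam j = 2 * Re (z j * poly (pderiv f) (z j))"
    and lam_decreasing: "\<And>i j. 1 \<le> i \<Longrightarrow> i \<le> j \<Longrightarrow> j \<le> n \<Longrightarrow> lam j \<le> lam i"
    and k: "1 \<le> k" "k \<le> n - 1"
  shows
    "((\<lambda>t. \<alpha> t (k - 1)) \<longlongrightarrow>
        (-1) ^ (k - 1) * (\<Prod>j\<in>{1..s_index n lam k}. cnj (z j)) *
        ((\<Sum>I\<in>Isets n lam k.
            complex_of_real ((norm (Delta z ({1..s_index n lam k} \<union> I)))\<^sup>2 * (\<Prod>i\<in>I. \<mu> i))
              * (\<Prod>i\<in>I. cnj (z i))) /
         (\<Sum>I\<in>Isets n lam k.
            complex_of_real ((norm (Delta z ({1..s_index n lam k} \<union> I)))\<^sup>2 * (\<Prod>i\<in>I. \<mu> i)))))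
       at_top
     \<and> (((\<lambda>t. norm (\<alpha> t (k - 1))) \<longlongrightarrow> 1) at_top \<longleftrightarrow> lam k > lam (k + 1))
     \<and> (inj_on lam {1..n} \<longrightarrow>
          (\<exists>\<gamma> E. \<gamma> > lam k - lam (k + 1) \<and> lam k - lam (k + 1) > 0 \<and>
             E \<in> O[at_top](\<lambda>t. complex_of_real (exp (- \<gamma> * t))) \<and>
             (\<forall>t\<ge>0. \<alpha> t (k - 1) =
                (-1) ^ (k - 1) * (\<Prod>j\<in>{1..k}. cnj (z j)) *
                (1 + (z k * cnj (z (k + 1)) - 1)
                       * complex_of_real (\<mu> (k + 1) / \<mu> k
                           * (\<Prod>l\<in>{1..k-1}. (norm ((z (k + 1) - z l) / (z k - z l)))\<^sup>2))
                       * complex_of_real (exp (- (lam k - lam (k + 1)) * t))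
                   + E t))))"
proof -
  have verb': "verblunsky CARD('n) (\<alpha> t)" if "0 \<le> t" for t
    using verb[OF that] by (simp add: n_def)
  note evo = verblunsky_evolution[where \<alpha> = \<alpha>, OF flow verb' cmv spec lam_def, folded n_def]
  have inj: "inj_on z {1..n}" by (rule evo(1))
  have mu: "0 < \<mu> j" if "j \<in> {1..n}" for j by (rule evo(2)) (use that in auto)
  have circ: "z j * cnj (z j) = 1" if "j \<in> {1..n}" for j by (rule evo(3)) (use that in auto)
  have n1z: "norm (z j) = 1" if "j \<in> {1..n}" for j
  proof -
    have "(norm (z j))\<^sup>2 = 1"
      using circ[OF that] by (metis complex_norm_square of_real_eq_1_iff)
    then show ?thesis by (simp add: abs_square_eq_1)
  qed
  have anti: "antimono_on {1..n} lam"
    unfolding monotone_on_def using lam_decreasing by auto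
  have kn: "k \<le> n" "k + 1 \<le> n" using k by auto
  let ?S = "ksubsets n k" and ?W = "heine_weight z \<mu>" and ?d = "lam_gap lam k"
    and ?c = "\<lambda>I. \<Prod>i\<in>I. cnj (z i)" and ?u = "(-1 :: complex) ^ (k - 1)"
  let ?I0 = "{1..k}" and ?I1 = "insert (k + 1) {1..k - 1}"
  let ?M = "{I \<in> ?S. ?d I = 0}"
  have W: "0 < ?W I" if "I \<in> ?S" for I by (rule heine_weight_pos[OF inj mu that])
  have c1: "norm (?c I) = 1" if "I \<in> ?S" for I
    using that n1z by (auto simp: ksubsets_def prod_norm[symmetric] intro!: prod.neutral)
  have d: "0 \<le> ?d I" if "I \<in> ?S" for I by (rule lam_gap_nonneg(1)[OF anti k(1) kn(1) that])
  have I0: "?I0 \<in> ?S" by (rule initial_segment_ksubset[OF kn(1)])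
  have I1: "?I1 \<in> ?S" by (rule swapped_segment_ksubset[OF k(1) kn(2)])
  have d0: "?d ?I0 = 0" by (simp add: lam_gap_def)
  have d1: "?d ?I1 = lam k - lam (k + 1)" by (rule lam_gap_swapped[OF k(1)])
  have M0: "?I0 \<in> ?M" using I0 d0 by simp
  \<comment> \<open>Dividing by the exponential of \<open>{1..k}\<close>, the largest one, replaces
    exponents by deficits.\<close>
  have a: "\<alpha> t (k - 1) * of_real (\<Sum>I\<in>?S. ?W I * exp (- ?d I * t)) =
      ?u * (\<Sum>I\<in>?S. of_real (?W I * exp (- ?d I * t)) * ?c I)" if t: "0 \<le> t" for t
  proof -
    let ?e = "exp (sum lam ?I0 * t)"
    have e: "?W I * exp (sum lam I * t) = ?e * (?W I * exp (- ?d I * t))" for I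
      by (simp add: lam_gap_def left_diff_distrib flip: exp_add)
    have "\<alpha> t (k - 1) * of_real (\<Sum>I\<in>?S. ?W I * exp (sum lam I * t)) =
        ?u * (\<Sum>I\<in>?S. of_real (?W I * exp (sum lam I * t)) * ?c I)"
      by (rule evo(4)) (use t k in auto)
    then have "\<alpha> t (k - 1) * (of_real ?e * of_real (\<Sum>I\<in>?S. ?W I * exp (- ?d I * t))) =
        ?u * (of_real ?e * (\<Sum>I\<in>?S. of_real (?W I * exp (- ?d I * t)) * ?c I))"
      unfolding e sum_distrib_left[symmetric] of_real_mult[of ?e] mult.assoc .
    then have "of_real ?e * (\<alpha> t (k - 1) * of_real (\<Sum>I\<in>?S. ?W I * exp (- ?d I * t))) =
        of_real ?e * (?u * (\<Sum>I\<in>?S. of_real (?W I * exp (- ?d I * t)) * ?c I))"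
      by (simp only: mult.left_commute)
    then show ?thesis by (subst (asm) mult_cancel_left) auto
  qed
  let ?L = "?u * ((\<Sum>I\<in>?M. of_real (?W I) * ?c I) / of_real (\<Sum>I\<in>?M. ?W I))"
  have lim: "((\<lambda>t. \<alpha> t (k - 1)) \<longlongrightarrow> ?L) at_top"
    by (rule exp_ratio_limit[where d = ?d]) (use W d M0 a in auto)
  let ?J = "{1..s_index n lam k}"
  let ?num = "\<Sum>I\<in>Isets n lam k. complex_of_real ((norm (Delta z (?J \<union> I)))\<^sup>2 * (\<Prod>i\<in>I. \<mu> i)) * ?c I"
    and ?den = "\<Sum>I\<in>Isets n lam k. complex_of_real ((norm (Delta z (?J \<union> I)))\<^sup>2 * (\<Prod>i\<in>I. \<mu> i))"
  have L: "?L = ?u * ?c ?J * (?num / ?den)"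
  proof -
    let ?m = "complex_of_real (\<Prod>i\<in>?J. \<mu> i)"
    have sn: "s_index n lam k \<le> n" using s_index_props(1)[OF anti k(1) kn(1)] kn by simp
    have "(\<Prod>i\<in>?J. \<mu> i) \<noteq> 0"
      using mu sn by (fastforce simp: prod_zero_iff)
    then have m: "?m \<noteq> 0" by (simp only: of_real_eq_0_iff not_False_eq_True)
    have num: "(\<Sum>I\<in>?M. of_real (?W I) * ?c I) = ?m * ?c ?J * ?num"
      by (rule weighted_sum_dominant[OF anti k(1) kn(1)])
    have "of_real (\<Sum>I\<in>?M. ?W I) = ?m * ?den"
      using weighted_sum_dominant[OF anti k(1) kn(1), where w = "\<lambda>_. 1" and z = z and \<mu> = \<mu>]
      by simp
    then show ?thesis unfolding num using m by simp
  qed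
  have norm_lim: "((\<lambda>t. norm (\<alpha> t (k - 1))) \<longlongrightarrow> norm ?L) at_top" by (rule tendsto_norm[OF lim])
  have finM: "finite ?M" by simp
  have posM: "0 < (\<Sum>I\<in>?M. ?W I)" by (rule sum_pos[OF finM]) (use M0 W in auto)
  have normL: "norm ?L = norm (\<Sum>I\<in>?M. of_real (?W I) * ?c I) / (\<Sum>I\<in>?M. ?W I)"
    using posM by (simp only: norm_mult norm_divide norm_power norm_minus_cancel norm_one power_one mult_1 norm_of_real abs_of_pos)
  have iff: "norm ?L = 1 \<longleftrightarrow> lam k > lam (k + 1)"
  proof
    assume gt: "lam k > lam (k + 1)"
    \<comment> \<open>A drop after \<open>k\<close> confines \<open>Bset n lam k\<close> to indices
      up to \<open>k\<close>; a dominant set then lies in \<open>{1..k}\<close> and equals it by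
      cardinality.\<close>
    have "I = ?I0" if I: "I \<in> ?M" for I
    proof -
      have "I - ?J \<subseteq> Bset n lam k" and sub: "I \<subseteq> {1..n}" and card: "card I = k"
        using I lam_gap_nonneg(2)[OF anti k(1) kn(1), of I] by (auto simp: ksubsets_def)
      moreover have "i \<le> k" if "i \<in> Bset n lam k" for i
        using lam_decreasing[of "k + 1" i] that gt by (cases "i \<le> k") (auto simp: Bset_def)
      moreover have "?J \<subseteq> ?I0" using s_index_props(1)[OF anti k(1) kn(1)] by auto
      ultimately have "I \<subseteq> ?I0" by fastforce
      then show ?thesis using card by (intro card_subset_eq) auto
    qed
    then have "?M = {?I0}" using M0 by blast
    then show "norm ?L = 1"
      unfolding normL using W[OF I0] c1[OF I0] by (simp add: norm_mult)
  next
    assume L1: "norm ?L = 1"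
    show "lam k > lam (k + 1)"
    proof (rule ccontr)
      assume "\<not> lam k > lam (k + 1)"
      then have eq: "lam (k + 1) = lam k" using lam_decreasing[of k "k + 1"] k(1) kn(2) by simp
      \<comment> \<open>Without a drop, exchanging \<open>k\<close> for \<open>k + 1\<close> is free
        and gives a second dominant set, whose product differs in one factor only.\<close>
      have M1: "?I1 \<in> ?M" using I1 d1 eq by simp
      have "?c ?I0 \<noteq> ?c ?I1"
      proof
        assume "?c ?I0 = ?c ?I1"
        then have "cnj (z k) * ?c {1..k - 1} = cnj (z (k + 1)) * ?c {1..k - 1}"
          unfolding initial_segment_insert[OF k(1)] using k(1) by simp
        moreover have "?c {1..k - 1} \<noteq> 0"
          using n1z kn by (fastforce simp: prod_zero_iff)
        ultimately have "z k = z (k + 1)" by simp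
        then show False using inj_onD[OF inj, of k "k + 1"] k(1) kn by simp
      qed
      then have "norm (\<Sum>I\<in>?M. of_real (?W I) * ?c I) < (\<Sum>I\<in>?M. ?W I)"
        by (intro norm_convex_combination_less[OF finM _ _ M0 M1]) (use W c1 in auto)
      then show False using L1 posM unfolding normL by simp
    qed
  qed
  have "((\<lambda>t. norm (\<alpha> t (k - 1))) \<longlongrightarrow> 1) at_top \<longleftrightarrow> norm ?L = 1"
    by (rule tendsto_at_top_iff_eq[OF norm_lim])
  then have part2: "((\<lambda>t. norm (\<alpha> t (k - 1))) \<longlongrightarrow> 1) at_top \<longleftrightarrow> lam k > lam (k + 1)"
    using iff by (rule trans)
  let ?r = "\<mu> (k + 1) / \<mu> k * (\<Prod>l\<in>{1..k - 1}. (norm ((z (k + 1) - z l) / (z k - z l)))\<^sup>2)"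
  have r: "?W ?I1 / ?W ?I0 = ?r"
  proof -
    let ?K = "{1..k - 1}"
    have K: "finite ?K" "k \<notin> ?K" "k + 1 \<notin> ?K" using k(1) by auto
    \<comment> \<open>Both leading sets add one point to \<open>{1..k - 1}\<close>, whose own weight
      cancels in the quotient.\<close>
    have "?W (insert x ?K) = ?W ?K * (\<mu> x * (\<Prod>l\<in>?K. (norm (z x - z l))\<^sup>2))" if "x \<notin> ?K" for x
      unfolding heine_weight_def norm_Delta_insert[OF K(1) that] prod.insert[OF K(1) that] by (simp only: mult_ac)
    note ins = this[OF K(2)] this[OF K(3)]
    have "?K \<in> ksubsets n (k - 1)" using kn by (intro initial_segment_ksubset) simp
    from heine_weight_pos[OF inj mu this] have "0 < ?W ?K" .
    then have "?W ?K \<noteq> 0" by linarith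
    then have "?W ?I1 / ?W ?I0 = (\<mu> (k + 1) * (\<Prod>l\<in>?K. (norm (z (k + 1) - z l))\<^sup>2)) / (\<mu> k * (\<Prod>l\<in>?K. (norm (z k - z l))\<^sup>2))"
      unfolding initial_segment_insert[OF k(1)] ins by (rule mult_divide_mult_cancel_left)
    then show ?thesis by (simp only: norm_divide power_divide prod_dividef times_divide_times_eq)
  qed
  have c10: "cnj (?c ?I0) * ?c ?I1 = z k * cnj (z (k + 1))"
  proof -
    let ?K = "{1..k - 1}"
    have K: "finite ?K" "k \<notin> ?K" "k + 1 \<notin> ?K" using k(1) by auto
    have "cnj (?c ?K) * ?c ?K = (\<Prod>i\<in>?K. z i * cnj (z i))" by (simp add: prod.distrib)
    also have "\<dots> = 1" using circ kn by (intro prod.neutral) auto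
    finally have one: "cnj (?c ?K) * ?c ?K = 1" .
    have "cnj (?c ?I0) * ?c ?I1 = (cnj (?c ?K) * ?c ?K) * (z k * cnj (z (k + 1)))"
      unfolding initial_segment_insert[OF k(1)] prod.insert[OF K(1,2)] prod.insert[OF K(1,3)]
      by (simp only: complex_cnj_mult complex_cnj_cnj mult_ac)
    then show ?thesis unfolding one by simp
  qed
  have part3: "\<exists>\<gamma> E. \<gamma> > lam k - lam (k + 1) \<and> lam k - lam (k + 1) > 0 \<and>
             E \<in> O[at_top](\<lambda>t. complex_of_real (exp (- \<gamma> * t))) \<and>
             (\<forall>t\<ge>0. \<alpha> t (k - 1) = ?u * ?c ?I0 *
                (1 + (z k * cnj (z (k + 1)) - 1) * complex_of_real ?r
                  * complex_of_real (exp (- (lam k - lam (k + 1)) * t)) + E t))"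
    if injl: "inj_on lam {1..n}"
  proof -
    have "lam (k + 1) \<noteq> lam k" using inj_onD[OF injl, of "k + 1" k] k(1) kn by auto
    then have pos: "0 < lam k - lam (k + 1)" using lam_decreasing[of k "k + 1"] k(1) kn(2) by simp
    have "\<exists>\<gamma> E. \<gamma> > lam k - lam (k + 1) \<and> E \<in> O[at_top](\<lambda>t. complex_of_real (exp (- \<gamma> * t))) \<and>
        (\<forall>t\<ge>0. \<alpha> t (k - 1) = ?u * ?c ?I0 * (1 + (cnj (?c ?I0) * ?c ?I1 - 1) * of_real (?W ?I1 / ?W ?I0)
          * of_real (exp (- (lam k - lam (k + 1)) * t)) + E t))"
    \<comment> \<open>The dominant set is \<open>{1..k}\<close>, the runner-up has \<open>k\<close>
      replaced by \<open>k + 1\<close>, and all others decay strictly faster.\<close>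
    proof (rule exp_ratio_expansion[OF finite_ksubsets W c1 I0 d0 I1 d1 pos _ a])
      show "lam k - lam (k + 1) < ?d I" if "I \<in> ?S" "I \<noteq> ?I0" "I \<noteq> ?I1" for I
        by (rule lam_gap_distinct[OF anti injl k(1) kn(2) that])
    qed
    then show ?thesis unfolding c10 r using pos by blast
  qed
  show ?thesis
    using lim[unfolded L] part2 part3 by blast
qed

end
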